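(* There exist two infinite compact sets $K_1,K_2\subset\mathbb R$ such that $K_1$ has the extension property, $K_2$ does not have the extension property, and $$\frac{M_n(K_2)}{M_n(K_1)}\to0\quad\text{as } n\to\infty .$$
   Context: For an infinite compact set $K$ let $\mathcal P_n$ be the set of polynomials of degree at most $n$ (in one complex variable), $|P|_{0,K}=\sup_K|P|$, and let the Markov factors be $M_n(K)=\inf\{M: |P'|_{0,K}\le M|P|_{0,K}\ \text{for all } P\in\mathcal P_n\}$, $n\in\mathbb N$. Extension property: for a perfect compact set $K\subset\mathbb R$, $\mathcal E(K)$ is the Fréchet space of Whitney functions on $K$, i.e. of traces $f=F|_K$ of functions $F\in C^\infty(\mathbb R)$ (since $K$ is perfect, $f$ determines the derivatives $f^{(k)}=F^{(k)}|_K$), with the topology given by the norms $$\|f\|_q=|f|_{q,K}+\sup\Big\{\frac{|(R_y^qf)^{(k)}(x)|}{|x-y|^{q-k}}:x,y\in K,\ x\ne y,\ k=0,\dots,q\Big\},\quad q=0,1,2,\dots,$$ where $|f|_{q,K}=\sup\{|f^{(k)}(x)|:x\in K,k\le q\}$ and $R_y^qf=f-T_y^qf$ is the Taylor remainder. $K$ has the extension property if there is a continuous linear operator $W:\mathcal E(K)\to C^\infty(\mathbb R)$ with $W(f)|_K=f$ for all $f\in\mathcal E(K)$. The paper considers only perfect compact sets; $K_1,K_2$ are understood to be perfect. *)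

theory Defs
  imports "HOL-Analysis.Analysis" "HOL-Computational_Algebra.Polynomial"
begin

definition poly_sup_norm :: "complex set \<Rightarrow> complex poly \<Rightarrow> real" where
  "poly_sup_norm K P = (SUP z\<in>K. norm (poly P z))"

definition markov_factor :: "nat \<Rightarrow> complex set \<Rightarrow> real" where
  "markov_factor n K =
     Inf {M. \<forall>P. degree P \<le> n \<longrightarrow> poly_sup_norm K (pderiv P) \<le> M * poly_sup_norm K P}"

definition perfect_set :: "real set \<Rightarrow> bool" where
  "perfect_set K \<longleftrightarrow> closed K \<and> (\<forall>x\<in>K. x islimpt K)"

definition C_inf :: "(real \<Rightarrow> real) set" where
  "C_inf = {F. \<forall>k. (deriv ^^ k) F differentiable_on UNIV}"

definition C_inf_norm :: "nat \<Rightarrow> nat \<Rightarrow> (real \<Rightarrow> real) \<Rightarrow> real" where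
  "C_inf_norm m q F = Sup {\<bar>(deriv ^^ k) F x\<bar> | k x. k \<le> q \<and> x \<in> {- real m..real m}}"

(* The usual Frechet topology: uniform convergence of all derivatives on compact sets.  All
   semiballs (with arbitrary centres) form a subbasis, so the topological space is C_inf. *)
definition C_inf_topology :: "(real \<Rightarrow> real) topology" where
  "C_inf_topology = topology_generated_by
     {{G \<in> C_inf. C_inf_norm m q (\<lambda>x. G x - F x) < e} | F m q e. F \<in> C_inf \<and> 0 < e}"

(* Functions on K are represented as extensional functions (undefined outside K), so that
   equality of elements is equality on K. *)
definition whitney_space :: "real set \<Rightarrow> (real \<Rightarrow> real) set" where
  "whitney_space K = (\<lambda>F. restrict F K) ` C_inf"

(* Independent of the chosen extension if K is perfect; see whitney_deriv_eq below. *)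
definition whitney_deriv :: "real set \<Rightarrow> nat \<Rightarrow> (real \<Rightarrow> real) \<Rightarrow> real \<Rightarrow> real" where
  "whitney_deriv K k f =
     restrict ((deriv ^^ k) (SOME F. F \<in> C_inf \<and> (\<forall>x\<in>K. F x = f x))) K"

definition taylor_poly :: "real set \<Rightarrow> nat \<Rightarrow> real \<Rightarrow> (real \<Rightarrow> real) \<Rightarrow> real \<Rightarrow> real" where
  "taylor_poly K q y f x = (\<Sum>j\<le>q. whitney_deriv K j f y / fact j * (x - y) ^ j)"

definition taylor_rem :: "real set \<Rightarrow> nat \<Rightarrow> real \<Rightarrow> (real \<Rightarrow> real) \<Rightarrow> real \<Rightarrow> real" where
  "taylor_rem K q y f = (\<lambda>x\<in>K. f x - taylor_poly K q y f x)"

definition whitney_norm :: "real set \<Rightarrow> nat \<Rightarrow> (real \<Rightarrow> real) \<Rightarrow> real" where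
  "whitney_norm K q f =
     Sup {\<bar>whitney_deriv K k f x\<bar> | k x. k \<le> q \<and> x \<in> K} +
     Sup {\<bar>whitney_deriv K k (taylor_rem K q y f) x\<bar> / \<bar>x - y\<bar> ^ (q - k) | k x y.
            k \<le> q \<and> x \<in> K \<and> y \<in> K \<and> x \<noteq> y}"

definition whitney_topology :: "real set \<Rightarrow> (real \<Rightarrow> real) topology" where
  "whitney_topology K = topology_generated_by
     {{g \<in> whitney_space K. whitney_norm K q (\<lambda>x\<in>K. g x - f x) < e} | f q e.
        f \<in> whitney_space K \<and> 0 < e}"

definition whitney_linear :: "real set \<Rightarrow> ((real \<Rightarrow> real) \<Rightarrow> real \<Rightarrow> real) \<Rightarrow> bool" where
  "whitney_linear K W \<longleftrightarrow>
     (\<forall>f\<in>whitney_space K. \<forall>g\<in>whitney_space K.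
        W (\<lambda>x\<in>K. f x + g x) = (\<lambda>x. W f x + W g x)) \<and>
     (\<forall>c. \<forall>f\<in>whitney_space K. W (\<lambda>x\<in>K. c * f x) = (\<lambda>x. c * W f x))"

definition extension_property :: "real set \<Rightarrow> bool" where
  "extension_property K \<longleftrightarrow>
     (\<exists>W. whitney_linear K W \<and>
          continuous_map (whitney_topology K) C_inf_topology W \<and>
          (\<forall>f\<in>whitney_space K. restrict (W f) K = f))"

lemma C_inf_derivs_eq_on:
  assumes "perfect_set K" "F \<in> C_inf" "G \<in> C_inf" "\<And>x. x \<in> K \<Longrightarrow> F x = G x" "x \<in> K"
  shows "(deriv ^^ k) F x = (deriv ^^ k) G x"
  using assms(5)
proof (induction k arbitrary: x)
  case 0
  then show ?case using assms(4) by simp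
next
  case (Suc k)
  have lim: "at x within K \<noteq> bot"
    using assms(1) Suc.prems by (simp add: perfect_set_def trivial_limit_within)
  have der: "((deriv ^^ k) H has_field_derivative (deriv ^^ Suc k) H x) (at x within K)"
    if "H \<in> C_inf" for H
  proof -
    have "(deriv ^^ k) H differentiable at x"
      using that by (simp add: C_inf_def differentiable_on_def)
    then show ?thesis
      by (simp add: DERIV_deriv_iff_real_differentiable has_field_derivative_at_within)
  qed
  have "((deriv ^^ k) F has_field_derivative (deriv ^^ Suc k) G x) (at x within K)"
    using has_derivative_transform[of x K "(deriv ^^ k) F" "(deriv ^^ k) G"] Suc
      der[OF assms(3)]
    unfolding has_field_derivative_def by blast
  with der[OF assms(2)] lim show ?case
    by (blast intro: has_field_derivative_unique)
qed

lemma whitney_deriv_eq: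
  assumes "perfect_set K" "F \<in> C_inf" "x \<in> K"
  shows "whitney_deriv K k (restrict F K) x = (deriv ^^ k) F x"
proof -
  define G where "G = (SOME G. G \<in> C_inf \<and> (\<forall>x\<in>K. G x = restrict F K x))"
  have "G \<in> C_inf \<and> (\<forall>x\<in>K. G x = restrict F K x)"
    unfolding G_def by (rule someI[of _ F]) (use assms in auto)
  then have "(deriv ^^ k) G x = (deriv ^^ k) F x"
    using assms by (intro C_inf_derivs_eq_on) auto
  with assms(3) show ?thesis
    by (simp add: whitney_deriv_def G_def)
qed

end

theory Submission
  imports Defs "HOL-Complex_Analysis.Cauchy_Integral_Formula" "HOL-Real_Asymp.Real_Asymp"
begin

text \<open>\<open>K\<^sub>1\<close> is a Cantor set whose intervals of level \<open>s\<close> split into \<open>s + 2\<close> equally spaced tiny ones, the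
  spacing being \<open>mesh s\<close> with \<open>mesh (s + 1) = mesh s\<^sup>2\<close>. The left end points of the subintervals serve as
  nodes of Lagrange interpolation. Since their number tends to infinity, the interpolants eventually
  reproduce Taylor polynomials of every fixed degree, and since it does so slowly, the Lebesgue
  constants are negligible against powers of \<open>1 / mesh s\<close>. Hence cutting off and summing up the differences of
  interpolants of consecutive levels defines a continuous linear extension operator. The polynomial
  with zeros at all left end points of one level, whose degree is only factorial in \<open>s\<close>, shows that the
  Markov factors of \<open>K\<^sub>1\<close> grow superpolynomially.

  \<open>K\<^sub>2\<close> is \<open>[-1, 0]\<close> together with intervals at \<open>b\<^sub>k = 8\<^sup>-\<^sup>k\<^sup>-\<^sup>1\<close> whose lengths decay faster than every power
  of \<open>b\<^sub>k\<close>. A monomial \<open>(x - b\<^sub>k)\<^sup>j\<close> that lives on one of them only is very small in the norms of order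
  less than \<open>j\<close>, but its higher norms are bounded by powers of \<open>1 / b\<^sub>k\<close>, so that extending it
  continuously would contradict the interpolation inequality between derivatives. Polynomials of
  degree \<open>n\<close> see the intervals with \<open>b\<^sub>k\<close> much smaller than \<open>n\<^sup>-\<^sup>3\<close> only as a part of a neighbourhood of 0, by
  the Markov inequality on \<open>[-1, 0]\<close>, and therefore the Markov factors of \<open>K\<^sub>2\<close> grow much more slowly.\<close>

section \<open>Smooth functions on the line\<close>

text \<open>Large Markov factors ask for rapidly shrinking intervals, but these make the differences
  of interpolants expensive to differentiate. The exponents balance as follows. At level
  \<open>s\<close>, \<open>q\<close> derivatives cost \<open>mesh (s + 1)\<close> to the power -q,
  that is \<open>mesh s\<close> to the power -2q. Taylor polynomials of degree 2q + 1 gain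
  \<open>width s\<close> to the power 2q + 1. One factor \<open>mesh s\<close> is left, and being
  doubly exponentially small it beats all factors of size s^O(s), including the number of intervals.
  Hence \<open>q\<close> derivatives of the extension are controlled by Whitney norms up to order 2q
  + 1. For the Markov factors the natural parameter is \<open>t\<close> with (t + 2)! <= n <= (t +
  3)!. There the Cantor set has a Markov factor of order at least 1 / \<open>width (t + 1)\<close>,
  nearly \<open>mesh t\<close> to the power -2. Since log n is O(t^2) and the exponent of the spike
  length is quadratic in log n, the other set stays below 2 * 8^O(t^4), which is at most 2 /
  \<open>mesh t\<close> for large \<open>t\<close>. Again one factor \<open>mesh t\<close> is left.
  Only a polynomial bound in n enters the Markov inequality on an interval, so an elementary cubic
  one suffices.\<close>

fun n_times_diff :: "nat \<Rightarrow> (real \<Rightarrow> real) \<Rightarrow> bool" where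
  "n_times_diff 0 f \<longleftrightarrow> True"
| "n_times_diff (Suc n) f \<longleftrightarrow> (\<exists>g. (\<forall>x. (f has_real_derivative g x) (at x)) \<and> n_times_diff n g)"

lemma deriv_funpow_Suc: "(deriv ^^ Suc k) F = (deriv ^^ k) (deriv F)"
  by (simp only: funpow_Suc_right o_apply)

lemma C_inf_derivD: "F \<in> C_inf \<Longrightarrow> deriv F \<in> C_inf"
  by (simp add: C_inf_def flip: deriv_funpow_Suc del: funpow.simps)

lemma C_inf_DERIV: "F \<in> C_inf \<Longrightarrow> (F has_real_derivative deriv F x) (at x)"
  unfolding C_inf_def differentiable_on_def DERIV_deriv_iff_real_differentiable
  by (drule CollectD, drule spec[of _ 0]) simp

lemma C_inf_funpow: "F \<in> C_inf \<Longrightarrow> (deriv ^^ k) F \<in> C_inf"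
  by (induction k arbitrary: F) (auto simp: deriv_funpow_Suc C_inf_derivD simp del: funpow.simps(2))

lemma C_inf_DERIV_funpow:
  "F \<in> C_inf \<Longrightarrow> ((deriv ^^ k) F has_real_derivative (deriv ^^ Suc k) F x) (at x)"
  using C_inf_DERIV[OF C_inf_funpow[of F k]] by simp

lemma C_inf_continuous: "F \<in> C_inf \<Longrightarrow> continuous_on S ((deriv ^^ k) F)"
  by (meson C_inf_DERIV_funpow DERIV_continuous_on has_field_derivative_at_within)

lemma n_times_diff_imp_differentiable:
  "n_times_diff (Suc k) f \<Longrightarrow> (deriv ^^ k) f differentiable_on UNIV"
proof (induction k arbitrary: f)
  case 0
  then show ?case
    by (auto simp: differentiable_on_def real_differentiable_def)
next
  case (Suc k)
  obtain g where g: "\<And>x. (f has_real_derivative g x) (at x)" "n_times_diff (Suc k) g"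
    using Suc.prems by auto
  have "deriv f = g" using g(1) by (auto simp: DERIV_imp_deriv)
  with Suc.IH[OF g(2)] show ?case by (simp add: deriv_funpow_Suc del: funpow.simps)
qed

lemma C_inf_n_times_diff: "F \<in> C_inf \<Longrightarrow> n_times_diff n F"
  by (induction n arbitrary: F) (auto intro: C_inf_DERIV C_inf_derivD)

text \<open>Membership in \<open>C_inf\<close> speaks of iterated \<open>deriv\<close>. In
  \<open>n_times_diff\<close> the derivative is existentially quantified, so closure under products,
  composition and inverses is an induction with an explicit derivative.\<close>

lemma C_inf_iff: "F \<in> C_inf \<longleftrightarrow> (\<forall>n. n_times_diff n F)"
  using C_inf_n_times_diff n_times_diff_imp_differentiable unfolding C_inf_def by blast

text \<open>Coinduction: a family closed under differentiation is smooth, whatever its higher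
  derivatives look like.\<close>

lemma C_infI_coinduct:
  assumes "f \<in> S" "\<And>f. f \<in> S \<Longrightarrow> \<exists>g\<in>S. \<forall>x. (f has_real_derivative g x) (at x)"
  shows "f \<in> C_inf"
proof -
  have "n_times_diff n f" if "f \<in> S" for n f
    using that by (induction n arbitrary: f) (use assms(2) in \<open>auto, blast\<close>)
  with assms(1) show ?thesis by (simp add: C_inf_iff)
qed

lemma n_times_diff_Suc_imp: "n_times_diff (Suc n) f \<Longrightarrow> n_times_diff n f"
proof (induction n arbitrary: f)
  case (Suc n)
  then obtain g where "\<forall>x. (f has_real_derivative g x) (at x)" "n_times_diff (Suc n) g" by auto
  with Suc.IH show ?case by auto
qed simp

lemma n_times_diff_add: "n_times_diff n f \<Longrightarrow> n_times_diff n g \<Longrightarrow> n_times_diff n (\<lambda>x. f x + g x)"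
proof (induction n arbitrary: f g)
  case (Suc n)
  obtain f' g' where "\<forall>x. (f has_real_derivative f' x) (at x)" "n_times_diff n f'"
    "\<forall>x. (g has_real_derivative g' x) (at x)" "n_times_diff n g'"
    using Suc.prems by auto
  with Suc.IH show ?case
    by (auto intro!: exI[of _ "\<lambda>x. f' x + g' x"] derivative_eq_intros)
qed simp

lemma n_times_diff_mult: "n_times_diff n f \<Longrightarrow> n_times_diff n g \<Longrightarrow> n_times_diff n (\<lambda>x. f x * g x)"
proof (induction n arbitrary: f g)
  case (Suc n)
  obtain f' g' where *: "\<forall>x. (f has_real_derivative f' x) (at x)" "n_times_diff n f'"
    "\<forall>x. (g has_real_derivative g' x) (at x)" "n_times_diff n g'"
    using Suc.prems by auto
  have "n_times_diff n (\<lambda>x. f' x * g x + f x * g' x)"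
    by (intro n_times_diff_add Suc.IH *(2,4) n_times_diff_Suc_imp[OF Suc.prems(1)]
        n_times_diff_Suc_imp[OF Suc.prems(2)])
  with * show ?case
    by (auto intro!: exI[of _ "\<lambda>x. f' x * g x + f x * g' x"] derivative_eq_intros)
qed simp

lemma n_times_diff_compose: "n_times_diff n f \<Longrightarrow> n_times_diff n g \<Longrightarrow> n_times_diff n (\<lambda>x. f (g x))"
proof (induction n arbitrary: f)
  case (Suc n)
  obtain f' g' where *: "\<forall>x. (f has_real_derivative f' x) (at x)" "n_times_diff n f'"
    "\<forall>x. (g has_real_derivative g' x) (at x)" "n_times_diff n g'"
    using Suc.prems unfolding n_times_diff.simps by blast
  have "n_times_diff n (\<lambda>x. f' (g x) * g' x)"
    using n_times_diff_mult[OF Suc.IH[OF *(2) n_times_diff_Suc_imp[OF Suc.prems(2)]] *(4)] .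
  moreover have "((\<lambda>x. f (g x)) has_real_derivative f' (g x) * g' x) (at x)" for x
    using * by (intro DERIV_chain2) auto
  ultimately show ?case
    unfolding n_times_diff.simps by (intro exI[of _ "\<lambda>x. f' (g x) * g' x"]) simp
qed simp

lemma n_times_diff_zero: "n_times_diff n (\<lambda>x. 0)"
proof (induction n)
  case (Suc n)
  then show ?case unfolding n_times_diff.simps by (intro exI[of _ "\<lambda>x. 0"]) simp
qed simp

lemma n_times_diff_inverse:
  "n_times_diff n f \<Longrightarrow> (\<And>x. f x \<noteq> 0) \<Longrightarrow> n_times_diff n (\<lambda>x. inverse (f x))"
proof (induction n)
  case (Suc n)
  obtain f' where *: "\<forall>x. (f has_real_derivative f' x) (at x)" "n_times_diff n f'"
    using Suc.prems by auto
  have c: "n_times_diff n (\<lambda>x. - 1)"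
  proof (cases n)
    case (Suc m)
    then show ?thesis
      unfolding n_times_diff.simps Suc by (intro exI[of _ "\<lambda>x. 0"]) (simp add: n_times_diff_zero)
  qed simp
  have "n_times_diff n (\<lambda>x. -1 * (inverse (f x) * f' x * inverse (f x)))"
    by (intro n_times_diff_mult c *(2) Suc.IH Suc.prems(2) n_times_diff_Suc_imp[OF Suc.prems(1)])
  with * Suc.prems(2) show ?case
    by (auto intro!: exI[of _ "\<lambda>x. -1 * (inverse (f x) * f' x * inverse (f x))"] derivative_eq_intros)
qed simp

lemma C_inf_const [simp]: "(\<lambda>x. c) \<in> C_inf"
  by (rule C_infI_coinduct[of _ "range (\<lambda>c x. c)"]) (auto intro!: derivative_eq_intros)

lemma C_inf_ident [simp]: "(\<lambda>x. x) \<in> C_inf"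
  by (rule C_infI_coinduct[of _ "insert (\<lambda>x. x) (range (\<lambda>c x. c))"])
    (auto intro!: derivative_eq_intros)

lemma C_inf_add: "f \<in> C_inf \<Longrightarrow> g \<in> C_inf \<Longrightarrow> (\<lambda>x. f x + g x) \<in> C_inf"
  by (simp add: C_inf_iff n_times_diff_add)

lemma C_inf_mult: "f \<in> C_inf \<Longrightarrow> g \<in> C_inf \<Longrightarrow> (\<lambda>x. f x * g x) \<in> C_inf"
  by (simp add: C_inf_iff n_times_diff_mult)

lemma C_inf_compose: "f \<in> C_inf \<Longrightarrow> g \<in> C_inf \<Longrightarrow> (\<lambda>x. f (g x)) \<in> C_inf"
  by (simp add: C_inf_iff n_times_diff_compose)

lemma C_inf_diff: "f \<in> C_inf \<Longrightarrow> g \<in> C_inf \<Longrightarrow> (\<lambda>x. f x - g x) \<in> C_inf"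
  using C_inf_add[of f "\<lambda>x. -1 * g x"] C_inf_mult[of "\<lambda>x. -1" g] by simp

lemma C_inf_divide:
  "f \<in> C_inf \<Longrightarrow> g \<in> C_inf \<Longrightarrow> (\<And>x. g x \<noteq> 0) \<Longrightarrow> (\<lambda>x. f x / g x) \<in> C_inf"
  using C_inf_mult[of f "\<lambda>x. inverse (g x)"] n_times_diff_inverse[of _ g]
  by (simp add: C_inf_iff divide_inverse)

lemma C_inf_sum: "(\<And>i. i \<in> I \<Longrightarrow> f i \<in> C_inf) \<Longrightarrow> (\<lambda>x. \<Sum>i\<in>I. f i x) \<in> C_inf"
  by (induction I rule: infinite_finite_induct) (auto intro: C_inf_add)

lemma C_inf_prod: "(\<And>i. i \<in> I \<Longrightarrow> f i \<in> C_inf) \<Longrightarrow> (\<lambda>x. \<Prod>i\<in>I. f i x) \<in> C_inf"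
  by (induction I rule: infinite_finite_induct) (auto intro: C_inf_mult)

lemma C_inf_power: "f \<in> C_inf \<Longrightarrow> (\<lambda>x. f x ^ n) \<in> C_inf"
  by (induction n) (auto intro: C_inf_mult)

lemma C_inf_poly: "poly p \<in> C_inf"
  by (rule C_infI_coinduct[of _ "range poly"]) (auto intro: poly_DERIV)

text \<open>A guessed family linked by differentiation determines all iterated \<open>deriv\<close>;
  the computation rules below only exhibit such a family.\<close>

lemma deriv_funpow_eqI:
  assumes "\<And>k x. (F k has_real_derivative F (Suc k) x) (at x)"
  shows "(deriv ^^ k) (F 0) = F k"
  by (induction k) (auto intro!: DERIV_imp_deriv assms)

lemma C_infI_seq:
  assumes "\<And>k x. (F k has_real_derivative F (Suc k) x) (at x)"
  shows "F 0 \<in> C_inf"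
  by (rule C_infI_coinduct[of _ "range F"]) (use assms in auto)

lemma deriv_funpow_poly:
  fixes p :: "real poly"
  shows "(deriv ^^ k) (poly p) = poly ((pderiv ^^ k) p)"
  using deriv_funpow_eqI[of "\<lambda>k. poly ((pderiv ^^ k) p)" k] by simp

lemma deriv_funpow_add:
  assumes "f \<in> C_inf" "g \<in> C_inf"
  shows "(deriv ^^ k) (\<lambda>x. f x + g x) = (\<lambda>x. (deriv ^^ k) f x + (deriv ^^ k) g x)"
  using deriv_funpow_eqI[of "\<lambda>k x. (deriv ^^ k) f x + (deriv ^^ k) g x" k] assms
  by (auto intro!: DERIV_add C_inf_DERIV_funpow simp del: funpow.simps(2))

lemma deriv_funpow_cmult:
  assumes "f \<in> C_inf"
  shows "(deriv ^^ k) (\<lambda>x. c * f x) = (\<lambda>x. c * (deriv ^^ k) f x)"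
  using deriv_funpow_eqI[of "\<lambda>k x. c * (deriv ^^ k) f x" k] assms
  by (auto intro!: DERIV_cmult C_inf_DERIV_funpow simp del: funpow.simps(2))

lemma deriv_funpow_diff:
  assumes "f \<in> C_inf" "g \<in> C_inf"
  shows "(deriv ^^ k) (\<lambda>x. f x - g x) = (\<lambda>x. (deriv ^^ k) f x - (deriv ^^ k) g x)"
  using deriv_funpow_eqI[of "\<lambda>k x. (deriv ^^ k) f x - (deriv ^^ k) g x" k] assms
  by (auto intro!: DERIV_diff C_inf_DERIV_funpow simp del: funpow.simps(2))

lemma deriv_funpow_zero [simp]: "(deriv ^^ k) (\<lambda>x. 0 :: real) = (\<lambda>x. 0)"
  using deriv_funpow_cmult[of "\<lambda>x. 0" k 0] by simp

lemma deriv_funpow_sum: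
  assumes "\<And>i. i \<in> I \<Longrightarrow> f i \<in> C_inf"
  shows "(deriv ^^ k) (\<lambda>x. \<Sum>i\<in>I. f i x) = (\<lambda>x. \<Sum>i\<in>I. (deriv ^^ k) (f i) x)"
  using assms
  by (induction I rule: infinite_finite_induct) (auto simp: deriv_funpow_add C_inf_sum)

lemma deriv_funpow_affine:
  assumes "f \<in> C_inf"
  shows "(deriv ^^ k) (\<lambda>x. f ((x - a) / h)) = (\<lambda>x. (deriv ^^ k) f ((x - a) / h) / h ^ k)"
proof -
  have "((\<lambda>x. (deriv ^^ k) f ((x - a) / h) / h ^ k) has_real_derivative
      (deriv ^^ Suc k) f ((x - a) / h) / h ^ Suc k) (at x)" for k x
  proof -
    have "((\<lambda>x. (x - a) / h) has_real_derivative 1 / h) (at x)"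
      by (cases "h = 0") (auto intro!: derivative_eq_intros)
    from DERIV_chain2[OF C_inf_DERIV_funpow[OF assms, of k] this]
    have "((\<lambda>x. (deriv ^^ k) f ((x - a) / h)) has_real_derivative
        (deriv ^^ Suc k) f ((x - a) / h) * (1 / h)) (at x)" .
    from DERIV_cdivide[OF this, of "h ^ k"] show ?thesis by (simp add: field_simps)
  qed
  from deriv_funpow_eqI[of "\<lambda>k x. (deriv ^^ k) f ((x - a) / h) / h ^ k", OF this]
  show ?thesis by simp
qed

lemma C_inf_affine: "f \<in> C_inf \<Longrightarrow> (\<lambda>x. f ((x - a) / h)) \<in> C_inf"
  by (rule C_inf_compose[of f]) (simp_all add: divide_inverse C_inf_mult C_inf_diff)

text \<open>Leibniz rule without binomial coefficients: for geometrically growing derivatives the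
  binomial sum collapses. The induction applies the product rule once and moves the extra factor
  \<open>r\<close> or \<open>s\<close> into the constant \<open>A\<close> or
  \<open>B\<close>.\<close>

lemma deriv_funpow_mult_bound:
  assumes "f \<in> C_inf" "g \<in> C_inf" "0 \<le> r" "0 \<le> s"
    and "\<And>j. j \<le> q \<Longrightarrow> \<bar>(deriv ^^ j) f x\<bar> \<le> A * r ^ j"
    and "\<And>j. j \<le> q \<Longrightarrow> \<bar>(deriv ^^ j) g x\<bar> \<le> B * s ^ j"
  shows "\<bar>(deriv ^^ q) (\<lambda>x. f x * g x) x\<bar> \<le> A * B * (r + s) ^ q"
  using assms
proof (induction q arbitrary: f g A B)
  case 0
  have "\<bar>f x\<bar> * \<bar>g x\<bar> \<le> A * B"
    using 0(5)[of 0] 0(6)[of 0] by (intro mult_mono) auto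
  then show ?case by (simp add: abs_mult)
next
  case (Suc q)
  note fg = Suc.prems(1,2)
  have "0 \<le> A" "0 \<le> B" using Suc.prems(5)[of 0] Suc.prems(6)[of 0] by auto
  have "deriv (\<lambda>x. f x * g x) = (\<lambda>x. deriv f x * g x + f x * deriv g x)"
    using C_inf_DERIV[OF fg(1)] C_inf_DERIV[OF fg(2)]
    by (intro ext DERIV_imp_deriv) (auto intro!: derivative_eq_intros)
  then have eq: "(deriv ^^ Suc q) (\<lambda>x. f x * g x) x =
      (deriv ^^ q) (\<lambda>x. deriv f x * g x) x + (deriv ^^ q) (\<lambda>x. f x * deriv g x) x"
    using fg by (simp add: deriv_funpow_Suc deriv_funpow_add C_inf_mult C_inf_derivD del: funpow.simps)
  have "\<bar>(deriv ^^ j) (deriv f) x\<bar> \<le> A * r * r ^ j" "\<bar>(deriv ^^ j) (deriv g) x\<bar> \<le> B * s * s ^ j"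
    if "j \<le> q" for j
    using Suc.prems(5)[of "Suc j"] Suc.prems(6)[of "Suc j"] that
    by (auto simp: deriv_funpow_Suc ac_simps simp del: funpow.simps)
  then have "\<bar>(deriv ^^ q) (\<lambda>x. deriv f x * g x) x\<bar> \<le> (A * r) * B * (r + s) ^ q"
    "\<bar>(deriv ^^ q) (\<lambda>x. f x * deriv g x) x\<bar> \<le> A * (B * s) * (r + s) ^ q"
    using Suc.prems fg by (auto intro!: Suc.IH C_inf_derivD)
  with eq have "\<bar>(deriv ^^ Suc q) (\<lambda>x. f x * g x) x\<bar> \<le>
      (A * r) * B * (r + s) ^ q + A * (B * s) * (r + s) ^ q"
    by linarith
  also have "\<dots> = A * B * (r + s) ^ Suc q" by (simp add: algebra_simps)
  finally show ?case .
qed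

text \<open>Termwise differentiation by the Weierstrass test at each order; the majorant may depend
  on the order, but not on \<open>x\<close>.\<close>

lemma C_inf_series:
  fixes G :: "nat \<Rightarrow> real \<Rightarrow> real"
  assumes G: "\<And>s. G s \<in> C_inf"
    and bound: "\<And>q s x. \<bar>(deriv ^^ q) (G s) x\<bar> \<le> B q s" and B: "\<And>q. summable (B q)"
  shows "(\<lambda>x. \<Sum>s. G s x) \<in> C_inf"
    and "(deriv ^^ q) (\<lambda>x. \<Sum>s. G s x) = (\<lambda>x. \<Sum>s. (deriv ^^ q) (G s) x)"
proof -
  have *: "((\<lambda>x. \<Sum>s. (deriv ^^ k) (G s) x) has_real_derivative (\<Sum>s. (deriv ^^ Suc k) (G s) x)) (at x)"
    for k x
  proof (rule has_field_derivative_series'(2)[of UNIV _ _ x])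
    show "uniformly_convergent_on UNIV (\<lambda>n x. \<Sum>i<n. (deriv ^^ Suc k) (G i) x)"
      using bound[of "Suc k"] by (intro Weierstrass_m_test'[OF _ B]) (auto simp del: funpow.simps(2))
    show "summable (\<lambda>n. (deriv ^^ k) (G n) x)"
      using bound[of k] by (intro summable_comparison_test'[OF B]) auto
  qed (use G in \<open>auto intro!: C_inf_DERIV_funpow simp del: funpow.simps(2)\<close>)
  show "(\<lambda>x. \<Sum>s. G s x) \<in> C_inf"
    using C_infI_seq[of "\<lambda>k x. \<Sum>s. (deriv ^^ k) (G s) x", OF *] by simp
  show "(deriv ^^ q) (\<lambda>x. \<Sum>s. G s x) = (\<lambda>x. \<Sum>s. (deriv ^^ q) (G s) x)"
    using deriv_funpow_eqI[of "\<lambda>k x. \<Sum>s. (deriv ^^ k) (G s) x" q, OF *] by simp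
qed

section \<open>Flat exponential, smooth step and cut-off function\<close>

definition flat_exp :: "real \<Rightarrow> real" where
  "flat_exp x = (if 0 < x then exp (- (1 / x)) else 0)"

text \<open>The products of a polynomial in 1 / x with the flat exponential form a family closed
  under differentiation: the chain rule yields (p - p')(1 / x) / x^2.\<close>

lemma flat_exp_poly_DERIV:
  fixes p :: "real poly"
  shows "((\<lambda>x. poly p (1 / x) * flat_exp x) has_real_derivative
    poly ([:0, 0, 1:] * (p - pderiv p)) (1 / x) * flat_exp x) (at x)"
proof -
  define g where "g = (\<lambda>p x. if 0 < x then poly p (1 / x) * exp (- (1 / x)) else (0 :: real))"
  have g_eq: "poly p (1 / x) * flat_exp x = g p x" for p x
    by (simp add: g_def flat_exp_def)
  consider "x < 0" | "x = 0" | "0 < x" by linarith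
  then have "(g p has_real_derivative g ([:0, 0, 1:] * (p - pderiv p)) x) (at x)"
  proof cases
    case 1
    have "((\<lambda>x. 0) has_real_derivative 0) (at x)" by simp
    then have "(g p has_real_derivative 0) (at x)"
      by (rule has_field_derivative_transform_within_open[where S = "{..<0}"])
        (use 1 in \<open>auto simp: g_def\<close>)
    then show ?thesis using 1 by (simp add: g_def)
  next
    case 2
    have lim: "((\<lambda>t. poly q t * exp (- t)) \<longlongrightarrow> 0) at_top" for q :: "real poly"
    proof -
      have "((\<lambda>t. \<Sum>i\<le>degree q. coeff q i * (t ^ i / exp t)) \<longlongrightarrow> (\<Sum>i\<le>degree q. coeff q i * 0)) at_top"
        by (intro tendsto_sum tendsto_mult tendsto_const tendsto_power_div_exp_0)
      then show ?thesis
        by (simp add: poly_altdef exp_minus field_simps sum_distrib_left)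
    qed
    have "((\<lambda>y. g p y / y) \<longlongrightarrow> 0) (at_right 0)"
    proof -
      \<comment> \<open>The division by \<open>y\<close> in the difference quotient is a factor t =
        1 / y, hence the shift \<open>pCons 0 p\<close>.\<close>
      have "((\<lambda>t. poly (pCons 0 p) t * exp (- t)) \<longlongrightarrow> 0) at_top" by (rule lim)
      then have "((\<lambda>y. poly (pCons 0 p) (inverse y) * exp (- inverse y)) \<longlongrightarrow> 0) (at_right 0)"
        by (rule filterlim_compose[OF _ filterlim_inverse_at_top_right])
      then show ?thesis
        by (rule Lim_transform_eventually)
          (auto simp: eventually_at_filter g_def field_simps intro!: always_eventually)
    qed
    moreover have "((\<lambda>y. g p y / y) \<longlongrightarrow> 0) (at_left 0)"
      by (rule Lim_transform_eventually[OF tendsto_const])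
        (auto simp: eventually_at_filter g_def intro!: always_eventually)
    ultimately have "((\<lambda>y. g p y / y) \<longlongrightarrow> 0) (at 0)"
      by (simp add: filterlim_at_split)
    with 2 show ?thesis
      by (simp add: has_field_derivative_iff g_def)
  next
    case 3
    have "((\<lambda>x. poly p (1 / x) * exp (- (1 / x))) has_real_derivative
        poly ([:0, 0, 1:] * (p - pderiv p)) (1 / x) * exp (- (1 / x))) (at x)"
      using 3
      by (auto intro!: derivative_eq_intros DERIV_chain2[OF poly_DERIV]
          simp: field_simps power2_eq_square)
    then have "(g p has_real_derivative
        poly ([:0, 0, 1:] * (p - pderiv p)) (1 / x) * exp (- (1 / x))) (at x)"
      by (rule has_field_derivative_transform_within_open[where S = "{0<..}"])
        (use 3 in \<open>auto simp: g_def\<close>)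
    then show ?thesis using 3 by (simp add: g_def)
  qed
  then show ?thesis unfolding g_eq .
qed

lemma flat_exp_C_inf: "flat_exp \<in> C_inf"
proof -
  have "(\<lambda>x. poly 1 (1 / x) * flat_exp x) \<in> C_inf"
  proof (rule C_infI_coinduct[where S = "range (\<lambda>p x. poly p (1 / x) * flat_exp x)"])
    fix f assume "f \<in> range (\<lambda>p x. poly p (1 / x) * flat_exp x)"
    then obtain p where f: "f = (\<lambda>x. poly p (1 / x) * flat_exp x)" by blast
    show "\<exists>g\<in>range (\<lambda>p x. poly p (1 / x) * flat_exp x). \<forall>x. (f has_real_derivative g x) (at x)"
      unfolding f
      by (rule bexI[OF _ range_eqI[OF refl, of _ "[:0, 0, 1:] * (p - pderiv p)"]])
        (use flat_exp_poly_DERIV in blast)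
  qed blast
  then show ?thesis by simp
qed

definition smooth_step :: "real \<Rightarrow> real" where
  "smooth_step x = flat_exp x / (flat_exp x + flat_exp (1 - x))"

text \<open>Scaled to an interval of length w, the cut-off is 1 on the interval and lives within
  distance w of it. If left end points are at least 2w apart, each cut-off therefore vanishes on all
  other intervals.\<close>

definition bump :: "real \<Rightarrow> real" where
  "bump x = smooth_step (x + 1) * smooth_step (2 - x)"

lemma smooth_step_C_inf: "smooth_step \<in> C_inf"
proof -
  have "(\<lambda>x. flat_exp (1 - x)) \<in> C_inf"
    by (intro C_inf_compose[OF flat_exp_C_inf] C_inf_diff) auto
  moreover have "flat_exp x + flat_exp (1 - x) \<noteq> 0" for x
    by (cases "0 < x"; cases "x < 1") (auto simp: flat_exp_def add_pos_pos less_imp_neq[symmetric])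
  ultimately show ?thesis
    unfolding smooth_step_def[abs_def] by (intro C_inf_divide C_inf_add flat_exp_C_inf) auto
qed

lemma bump_C_inf: "bump \<in> C_inf"
proof -
  have "(\<lambda>x. smooth_step (x + 1)) \<in> C_inf" "(\<lambda>x. smooth_step (2 - x)) \<in> C_inf"
    by (intro C_inf_compose[OF smooth_step_C_inf] C_inf_diff C_inf_add; simp)+
  then show ?thesis
    unfolding bump_def[abs_def] by (rule C_inf_mult)
qed

lemma bump_eq_1: "0 \<le> x \<Longrightarrow> x \<le> 1 \<Longrightarrow> bump x = 1"
  by (auto simp: bump_def smooth_step_def flat_exp_def)

lemma bump_eq_0: "x \<le> -1 \<or> 2 \<le> x \<Longrightarrow> bump x = 0"
  by (auto simp: bump_def smooth_step_def flat_exp_def)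

text \<open>Closed half lines are perfect, so the values on them determine all derivatives there,
  even at the end points \<open>a\<close> and \<open>b\<close>.\<close>

lemma deriv_funpow_eq_0_outside:
  assumes "f \<in> C_inf" "\<And>x. x \<le> a \<or> b \<le> x \<Longrightarrow> f x = 0" "x \<le> a \<or> b \<le> x"
  shows "(deriv ^^ k) f x = 0"
proof -
  have "perfect_set {..a}" "perfect_set {b..}"
    by (auto simp: perfect_set_def infinite_Iic infinite_Ici
        intro!: connected_imp_perfect dest!: arg_cong[of _ _ finite])
  from C_inf_derivs_eq_on[OF this(1) assms(1) C_inf_const[of 0]]
    C_inf_derivs_eq_on[OF this(2) assms(1) C_inf_const[of 0]]
  show ?thesis using assms(2,3) by (auto simp del: funpow.simps)
qed

lemma deriv_funpow_bounded_on_compact: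
  assumes "f \<in> C_inf" "compact S"
  obtains B where "1 \<le> B" "\<And>k x. k \<le> q \<Longrightarrow> x \<in> S \<Longrightarrow> \<bar>(deriv ^^ k) f x\<bar> \<le> B"
proof -
  have "\<exists>B. \<forall>x\<in>S. \<bar>(deriv ^^ k) f x\<bar> \<le> B" for k
    using compact_imp_bounded[OF compact_continuous_image[OF C_inf_continuous[OF assms(1)] assms(2)], of k]
    by (auto simp: bounded_iff)
  then obtain B where B: "\<And>k x. x \<in> S \<Longrightarrow> \<bar>(deriv ^^ k) f x\<bar> \<le> B k" by metis
  have "\<bar>(deriv ^^ k) f x\<bar> \<le> Max (insert 1 (B ` {..q}))" if "k \<le> q" "x \<in> S" for k x
    using B[OF that(2), of k] that by (intro order_trans[OF _ Max_ge]) auto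
  then show ?thesis by (intro that[of "Max (insert 1 (B ` {..q}))"]) auto
qed

lemma deriv_funpow_bounded_of_support:
  assumes "f \<in> C_inf" "\<And>x. x \<le> a \<or> b \<le> x \<Longrightarrow> f x = 0"
  obtains B where "1 \<le> B" "\<And>k x. k \<le> q \<Longrightarrow> \<bar>(deriv ^^ k) f x\<bar> \<le> B"
proof -
  obtain B where B: "1 \<le> B" "\<And>k x. k \<le> q \<Longrightarrow> x \<in> {a..b} \<Longrightarrow> \<bar>(deriv ^^ k) f x\<bar> \<le> B"
    using deriv_funpow_bounded_on_compact[OF assms(1), of "{a..b}" q] by auto
  have "\<bar>(deriv ^^ k) f x\<bar> \<le> B" if "k \<le> q" for k x
  proof (cases "x \<in> {a..b}")
    case False
    then have "(deriv ^^ k) f x = 0"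
      using assms(2) by (intro deriv_funpow_eq_0_outside[OF assms(1), of a b]) auto
    with B(1) show ?thesis by simp
  qed (use B that in auto)
  with B(1) show ?thesis by (rule that)
qed

text \<open>The bound on the derivative of order \<open>q\<close> is integrated down from
  \<open>y\<close>, one order at a time, by the mean value inequality; \<open>d\<close> counts the
  integrations.\<close>

lemma flat_remainder_bound:
  assumes "H \<in> C_inf" "\<And>j. j < q \<Longrightarrow> (deriv ^^ j) H y = 0"
    and "\<And>z. z \<in> closed_segment y x \<Longrightarrow> \<bar>(deriv ^^ q) H z\<bar> \<le> B" "k \<le> q"
  shows "\<bar>(deriv ^^ k) H x\<bar> \<le> B * \<bar>x - y\<bar> ^ (q - k)"
proof -
  have "\<bar>(deriv ^^ (q - d)) H z\<bar> \<le> B * \<bar>z - y\<bar> ^ d"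
    if "d \<le> q" "z \<in> closed_segment y x" for d z
    using that
  proof (induction d arbitrary: z)
    case (Suc d)
    define m where "m = q - Suc d"
    have m: "Suc m = q - d" "m < q" using Suc.prems by (auto simp: m_def)
    have sub: "closed_segment y z \<subseteq> closed_segment y x"
      using Suc.prems(2) by (simp add: subset_closed_segment)
    have "norm ((deriv ^^ m) H z - (deriv ^^ m) H y) \<le> (B * \<bar>z - y\<bar> ^ d) * norm (z - y)"
    proof (rule field_differentiable_bound[of "closed_segment y z" "(deriv ^^ m) H" "(deriv ^^ Suc m) H"])
      fix u assume u: "u \<in> closed_segment y z"
      show "((deriv ^^ m) H has_field_derivative (deriv ^^ Suc m) H u) (at u within closed_segment y z)"
        using C_inf_DERIV_funpow[OF assms(1)] by (rule has_field_derivative_at_within)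
      have "\<bar>u - y\<bar> \<le> \<bar>z - y\<bar>"
        using u by (auto simp: closed_segment_eq_real_ivl split: if_splits)
      then have "\<bar>u - y\<bar> ^ d \<le> \<bar>z - y\<bar> ^ d" by (simp add: power_mono)
      moreover have "\<bar>(deriv ^^ (q - d)) H u\<bar> \<le> B * \<bar>u - y\<bar> ^ d"
        using Suc.prems u sub by (intro Suc.IH) auto
      moreover have "0 \<le> B" using assms(3)[of y] by force
      ultimately show "norm ((deriv ^^ Suc m) H u) \<le> B * \<bar>z - y\<bar> ^ d"
        unfolding m(1) real_norm_def by (meson mult_left_mono order_trans)
    qed auto
    then show ?case
      using assms(2)[OF m(2)] by (simp add: m_def mult_ac)
  qed (use assms(3) in simp)
  from this[of "q - k" x] show ?thesis using assms(4) by simp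
qed

section \<open>Taylor expansion and Whitney norms\<close>

text \<open>The derivative of order \<open>k\<close> of the Taylor polynomial of degree
  \<open>q\<close> at \<open>y\<close>, written out so that the family in \<open>k\<close> can be
  fed to \<open>deriv_funpow_eqI\<close>.\<close>

definition taylor_deriv :: "nat \<Rightarrow> real \<Rightarrow> nat \<Rightarrow> (real \<Rightarrow> real) \<Rightarrow> real \<Rightarrow> real" where
  "taylor_deriv q y k F x =
     (\<Sum>j\<le>q. if k \<le> j then (deriv ^^ j) F y / fact (j - k) * (x - y) ^ (j - k) else 0)"

lemma taylor_deriv_DERIV:
  "(taylor_deriv q y k F has_real_derivative taylor_deriv q y (Suc k) F x) (at x)"
proof -
  have "((\<lambda>x. if k \<le> j then (deriv ^^ j) F y / fact (j - k) * (x - y) ^ (j - k) else 0)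
      has_real_derivative
      (if Suc k \<le> j then (deriv ^^ j) F y / fact (j - Suc k) * (x - y) ^ (j - Suc k) else 0)) (at x)" for j
  proof (cases "Suc k \<le> j")
    case True
    then obtain m where m: "j - k = Suc m" "j - Suc k = m" by (metis Suc_diff_Suc Suc_le_eq)
    have "((\<lambda>x. (deriv ^^ j) F y / fact (Suc m) * (x - y) ^ Suc m) has_real_derivative
        (deriv ^^ j) F y / fact (Suc m) * (real (Suc m) * (x - y) ^ m)) (at x)"
      using DERIV_power[OF DERIV_diff[OF DERIV_ident DERIV_const], where n = "Suc m"]
      by (intro DERIV_cmult) simp
    moreover have "(deriv ^^ j) F y / fact (Suc m) * (real (Suc m) * (x - y) ^ m) =
        (deriv ^^ j) F y / fact m * (x - y) ^ m"
      by (simp add: field_simps del: of_nat_Suc)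
    ultimately show ?thesis using True m by (simp del: fact_Suc power_Suc)
  next
    case False
    then show ?thesis by (cases "k = j") auto
  qed
  then show ?thesis unfolding taylor_deriv_def[abs_def] by (intro DERIV_sum) blast
qed

lemma taylor_deriv_C_inf: "taylor_deriv q y 0 F \<in> C_inf"
  using C_infI_seq[of "\<lambda>k. taylor_deriv q y k F", OF taylor_deriv_DERIV] .

lemma deriv_funpow_taylor: "(deriv ^^ k) (taylor_deriv q y 0 F) = taylor_deriv q y k F"
  using deriv_funpow_eqI[of "\<lambda>k. taylor_deriv q y k F", OF taylor_deriv_DERIV] .

lemma taylor_deriv_at:
  assumes "k \<le> q" shows "taylor_deriv q y k F y = (deriv ^^ k) F y"
proof -
  have "taylor_deriv q y k F y = (\<Sum>j\<le>q. if k = j then (deriv ^^ j) F y else 0)"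
    unfolding taylor_deriv_def by (intro sum.cong) (auto simp: power_0_left)
  with assms show ?thesis by simp
qed

lemma taylor_deriv_top: "taylor_deriv q y q F x = (deriv ^^ q) F y"
proof -
  have "taylor_deriv q y q F x = (\<Sum>j\<le>q. if q = j then (deriv ^^ j) F y else 0)"
    unfolding taylor_deriv_def by (intro sum.cong) auto
  then show ?thesis by simp
qed

lemma taylor_deriv_Suc_top: "taylor_deriv q y (Suc q) F x = 0"
  unfolding taylor_deriv_def by (intro sum.neutral) auto

lemma taylor_deriv_add:
  "F \<in> C_inf \<Longrightarrow> G \<in> C_inf \<Longrightarrow>
     taylor_deriv q y k (\<lambda>x. F x + G x) x = taylor_deriv q y k F x + taylor_deriv q y k G x"
  unfolding taylor_deriv_def sum.distrib[symmetric]
  by (intro sum.cong) (auto simp: deriv_funpow_add field_simps)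

lemma taylor_deriv_cmult:
  "F \<in> C_inf \<Longrightarrow> taylor_deriv q y k (\<lambda>x. c * F x) x = c * taylor_deriv q y k F x"
  unfolding taylor_deriv_def sum_distrib_left
  by (intro sum.cong) (auto simp: deriv_funpow_cmult field_simps)

lemma taylor_remainder_bound:
  assumes "F \<in> C_inf" "\<And>z. z \<in> closed_segment y x \<Longrightarrow> \<bar>(deriv ^^ q) F z\<bar> \<le> B" "k \<le> q"
  shows "\<bar>(deriv ^^ k) F x - taylor_deriv q y k F x\<bar> \<le> 2 * B * \<bar>x - y\<bar> ^ (q - k)"
proof -
  let ?H = "\<lambda>x. F x - taylor_deriv q y 0 F x"
  have H: "(deriv ^^ k) ?H = (\<lambda>x. (deriv ^^ k) F x - taylor_deriv q y k F x)" for k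
    by (simp add: deriv_funpow_diff assms(1) taylor_deriv_C_inf deriv_funpow_taylor)
  have "\<bar>(deriv ^^ k) ?H x\<bar> \<le> (2 * B) * \<bar>x - y\<bar> ^ (q - k)"
  proof (rule flat_remainder_bound)
    show "?H \<in> C_inf" by (intro C_inf_diff assms taylor_deriv_C_inf)
    show "(deriv ^^ j) ?H y = 0" if "j < q" for j
      using that by (simp add: H taylor_deriv_at)
    \<comment> \<open>The Taylor polynomial contains the term of order \<open>q\<close>, so this
      derivative is a difference of two values of the derivative of \<open>F\<close>, whence the
      factor 2.\<close>
    show "\<bar>(deriv ^^ q) ?H z\<bar> \<le> 2 * B" if "z \<in> closed_segment y x" for z
      using assms(2)[OF that] assms(2)[of y] by (simp add: H taylor_deriv_top)
  qed fact
  then show ?thesis by (simp add: H)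
qed

text \<open>One derivative more annihilates the Taylor polynomial, and the factor 2
  disappears.\<close>

lemma taylor_remainder_bound_Suc:
  assumes "F \<in> C_inf" "\<And>z. z \<in> closed_segment y x \<Longrightarrow> \<bar>(deriv ^^ Suc q) F z\<bar> \<le> B"
  shows "\<bar>F x - taylor_deriv q y 0 F x\<bar> \<le> B * \<bar>x - y\<bar> ^ Suc q"
proof -
  let ?H = "\<lambda>x. F x - taylor_deriv q y 0 F x"
  have H: "(deriv ^^ k) ?H = (\<lambda>x. (deriv ^^ k) F x - taylor_deriv q y k F x)" for k
    by (simp add: deriv_funpow_diff assms(1) taylor_deriv_C_inf deriv_funpow_taylor del: funpow.simps)
  have "\<bar>(deriv ^^ 0) ?H x\<bar> \<le> B * \<bar>x - y\<bar> ^ (Suc q - 0)"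
  proof (rule flat_remainder_bound)
    show "?H \<in> C_inf" by (intro C_inf_diff assms taylor_deriv_C_inf)
    show "(deriv ^^ j) ?H y = 0" if "j < Suc q" for j
      using that by (simp add: H taylor_deriv_at)
    show "\<bar>(deriv ^^ Suc q) ?H z\<bar> \<le> B" if "z \<in> closed_segment y x" for z
      using assms(2)[OF that] unfolding H taylor_deriv_Suc_top by simp
  qed simp
  then show ?thesis by simp
qed

lemma restrict_C_inf_whitney: "F \<in> C_inf \<Longrightarrow> restrict F K \<in> whitney_space K"
  by (auto simp: whitney_space_def)

lemma whitney_deriv_taylor_rem:
  assumes K: "perfect_set K" and F: "F \<in> C_inf" and "x \<in> K" "y \<in> K"
  shows "whitney_deriv K k (taylor_rem K q y (restrict F K)) x =
    (deriv ^^ k) F x - taylor_deriv q y k F x"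
proof -
  have "taylor_poly K q y (restrict F K) z = taylor_deriv q y 0 F z" for z
    using assms by (simp add: taylor_poly_def taylor_deriv_def whitney_deriv_eq)
  then have "taylor_rem K q y (restrict F K) = restrict (\<lambda>x. F x - taylor_deriv q y 0 F x) K"
    by (auto simp: taylor_rem_def)
  then show ?thesis
    using assms by (simp add: whitney_deriv_eq C_inf_diff taylor_deriv_C_inf deriv_funpow_diff
        deriv_funpow_taylor)
qed

section \<open>Whitney norms computed from smooth extensions\<close>

locale perfect_compact =
  fixes K :: "real set"
  assumes perfect: "perfect_set K" and compact: "compact K" and nonempty: "K \<noteq> {}"
begin

lemma ex_two_points: "\<exists>x y. x \<in> K \<and> y \<in> K \<and> x \<noteq> y"
  using perfect nonempty unfolding perfect_set_def islimpt_def by (metis UNIV_I ex_in_conv open_UNIV)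

definition jet_set :: "nat \<Rightarrow> (real \<Rightarrow> real) \<Rightarrow> real set" where
  "jet_set q F = {\<bar>(deriv ^^ k) F x\<bar> | k x. k \<le> q \<and> x \<in> K}"

definition rem_set :: "nat \<Rightarrow> (real \<Rightarrow> real) \<Rightarrow> real set" where
  "rem_set q F = {\<bar>(deriv ^^ k) F x - taylor_deriv q y k F x\<bar> / \<bar>x - y\<bar> ^ (q - k) | k x y.
            k \<le> q \<and> x \<in> K \<and> y \<in> K \<and> x \<noteq> y}"

text \<open>On a perfect set all derivatives are determined by the values, so both suprema may be
  computed from any smooth extension \<open>F\<close> instead of the chosen one.\<close>

lemma whitney_norm_eq:
  assumes "F \<in> C_inf"
  shows "whitney_norm K q (restrict F K) = Sup (jet_set q F) + Sup (rem_set q F)"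
proof -
  have "{\<bar>whitney_deriv K k (restrict F K) x\<bar> | k x. k \<le> q \<and> x \<in> K} = jet_set q F"
    unfolding jet_set_def
    by (intro Collect_cong ex_cong1) (auto simp: whitney_deriv_eq[OF perfect assms])
  moreover have "{\<bar>whitney_deriv K k (taylor_rem K q y (restrict F K)) x\<bar> / \<bar>x - y\<bar> ^ (q - k) | k x y.
            k \<le> q \<and> x \<in> K \<and> y \<in> K \<and> x \<noteq> y} = rem_set q F"
    unfolding rem_set_def
    by (intro Collect_cong ex_cong1) (auto simp: whitney_deriv_taylor_rem[OF perfect assms])
  ultimately show ?thesis unfolding whitney_norm_def by simp
qed

lemma jet_set_nonempty: "jet_set q F \<noteq> {}"
  using nonempty unfolding jet_set_def by blast

lemma rem_set_nonempty: "rem_set q F \<noteq> {}"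
  using ex_two_points unfolding rem_set_def by blast

lemma hull_bound:
  assumes "F \<in> C_inf" "\<And>k z. k \<le> q \<Longrightarrow> z \<in> convex hull K \<Longrightarrow> \<bar>(deriv ^^ k) F z\<bar> \<le> B"
  shows "v \<in> jet_set q F \<Longrightarrow> v \<le> B" "v \<in> rem_set q F \<Longrightarrow> v \<le> 2 * B"
proof -
  have sub: "K \<subseteq> convex hull K" by (rule hull_subset)
  show "v \<in> jet_set q F \<Longrightarrow> v \<le> B"
    using assms(2) sub unfolding jet_set_def by auto
  assume "v \<in> rem_set q F"
  then obtain k x y where v: "v = \<bar>(deriv ^^ k) F x - taylor_deriv q y k F x\<bar> / \<bar>x - y\<bar> ^ (q - k)"
    and kxy: "k \<le> q" "x \<in> K" "y \<in> K" "x \<noteq> y"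
    unfolding rem_set_def by blast
  have "closed_segment y x \<subseteq> convex hull K"
    using kxy sub by (intro closed_segment_subset convex_convex_hull) auto
  then have "\<bar>(deriv ^^ k) F x - taylor_deriv q y k F x\<bar> \<le> 2 * B * \<bar>x - y\<bar> ^ (q - k)"
    using assms kxy by (intro taylor_remainder_bound) auto
  then show "v \<le> 2 * B"
    using kxy unfolding v by (simp add: divide_le_eq)
qed

text \<open>The jets contribute 1 and the Taylor remainders 2, the latter being estimated along
  segments between points of \<open>K\<close>, hence the convex hull. Different extensions of the
  same function may be used for different orders.\<close>

lemma whitney_norm_le:
  assumes "F \<in> C_inf" "\<And>k z. k \<le> q \<Longrightarrow> z \<in> convex hull K \<Longrightarrow> \<bar>(deriv ^^ k) F z\<bar> \<le> B"
  shows "whitney_norm K q (restrict F K) \<le> 3 * B"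
proof -
  have "Sup (jet_set q F) \<le> B" "Sup (rem_set q F) \<le> 2 * B"
    using hull_bound[OF assms]
    by (auto intro!: cSup_least jet_set_nonempty rem_set_nonempty)
  then show ?thesis using whitney_norm_eq[OF assms(1)] by simp
qed

lemma bdd_sets:
  assumes "F \<in> C_inf"
  shows "bdd_above (jet_set q F)" "bdd_above (rem_set q F)"
proof -
  obtain B where B: "\<And>k x. k \<le> q \<Longrightarrow> x \<in> convex hull K \<Longrightarrow> \<bar>(deriv ^^ k) F x\<bar> \<le> B"
    using deriv_funpow_bounded_on_compact[OF assms compact_convex_hull[OF compact], of q] by metis
  show "bdd_above (jet_set q F)" "bdd_above (rem_set q F)"
    using hull_bound[OF assms, of q B, OF B] by (auto simp: bdd_above_def)
qed

lemma Sup_jet_ge: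
  "F \<in> C_inf \<Longrightarrow> k \<le> q \<Longrightarrow> x \<in> K \<Longrightarrow> \<bar>(deriv ^^ k) F x\<bar> \<le> Sup (jet_set q F)"
  using bdd_sets by (intro cSup_upper) (auto simp: jet_set_def)

lemma Sup_rem_ge:
  "F \<in> C_inf \<Longrightarrow> k \<le> q \<Longrightarrow> x \<in> K \<Longrightarrow> y \<in> K \<Longrightarrow> x \<noteq> y \<Longrightarrow>
     \<bar>(deriv ^^ k) F x - taylor_deriv q y k F x\<bar> / \<bar>x - y\<bar> ^ (q - k) \<le> Sup (rem_set q F)"
  using bdd_sets by (intro cSup_upper) (auto simp: rem_set_def)

lemma Sup_nonneg:
  assumes "F \<in> C_inf"
  shows "0 \<le> Sup (jet_set q F)" "0 \<le> Sup (rem_set q F)"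
proof -
  obtain x y where xy: "x \<in> K" "y \<in> K" "x \<noteq> y" using ex_two_points by blast
  show "0 \<le> Sup (jet_set q F)"
    by (rule order_trans[OF _ Sup_jet_ge[OF assms, of 0 q x]]) (use xy in auto)
  show "0 \<le> Sup (rem_set q F)"
    by (rule order_trans[OF _ Sup_rem_ge[OF assms, of 0 q x y]]) (use xy in auto)
qed

lemma whitney_norm_nonneg: "f \<in> whitney_space K \<Longrightarrow> 0 \<le> whitney_norm K q f"
  unfolding whitney_space_def by (auto simp: whitney_norm_eq intro!: add_nonneg_nonneg Sup_nonneg)

lemma abs_le_whitney_norm:
  assumes "f \<in> whitney_space K" "x \<in> K"
  shows "\<bar>f x\<bar> \<le> whitney_norm K q f"
proof -
  obtain F where F: "F \<in> C_inf" "f = restrict F K" using assms by (auto simp: whitney_space_def)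
  show ?thesis
    using Sup_jet_ge[OF F(1), of 0 q x] Sup_nonneg(2)[OF F(1), of q] assms
    by (simp add: F(2) whitney_norm_eq[OF F(1)])
qed

text \<open>The order 0 part of the remainder seminorm: this is all that interpolation uses of the
  Whitney norms of \<open>f\<close>.\<close>

lemma whitney_taylor_approx:
  assumes "f \<in> whitney_space K" "y \<in> K"
  obtains p :: "real poly" where "degree p \<le> q"
    "\<And>x. x \<in> K \<Longrightarrow> \<bar>f x - poly p x\<bar> \<le> whitney_norm K q f * \<bar>x - y\<bar> ^ q"
proof -
  obtain F where F: "F \<in> C_inf" "f = restrict F K" using assms by (auto simp: whitney_space_def)
  define p where "p = (\<Sum>j\<le>q. smult ((deriv ^^ j) F y / fact j) ([:-y, 1:] ^ j))"
  have poly_p: "poly p x = taylor_deriv q y 0 F x" for x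
    by (simp add: p_def taylor_deriv_def poly_sum algebra_simps)
  have "degree ([:-y, 1:] ^ j) \<le> j" for j
    by (rule order_trans[OF degree_power_le]) simp
  then have "degree p \<le> q"
    unfolding p_def
    by (intro degree_sum_le) (auto intro: order_trans[OF degree_smult_le] order_trans)
  moreover have "\<bar>f x - poly p x\<bar> \<le> whitney_norm K q f * \<bar>x - y\<bar> ^ q" if "x \<in> K" for x
  proof (cases "x = y")
    case True
    then show ?thesis
      using that whitney_norm_nonneg[OF assms(1)]
      by (simp add: F(2) poly_p taylor_deriv_at)
  next
    case False
    have "\<bar>F x - taylor_deriv q y 0 F x\<bar> / \<bar>x - y\<bar> ^ q \<le> whitney_norm K q f"
      using Sup_rem_ge[OF F(1) _ that assms(2) False, of 0 q] Sup_nonneg(1)[OF F(1), of q]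
      by (simp add: F(2) whitney_norm_eq[OF F(1)])
    then show ?thesis
      using False that by (simp add: F(2) poly_p divide_le_eq)
  qed
  ultimately show ?thesis by (rule that)
qed

section \<open>Subadditivity and homogeneity of the Whitney norms\<close>

lemma whitney_norm_add_C_inf:
  assumes F: "F \<in> C_inf" and G: "G \<in> C_inf"
  shows "whitney_norm K q (restrict (\<lambda>x. F x + G x) K) \<le>
    whitney_norm K q (restrict F K) + whitney_norm K q (restrict G K)"
proof -
  have "Sup (jet_set q (\<lambda>x. F x + G x)) \<le> Sup (jet_set q F) + Sup (jet_set q G)"
  proof (rule cSup_least[OF jet_set_nonempty])
    fix v assume "v \<in> jet_set q (\<lambda>x. F x + G x)"
    then obtain k x where "v = \<bar>(deriv ^^ k) F x + (deriv ^^ k) G x\<bar>" "k \<le> q" "x \<in> K"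
      using F G by (auto simp: jet_set_def deriv_funpow_add)
    with Sup_jet_ge[OF F, of k q x] Sup_jet_ge[OF G, of k q x]
    show "v \<le> Sup (jet_set q F) + Sup (jet_set q G)" by linarith
  qed
  moreover have "Sup (rem_set q (\<lambda>x. F x + G x)) \<le> Sup (rem_set q F) + Sup (rem_set q G)"
  proof (rule cSup_least[OF rem_set_nonempty])
    fix v assume "v \<in> rem_set q (\<lambda>x. F x + G x)"
    then obtain k x y where kxy: "k \<le> q" "x \<in> K" "y \<in> K" "x \<noteq> y"
      and v: "v = \<bar>((deriv ^^ k) F x - taylor_deriv q y k F x) +
        ((deriv ^^ k) G x - taylor_deriv q y k G x)\<bar> / \<bar>x - y\<bar> ^ (q - k)"
      using F G by (auto simp: rem_set_def deriv_funpow_add taylor_deriv_add algebra_simps)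
    have "v \<le> \<bar>(deriv ^^ k) F x - taylor_deriv q y k F x\<bar> / \<bar>x - y\<bar> ^ (q - k) +
        \<bar>(deriv ^^ k) G x - taylor_deriv q y k G x\<bar> / \<bar>x - y\<bar> ^ (q - k)"
      unfolding v add_divide_distrib[symmetric] by (intro divide_right_mono) auto
    with Sup_rem_ge[OF F kxy] Sup_rem_ge[OF G kxy]
    show "v \<le> Sup (rem_set q F) + Sup (rem_set q G)" by linarith
  qed
  ultimately show ?thesis using F G by (simp add: whitney_norm_eq C_inf_add)
qed

lemma whitney_norm_cmult_C_inf:
  assumes F: "F \<in> C_inf"
  shows "whitney_norm K q (restrict (\<lambda>x. c * F x) K) \<le> \<bar>c\<bar> * whitney_norm K q (restrict F K)"
proof -
  have "Sup (jet_set q (\<lambda>x. c * F x)) \<le> \<bar>c\<bar> * Sup (jet_set q F)"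
  proof (rule cSup_least[OF jet_set_nonempty])
    fix v assume "v \<in> jet_set q (\<lambda>x. c * F x)"
    then obtain k x where "v = \<bar>c\<bar> * \<bar>(deriv ^^ k) F x\<bar>" "k \<le> q" "x \<in> K"
      using F by (auto simp: jet_set_def deriv_funpow_cmult abs_mult)
    with Sup_jet_ge[OF F, of k q x] show "v \<le> \<bar>c\<bar> * Sup (jet_set q F)"
      by (simp add: mult_left_mono)
  qed
  moreover have "Sup (rem_set q (\<lambda>x. c * F x)) \<le> \<bar>c\<bar> * Sup (rem_set q F)"
  proof (rule cSup_least[OF rem_set_nonempty])
    fix v assume "v \<in> rem_set q (\<lambda>x. c * F x)"
    then obtain k x y where kxy: "k \<le> q" "x \<in> K" "y \<in> K" "x \<noteq> y"
      and v: "v = \<bar>c * ((deriv ^^ k) F x - taylor_deriv q y k F x)\<bar> / \<bar>x - y\<bar> ^ (q - k)"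
      using F by (auto simp: rem_set_def deriv_funpow_cmult taylor_deriv_cmult algebra_simps)
    from mult_left_mono[OF Sup_rem_ge[OF F kxy], of "\<bar>c\<bar>"]
    show "v \<le> \<bar>c\<bar> * Sup (rem_set q F)" by (simp add: v abs_mult)
  qed
  ultimately show ?thesis using F by (simp add: whitney_norm_eq C_inf_mult distrib_left)
qed

lemma whitney_space_add:
  "f \<in> whitney_space K \<Longrightarrow> g \<in> whitney_space K \<Longrightarrow> (\<lambda>x\<in>K. f x + g x) \<in> whitney_space K"
  "f \<in> whitney_space K \<Longrightarrow> g \<in> whitney_space K \<Longrightarrow>
     whitney_norm K q (\<lambda>x\<in>K. f x + g x) \<le> whitney_norm K q f + whitney_norm K q g"
proof -
  assume "f \<in> whitney_space K" "g \<in> whitney_space K"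
  then obtain F G where FG: "F \<in> C_inf" "G \<in> C_inf" "f = restrict F K" "g = restrict G K"
    by (auto simp: whitney_space_def)
  then have eq: "(\<lambda>x\<in>K. f x + g x) = restrict (\<lambda>x. F x + G x) K" by auto
  show "(\<lambda>x\<in>K. f x + g x) \<in> whitney_space K"
    unfolding eq using FG by (intro restrict_C_inf_whitney C_inf_add)
  show "whitney_norm K q (\<lambda>x\<in>K. f x + g x) \<le> whitney_norm K q f + whitney_norm K q g"
    unfolding eq using whitney_norm_add_C_inf FG by simp
qed

lemma whitney_space_cmult:
  "f \<in> whitney_space K \<Longrightarrow> (\<lambda>x\<in>K. c * f x) \<in> whitney_space K"
  "f \<in> whitney_space K \<Longrightarrow> whitney_norm K q (\<lambda>x\<in>K. c * f x) \<le> \<bar>c\<bar> * whitney_norm K q f"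
proof -
  assume "f \<in> whitney_space K"
  then obtain F where F: "F \<in> C_inf" "f = restrict F K"
    by (auto simp: whitney_space_def)
  then have eq: "(\<lambda>x\<in>K. c * f x) = restrict (\<lambda>x. c * F x) K" by auto
  show "(\<lambda>x\<in>K. c * f x) \<in> whitney_space K"
    unfolding eq using F by (intro restrict_C_inf_whitney C_inf_mult) auto
  show "whitney_norm K q (\<lambda>x\<in>K. c * f x) \<le> \<bar>c\<bar> * whitney_norm K q f"
    unfolding eq using whitney_norm_cmult_C_inf F by simp
qed

lemma diff_eq_add_cmult:
  fixes f g :: "real \<Rightarrow> real"
  shows "(\<lambda>x\<in>K. f x - g x) = (\<lambda>x\<in>K. f x + (\<lambda>x\<in>K. -1 * g x) x)"
  by auto

lemma whitney_space_diff:
  "f \<in> whitney_space K \<Longrightarrow> g \<in> whitney_space K \<Longrightarrow> (\<lambda>x\<in>K. f x - g x) \<in> whitney_space K"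
  "f \<in> whitney_space K \<Longrightarrow> g \<in> whitney_space K \<Longrightarrow>
     whitney_norm K q (\<lambda>x\<in>K. f x - g x) \<le> whitney_norm K q f + whitney_norm K q g"
  unfolding diff_eq_add_cmult
  using whitney_space_add(1)[of f "\<lambda>x\<in>K. -1 * g x"] whitney_space_cmult(1)[of g "-1"]
    whitney_space_add(2)[of f "\<lambda>x\<in>K. -1 * g x" q] whitney_space_cmult(2)[of g q "-1"]
  by auto

lemma whitney_norm_triangle:
  assumes "f \<in> whitney_space K" "g \<in> whitney_space K" "h \<in> whitney_space K"
  shows "whitney_norm K q (\<lambda>x\<in>K. f x - h x) \<le>
    whitney_norm K q (\<lambda>x\<in>K. f x - g x) + whitney_norm K q (\<lambda>x\<in>K. g x - h x)"
proof -
  have "(\<lambda>x\<in>K. f x - h x) = (\<lambda>x\<in>K. (\<lambda>x\<in>K. f x - g x) x + (\<lambda>x\<in>K. g x - h x) x)" by auto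
  then show ?thesis
    using whitney_space_add(2)[OF whitney_space_diff(1)[OF assms(1,2)] whitney_space_diff(1)[OF assms(2,3)]]
    by simp
qed

lemma whitney_zero: "(\<lambda>x\<in>K. 0) \<in> whitney_space K" "whitney_norm K q (\<lambda>x\<in>K. 0) = 0"
proof -
  show "(\<lambda>x\<in>K. 0) \<in> whitney_space K" by (intro restrict_C_inf_whitney) simp
  then show "whitney_norm K q (\<lambda>x\<in>K. 0) = 0"
    using whitney_norm_le[of "\<lambda>x. 0" q 0] whitney_norm_nonneg[of "\<lambda>x\<in>K. 0" q] by simp
qed

end

section \<open>Continuity of operators on Whitney functions\<close>

lemma C_inf_norm_bdd:
  assumes "F \<in> C_inf"
  shows "bdd_above {\<bar>(deriv ^^ k) F x\<bar> | k x. k \<le> q \<and> x \<in> {- real m..real m}}"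
proof -
  obtain B where "\<And>k x. k \<le> q \<Longrightarrow> x \<in> {- real m..real m} \<Longrightarrow> \<bar>(deriv ^^ k) F x\<bar> \<le> B"
    using deriv_funpow_bounded_on_compact[OF assms compact_Icc[of "- real m" "real m"], of q] by metis
  then show ?thesis by (auto simp: bdd_above_def)
qed

lemma abs_le_C_inf_norm:
  assumes "F \<in> C_inf" "k \<le> q" "\<bar>x\<bar> \<le> real m"
  shows "\<bar>(deriv ^^ k) F x\<bar> \<le> C_inf_norm m q F"
  unfolding C_inf_norm_def
proof (rule cSup_upper)
  show "\<bar>(deriv ^^ k) F x\<bar> \<in> {\<bar>(deriv ^^ k) F x\<bar> | k x. k \<le> q \<and> x \<in> {- real m..real m}}"
    by (intro CollectI exI[of _ k] exI[of _ x]) (use assms in auto)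
qed (rule C_inf_norm_bdd[OF assms(1)])

lemma C_inf_norm_least:
  assumes "\<And>k x. k \<le> q \<Longrightarrow> \<bar>x\<bar> \<le> real m \<Longrightarrow> \<bar>(deriv ^^ k) F x\<bar> \<le> B"
  shows "C_inf_norm m q F \<le> B"
  unfolding C_inf_norm_def
proof (rule cSup_least)
  show "{\<bar>(deriv ^^ k) F x\<bar> | k x. k \<le> q \<and> x \<in> {- real m..real m}} \<noteq> {}"
    by (auto intro!: exI[of _ 0])
qed (use assms in auto)

lemma C_inf_norm_triangle:
  assumes "F \<in> C_inf" "G \<in> C_inf"
  shows "C_inf_norm m q (\<lambda>x. F x + G x) \<le> C_inf_norm m q F + C_inf_norm m q G"
proof (rule C_inf_norm_least)
  fix k x assume "k \<le> q" "\<bar>x\<bar> \<le> real m"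
  from abs_le_C_inf_norm[OF assms(1) this] abs_le_C_inf_norm[OF assms(2) this]
  show "\<bar>(deriv ^^ k) (\<lambda>x. F x + G x) x\<bar> \<le> C_inf_norm m q F + C_inf_norm m q G"
    using assms by (simp add: deriv_funpow_add)
qed

context perfect_compact
begin

text \<open>The single Whitney norms are not compared with each other; their partial sums increase
  with \<open>R\<close> and thus form a directed family of seminorms.\<close>

definition graded_norm :: "nat \<Rightarrow> (real \<Rightarrow> real) \<Rightarrow> real" where
  "graded_norm R f = (\<Sum>r\<le>R. whitney_norm K r f)"

lemma whitney_norm_le_graded_norm:
  "f \<in> whitney_space K \<Longrightarrow> r \<le> R \<Longrightarrow> whitney_norm K r f \<le> graded_norm R f"
  unfolding graded_norm_def by (intro member_le_sum) (auto simp: whitney_norm_nonneg)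

lemma graded_norm_nonneg: "f \<in> whitney_space K \<Longrightarrow> 0 \<le> graded_norm R f"
  unfolding graded_norm_def by (intro sum_nonneg whitney_norm_nonneg)

lemma openin_semiball:
  "f \<in> whitney_space K \<Longrightarrow> 0 < e \<Longrightarrow>
     openin (whitney_topology K) {g \<in> whitney_space K. whitney_norm K q (\<lambda>x\<in>K. g x - f x) < e}"
  unfolding whitney_topology_def by (rule topology_generated_by_Basis) blast

lemma topspace_whitney: "topspace (whitney_topology K) = whitney_space K"
proof
  show "topspace (whitney_topology K) \<subseteq> whitney_space K"
    unfolding whitney_topology_def topology_generated_by_topspace by blast
  show "whitney_space K \<subseteq> topspace (whitney_topology K)"
  proof
    fix f assume f: "f \<in> whitney_space K"
    then have "openin (whitney_topology K) {g \<in> whitney_space K. whitney_norm K 0 (\<lambda>x\<in>K. g x - f x) < 1}"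
      by (intro openin_semiball) simp_all
    moreover have "(\<lambda>x\<in>K. f x - f x) = (\<lambda>x\<in>K. 0)" by simp
    then have "f \<in> {g \<in> whitney_space K. whitney_norm K 0 (\<lambda>x\<in>K. g x - f x) < 1}"
      using f whitney_zero(2) by simp
    ultimately show "f \<in> topspace (whitney_topology K)"
      using openin_subset by blast
  qed
qed

lemma openin_C_inf_semiball:
  assumes "F \<in> C_inf" "0 < e"
  shows "openin C_inf_topology {G \<in> C_inf. C_inf_norm m q (\<lambda>x. G x - F x) < e}"
  unfolding C_inf_topology_def using assms by (intro topology_generated_by_Basis) blast

lemma topspace_C_inf: "topspace C_inf_topology = C_inf"
proof
  show "topspace C_inf_topology \<subseteq> C_inf"
    unfolding C_inf_topology_def topology_generated_by_topspace by blast
  show "C_inf \<subseteq> topspace C_inf_topology"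
  proof
    fix F assume F: "F \<in> C_inf"
    have "C_inf_norm 0 0 (\<lambda>x. F x - F x) \<le> 0" by (rule C_inf_norm_least) simp
    with F have "F \<in> {G \<in> C_inf. C_inf_norm 0 0 (\<lambda>x. G x - F x) < 1}" by simp
    with openin_subset[OF openin_C_inf_semiball[OF F zero_less_one, of 0 0]]
    show "F \<in> topspace C_inf_topology" by blast
  qed
qed

lemma whitney_linear_diff:
  assumes W: "whitney_linear K W" and "f \<in> whitney_space K" "g \<in> whitney_space K"
  shows "W (\<lambda>x\<in>K. f x - g x) = (\<lambda>x. W f x - W g x)"
proof -
  have "W (\<lambda>x\<in>K. f x + (\<lambda>x\<in>K. -1 * g x) x) = (\<lambda>x. W f x + W (\<lambda>x\<in>K. -1 * g x) x)"
    using assms whitney_space_cmult(1) unfolding whitney_linear_def by blast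
  moreover have "W (\<lambda>x\<in>K. -1 * g x) = (\<lambda>x. -1 * W g x)"
    using assms unfolding whitney_linear_def by blast
  ultimately show ?thesis unfolding diff_eq_add_cmult by simp
qed

lemma continuous_whitney_operatorI:
  assumes W: "whitney_linear K W" and range: "\<And>f. f \<in> whitney_space K \<Longrightarrow> W f \<in> C_inf"
    and bound: "\<And>q. \<exists>C R. \<forall>f\<in>whitney_space K. \<forall>k\<le>q. \<forall>x. \<bar>(deriv ^^ k) (W f) x\<bar> \<le> C * graded_norm R f"
  shows "continuous_map (whitney_topology K) C_inf_topology W"
  unfolding C_inf_topology_def
proof (rule continuous_on_generated_topo)
  fix U assume "U \<in> {{G \<in> C_inf. C_inf_norm m q (\<lambda>x. G x - F x) < e} | F m q e. F \<in> C_inf \<and> 0 < e}"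
  then obtain F m q e where U: "U = {G \<in> C_inf. C_inf_norm m q (\<lambda>x. G x - F x) < e}"
    and F: "F \<in> C_inf" and "0 < e" by blast
  obtain C R where CR: "\<forall>f\<in>whitney_space K. \<forall>k\<le>q. \<forall>x. \<bar>(deriv ^^ k) (W f) x\<bar> \<le> C * graded_norm R f"
    using bound by blast
  show "openin (whitney_topology K) (W -` U \<inter> topspace (whitney_topology K))"
  proof (subst openin_subopen, intro ballI)
    fix f assume "f \<in> W -` U \<inter> topspace (whitney_topology K)"
    then have f: "f \<in> whitney_space K" "C_inf_norm m q (\<lambda>x. W f x - F x) < e"
      by (auto simp: U topspace_whitney)
    define d where "d = e - C_inf_norm m q (\<lambda>x. W f x - F x)"
    \<comment> \<open>Each of the \<open>R + 1\<close> norms may use an equal share of the slack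
      \<open>d\<close>; the summand 1 avoids a division by zero when \<open>C\<close> is 0.\<close>
    define \<eta> where "\<eta> = d / ((\<bar>C\<bar> + 1) * (real R + 1))"
    have "0 < d" using f by (simp add: d_def)
    then have "0 < \<eta>" by (simp add: \<eta>_def)
    define T where "T = (\<Inter>r\<le>R. {g \<in> whitney_space K. whitney_norm K r (\<lambda>x\<in>K. g x - f x) < \<eta>})"
    have "openin (whitney_topology K) T"
      unfolding T_def using f(1) \<open>0 < \<eta>\<close> by (intro openin_INT2 openin_semiball) auto
    moreover have "f \<in> T"
    proof -
      have "(\<lambda>x\<in>K. f x - f x) = (\<lambda>x\<in>K. 0)" by simp
      then show ?thesis using f(1) \<open>0 < \<eta>\<close> whitney_zero(2) by (auto simp: T_def)
    qed
    moreover have "T \<subseteq> W -` U \<inter> topspace (whitney_topology K)"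
    proof
      fix g assume "g \<in> T"
      then have g: "g \<in> whitney_space K" "\<And>r. r \<le> R \<Longrightarrow> whitney_norm K r (\<lambda>x\<in>K. g x - f x) < \<eta>"
        by (auto simp: T_def)
      let ?h = "\<lambda>x\<in>K. g x - f x"
      have h: "?h \<in> whitney_space K" using whitney_space_diff f g by blast
      have "graded_norm R ?h \<le> (\<Sum>r\<le>R. \<eta>)"
        unfolding graded_norm_def using g(2) by (intro sum_mono) (auto intro: less_imp_le)
      then have gr: "graded_norm R ?h \<le> (real R + 1) * \<eta>" by (simp add: algebra_simps)
      have "C_inf_norm m q (W ?h) \<le> C * graded_norm R ?h"
        using CR h by (intro C_inf_norm_least) blast
      also have "\<dots> \<le> \<bar>C\<bar> * ((real R + 1) * \<eta>)"
        using gr graded_norm_nonneg[OF h] by (intro mult_mono) auto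
      also have "\<dots> < (\<bar>C\<bar> + 1) * ((real R + 1) * \<eta>)"
        using \<open>0 < \<eta>\<close> by (intro mult_strict_right_mono) auto
      also have "\<dots> = d" by (simp add: \<eta>_def field_simps add_pos_nonneg less_imp_neq[symmetric])
      finally have *: "C_inf_norm m q (W ?h) < d" .
      have "(\<lambda>x. W g x - F x) = (\<lambda>x. W ?h x + (W f x - F x))"
        using whitney_linear_diff[OF W g(1) f(1)] by auto
      then have "C_inf_norm m q (\<lambda>x. W g x - F x) \<le>
          C_inf_norm m q (W ?h) + C_inf_norm m q (\<lambda>x. W f x - F x)"
        using C_inf_norm_triangle[OF range[OF h] C_inf_diff[OF range[OF f(1)] F]] by simp
      with * have "C_inf_norm m q (\<lambda>x. W g x - F x) < e" by (simp add: d_def)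
      with g(1) range show "g \<in> W -` U \<inter> topspace (whitney_topology K)"
        by (auto simp: U topspace_whitney)
    qed
    ultimately show "\<exists>T. openin (whitney_topology K) T \<and> f \<in> T \<and>
        T \<subseteq> W -` U \<inter> topspace (whitney_topology K)"
      by blast
  qed
next
  show "W ` topspace (whitney_topology K) \<subseteq>
      \<Union> {{G \<in> C_inf. C_inf_norm m q (\<lambda>x. G x - F x) < e} | F m q e. F \<in> C_inf \<and> 0 < e}"
    unfolding topspace_C_inf[unfolded C_inf_topology_def topology_generated_by_topspace] topspace_whitney
    using range by blast
qed

text \<open>Induction over the generation of the topology. The generating semiballs have arbitrary
  centres, and the triangle inequality recentres them at zero; intersections are handled by the
  larger order and the smaller radius.\<close>

lemma nhds_zero_semiball:
  assumes "openin (whitney_topology K) V" "(\<lambda>x\<in>K. 0) \<in> V"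
  shows "\<exists>R \<eta>. 0 < \<eta> \<and> {f \<in> whitney_space K. graded_norm R f < \<eta>} \<subseteq> V"
proof -
  have "generate_topology_on {{g \<in> whitney_space K. whitney_norm K q (\<lambda>x\<in>K. g x - f x) < e} | f q e.
      f \<in> whitney_space K \<and> 0 < e} V"
    using assms(1) unfolding whitney_topology_def openin_topology_generated_by_iff .
  then show ?thesis using assms(2)
  proof induction
    case (Int a b)
    then obtain R \<eta> R' \<eta>' where
      *: "0 < \<eta>" "{f \<in> whitney_space K. graded_norm R f < \<eta>} \<subseteq> a"
        "0 < \<eta>'" "{f \<in> whitney_space K. graded_norm R' f < \<eta>'} \<subseteq> b"
      by auto
    have mono: "graded_norm r f \<le> graded_norm s f" if "f \<in> whitney_space K" "r \<le> s" for r s f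
      unfolding graded_norm_def using that by (intro sum_mono2) (auto simp: whitney_norm_nonneg)
    have "{f \<in> whitney_space K. graded_norm (max R R') f < min \<eta> \<eta>'} \<subseteq> a \<inter> b"
    proof
      fix f assume "f \<in> {f \<in> whitney_space K. graded_norm (max R R') f < min \<eta> \<eta>'}"
      then show "f \<in> a \<inter> b"
        using * mono[of f R "max R R'"] mono[of f R' "max R R'"] by fastforce
    qed
    with * show ?case by (intro exI[of _ "max R R'"] exI[of _ "min \<eta> \<eta>'"]) auto
  next
    case (UN S)
    then obtain V' where "V' \<in> S" "(\<lambda>x\<in>K. 0) \<in> V'" by blast
    with UN.IH show ?case by blast
  next
    case (Basis s)
    then obtain f q e where s: "s = {g \<in> whitney_space K. whitney_norm K q (\<lambda>x\<in>K. g x - f x) < e}"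
      and f: "f \<in> whitney_space K" by blast
    let ?z = "\<lambda>x\<in>K. 0 :: real"
    define \<eta> where "\<eta> = e - whitney_norm K q (\<lambda>x\<in>K. ?z x - f x)"
    have "0 < \<eta>" using Basis.prems by (simp add: s \<eta>_def)
    moreover have "{g \<in> whitney_space K. graded_norm q g < \<eta>} \<subseteq> s"
    proof
      fix g assume "g \<in> {g \<in> whitney_space K. graded_norm q g < \<eta>}"
      then have g: "g \<in> whitney_space K" "graded_norm q g < \<eta>" by auto
      have "g = (\<lambda>x\<in>K. g x - ?z x)"
        using g(1) by (auto simp: whitney_space_def fun_eq_iff)
      then have "whitney_norm K q (\<lambda>x\<in>K. g x - f x) \<le>
          whitney_norm K q g + whitney_norm K q (\<lambda>x\<in>K. ?z x - f x)"
        using whitney_norm_triangle[OF g(1) whitney_zero(1) f, of q] by simp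
      with whitney_norm_le_graded_norm[OF g(1), of q q] g
      show "g \<in> s" by (simp add: s \<eta>_def)
    qed
    ultimately show ?case by blast
  qed auto
qed

text \<open>Homogeneity: if the estimate failed for \<open>f\<close>, dividing \<open>f\<close> by
  the value of the derivative would give a function inside the neighbourhood of zero that is mapped
  into the unit semiball, although its image has a derivative of modulus 1.\<close>

lemma continuous_whitney_operatorD:
  assumes W: "whitney_linear K W"
    and cont: "continuous_map (whitney_topology K) C_inf_topology W"
  obtains C R where "0 < C" "\<And>f k x. f \<in> whitney_space K \<Longrightarrow> k \<le> q \<Longrightarrow> \<bar>x\<bar> \<le> real m \<Longrightarrow>
    \<bar>(deriv ^^ k) (W f) x\<bar> \<le> C * graded_norm R f"
proof -
  have range: "W f \<in> C_inf" if "f \<in> whitney_space K" for f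
    using cont that unfolding continuous_map_def topspace_whitney topspace_C_inf by auto
  define U where "U = {G \<in> C_inf. C_inf_norm m q (\<lambda>x. G x - 0) < 1}"
  have "openin C_inf_topology U"
    unfolding U_def using openin_C_inf_semiball[OF C_inf_const[of 0], of 1 m q] by simp
  then have op: "openin (whitney_topology K) {f \<in> whitney_space K. W f \<in> U}"
    using cont unfolding continuous_map_def topspace_whitney by blast
  have scale: "W (\<lambda>x\<in>K. c * f x) = (\<lambda>x. c * W f x)" if "f \<in> whitney_space K" for c f
    using W that unfolding whitney_linear_def by blast
  have "W (\<lambda>x\<in>K. 0) = (\<lambda>x. 0)"
    using scale[OF whitney_zero(1), of 0] by simp
  moreover have "C_inf_norm m q (\<lambda>x. 0) \<le> 0" by (rule C_inf_norm_least) simp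
  ultimately have "(\<lambda>x\<in>K. 0) \<in> {f \<in> whitney_space K. W f \<in> U}"
    using whitney_zero by (simp add: U_def)
  from nhds_zero_semiball[OF op this] obtain R \<eta> where "0 < \<eta>"
    and sub: "{f \<in> whitney_space K. graded_norm R f < \<eta>} \<subseteq> {f \<in> whitney_space K. W f \<in> U}" by blast
  have "\<bar>(deriv ^^ k) (W f) x\<bar> \<le> (1 / \<eta>) * graded_norm R f"
    if f: "f \<in> whitney_space K" and kx: "k \<le> q" "\<bar>x\<bar> \<le> real m" for f k x
  proof (rule ccontr)
    let ?v = "\<bar>(deriv ^^ k) (W f) x\<bar>"
    assume "\<not> ?v \<le> (1 / \<eta>) * graded_norm R f"
    then have less: "graded_norm R f < \<eta> * ?v" using \<open>0 < \<eta>\<close> by (simp add: field_simps)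
    with graded_norm_nonneg[OF f, of R] \<open>0 < \<eta>\<close> have "0 < ?v"
      by (metis abs_ge_zero linorder_not_less mult_zero_right order_less_le)
    let ?g = "\<lambda>x\<in>K. (1 / ?v) * f x"
    have g: "?g \<in> whitney_space K" by (rule whitney_space_cmult(1)[OF f])
    have "graded_norm R ?g \<le> (\<Sum>r\<le>R. \<bar>1 / ?v\<bar> * whitney_norm K r f)"
      unfolding graded_norm_def by (intro sum_mono whitney_space_cmult(2)[OF f])
    also have "\<dots> = graded_norm R f / ?v"
      unfolding graded_norm_def sum_distrib_left[symmetric] by simp
    also have "\<dots> < \<eta>" using less \<open>0 < ?v\<close> by (simp add: field_simps)
    finally have "W ?g \<in> U" using sub g by blast
    then have "C_inf_norm m q (W ?g) < 1" by (simp add: U_def)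
    moreover have "(deriv ^^ k) (W ?g) x = (1 / ?v) * (deriv ^^ k) (W f) x"
      unfolding scale[OF f] deriv_funpow_cmult[OF range[OF f]] ..
    then have "\<bar>(deriv ^^ k) (W ?g) x\<bar> = 1"
      using \<open>0 < ?v\<close> by (simp add: abs_mult)
    ultimately show False
      using abs_le_C_inf_norm[OF range[OF g] kx] by simp
  qed
  with \<open>0 < \<eta>\<close> show ?thesis by (intro that[of "1 / \<eta>" R]) auto
qed

end

section \<open>Lagrange interpolation and polynomial inequalities\<close>

text \<open>Over a general field, because real nodes serve the extension operator and complex ones
  the finiteness of the Markov factors.\<close>

definition lagrange_basis :: "(nat \<Rightarrow> 'a::field) \<Rightarrow> nat \<Rightarrow> nat \<Rightarrow> 'a poly" where
  "lagrange_basis x n i = (\<Prod>j\<in>{..<n} - {i}. smult (1 / (x i - x j)) [:- x j, 1:])"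

lemma degree_lagrange_basis: "i < n \<Longrightarrow> degree (lagrange_basis x n i) < n"
proof -
  assume "i < n"
  have "degree (lagrange_basis x n i) \<le> sum (degree \<circ> (\<lambda>j. smult (1 / (x i - x j)) [:- x j, 1:])) ({..<n} - {i})"
    unfolding lagrange_basis_def by (intro degree_prod_sum_le) auto
  also have "\<dots> \<le> (\<Sum>j\<in>{..<n} - {i}. 1)"
    by (intro sum_mono) (auto intro: order_trans[OF degree_smult_le])
  also have "\<dots> < n" using \<open>i < n\<close> by simp
  finally show ?thesis .
qed

lemma poly_lagrange_basis:
  assumes "inj_on x {..<n}" "i < n" "k < n"
  shows "poly (lagrange_basis x n i) (x k) = (if i = k then 1 else 0)"
proof (cases "i = k")
  case True
  have "poly (lagrange_basis x n i) (x k) = (\<Prod>j\<in>{..<n} - {i}. 1)"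
    unfolding lagrange_basis_def poly_prod
    by (intro prod.cong) (use assms True in \<open>auto simp: inj_on_def divide_simps\<close>)
  with True show ?thesis by simp
next
  case False
  then show ?thesis
    using assms unfolding lagrange_basis_def poly_prod by (auto intro!: prod_zero bexI[of _ k])
qed

lemma lagrange_interpolation:
  fixes p :: "'a::field poly"
  assumes inj: "inj_on x {..<n}" and "degree p < n"
  shows "p = (\<Sum>i<n. smult (poly p (x i)) (lagrange_basis x n i))" (is "p = ?q")
proof (rule poly_eqI_degree)
  fix y assume "y \<in> x ` {..<n}"
  then obtain k where k: "k < n" "y = x k" by auto
  have "poly ?q y = (\<Sum>i<n. if i = k then poly p (x k) else 0)"
    unfolding poly_sum k(2) by (intro sum.cong) (use inj k in \<open>auto simp: poly_lagrange_basis\<close>)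
  with k show "poly p y = poly ?q y" by simp
next
  have card: "card (x ` {..<n}) = n" using inj by (simp add: card_image)
  then show "degree p < card (x ` {..<n})" using assms by simp
  have "degree ?q \<le> n - 1"
  proof (rule degree_sum_le)
    fix i assume "i \<in> {..<n}"
    then show "degree (smult (poly p (x i)) (lagrange_basis x n i)) \<le> n - 1"
      using degree_lagrange_basis[of i n x] order_trans[OF degree_smult_le, of "lagrange_basis x n i" "n - 1"]
      by simp
  qed simp
  then show "degree ?q < card (x ` {..<n})" using card assms by simp
qed

text \<open>By Lagrange interpolation the top coefficient is a fixed linear form in the values at 0,
  ..., \<open>j\<close>.\<close>

lemma coeff_bound_by_values:
  "\<exists>C>0. \<forall>p :: real poly. \<forall>B. degree p \<le> j \<longrightarrow> (\<forall>i\<le>j. \<bar>poly p (real i)\<bar> \<le> B) \<longrightarrow> \<bar>coeff p j\<bar> \<le> C * B"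
proof -
  let ?L = "lagrange_basis real (Suc j)"
  define C where "C = 1 + (\<Sum>i<Suc j. \<bar>coeff (?L i) j\<bar>)"
  have "0 < C" unfolding C_def by (intro add_pos_nonneg sum_nonneg) auto
  moreover have "\<bar>coeff p j\<bar> \<le> C * B"
    if p: "degree p \<le> j" and B: "\<And>i. i \<le> j \<Longrightarrow> \<bar>poly p (real i)\<bar> \<le> B" for p :: "real poly" and B
  proof -
    have "0 \<le> B" using B[of 0] by force
    have "inj_on real {..<Suc j}" by (auto intro: inj_onI)
    then have "coeff p j = coeff (\<Sum>i<Suc j. smult (poly p (real i)) (?L i)) j"
      using lagrange_interpolation[of real "Suc j" p] p by simp
    also have "\<bar>\<dots>\<bar> \<le> (\<Sum>i<Suc j. \<bar>poly p (real i) * coeff (?L i) j\<bar>)"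
      by (simp add: coeff_sum del: sum.lessThan_Suc)
    also have "\<dots> \<le> (\<Sum>i<Suc j. B * \<bar>coeff (?L i) j\<bar>)"
      using B by (intro sum_mono) (auto simp: abs_mult intro!: mult_right_mono)
    also have "\<dots> \<le> C * B"
      using \<open>0 \<le> B\<close> by (simp add: C_def algebra_simps sum_distrib_left del: sum.lessThan_Suc)
    finally show ?thesis .
  qed
  ultimately show ?thesis by blast
qed

text \<open>A local Landau-Kolmogorov inequality: at the points c + i t the Taylor polynomial of
  degree \<open>j\<close> differs from \<open>F\<close> by O(B t^(j+1)), and its top coefficient is
  controlled by its values there.\<close>

lemma derivative_interpolation_inequality:
  obtains C where "0 < C" "\<And>F c t A B. F \<in> C_inf \<Longrightarrow> 0 < t \<Longrightarrow>
    (\<And>x. x \<in> {c..c + real j * t} \<Longrightarrow> \<bar>F x\<bar> \<le> A) \<Longrightarrow>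
    (\<And>x. x \<in> {c..c + real j * t} \<Longrightarrow> \<bar>(deriv ^^ Suc j) F x\<bar> \<le> B) \<Longrightarrow>
    t ^ j * \<bar>(deriv ^^ j) F c\<bar> \<le> C * (A + B * t ^ Suc j)"
proof -
  obtain C where "0 < C" and
    C: "\<And>p :: real poly. \<And>B. degree p \<le> j \<Longrightarrow> (\<And>i. i \<le> j \<Longrightarrow> \<bar>poly p (real i)\<bar> \<le> B) \<Longrightarrow> \<bar>coeff p j\<bar> \<le> C * B"
    using coeff_bound_by_values[of j] by blast
  \<comment> \<open>\<open>fact j\<close> turns the coefficient into a derivative; the power of
    \<open>j\<close> arises because the nodes reach up to distance \<open>j * t\<close> from
    \<open>c\<close>.\<close>
  define D where "D = fact j * C * (1 + real j ^ Suc j)"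
  have "0 < D" unfolding D_def using \<open>0 < C\<close> by (intro mult_pos_pos add_pos_nonneg) auto
  moreover have "t ^ j * \<bar>(deriv ^^ j) F c\<bar> \<le> D * (A + B * t ^ Suc j)"
    if F: "F \<in> C_inf" and "0 < t" and A: "\<And>x. x \<in> {c..c + real j * t} \<Longrightarrow> \<bar>F x\<bar> \<le> A"
      and B: "\<And>x. x \<in> {c..c + real j * t} \<Longrightarrow> \<bar>(deriv ^^ Suc j) F x\<bar> \<le> B" for F c t A B
  proof -
    define p where "p = (\<Sum>i\<le>j. monom ((deriv ^^ i) F c / fact i * t ^ i) i)"
    have nonneg: "0 \<le> A" "0 \<le> B" using A[of c] B[of c] \<open>0 < t\<close> by (auto intro: order_trans[OF abs_ge_zero])
    have deg: "degree p \<le> j"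
      unfolding p_def by (intro degree_sum_le) (auto intro: order_trans[OF degree_monom_le])
    have val: "\<bar>poly p (real i)\<bar> \<le> A + B * (real j * t) ^ Suc j" if "i \<le> j" for i
    proof -
      have "poly p (real i) = taylor_deriv j c 0 F (c + real i * t)"
        by (simp add: p_def taylor_deriv_def poly_sum poly_monom power_mult_distrib mult_ac)
      moreover have i: "c + real i * t \<in> {c..c + real j * t}"
        using that \<open>0 < t\<close> by (auto intro: mult_right_mono)
      moreover have "closed_segment c (c + real i * t) \<subseteq> {c..c + real j * t}"
        using i by (auto simp: closed_segment_eq_real_ivl)
      then have "\<bar>F (c + real i * t) - taylor_deriv j c 0 F (c + real i * t)\<bar> \<le>
          B * \<bar>c + real i * t - c\<bar> ^ Suc j"
        using B by (intro taylor_remainder_bound_Suc F) blast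
      moreover have "B * \<bar>c + real i * t - c\<bar> ^ Suc j \<le> B * (real j * t) ^ Suc j"
        using nonneg \<open>0 < t\<close> that by (intro mult_left_mono power_mono) (auto intro: mult_right_mono)
      ultimately show ?thesis using A[OF i] by linarith
    qed
    have "coeff p j = (deriv ^^ j) F c / fact j * t ^ j"
      by (simp add: p_def coeff_sum coeff_monom)
    then have "t ^ j * \<bar>(deriv ^^ j) F c\<bar> = fact j * \<bar>coeff p j\<bar>"
      using \<open>0 < t\<close> by (simp add: abs_mult)
    also have "\<dots> \<le> fact j * (C * (A + B * (real j * t) ^ Suc j))"
      by (intro mult_left_mono C deg val) auto
    also have "A + B * (real j * t) ^ Suc j \<le> (1 + real j ^ Suc j) * (A + B * t ^ Suc j)"
      using nonneg \<open>0 < t\<close> by (simp add: algebra_simps power_mult_distrib)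
    finally show ?thesis using \<open>0 < C\<close> by (simp add: D_def mult_ac mult_left_mono)
  qed
  ultimately show ?thesis by (rule that)
qed

section \<open>Markov inequality for complex polynomials on real intervals\<close>

lemma coeff_bound_on_circle:
  fixes q :: "complex poly"
  assumes "\<And>w. norm w = 1 \<Longrightarrow> norm (poly q w) \<le> B"
  shows "norm (coeff q k) \<le> B"
proof -
  have d: "(deriv ^^ k) (poly q) = poly ((pderiv ^^ k) q)" for k
    by (induction k) (auto intro!: ext DERIV_imp_deriv poly_DERIV)
  have "norm ((deriv ^^ k) (poly q) 0) \<le> fact k * B / 1 ^ k"
    by (rule Cauchy_inequality) (use assms in \<open>auto intro!: holomorphic_intros continuous_intros\<close>)
  then have "fact k * norm (coeff q k) \<le> fact k * B"
    by (simp add: d poly_0_coeff_0 coeff_higher_pderiv norm_mult flip: pochhammer_fact)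
  then show ?thesis by simp
qed

text \<open>With x = cos \<theta> the polynomial becomes a trigonometric one with frequencies at
  most \<open>n\<close> and coefficients at most \<open>B\<close>. The factor sin \<theta> coming
  from the chain rule is small near \<theta> = 0, but there the differentiated sum is of order
  \<theta> as well, since it vanishes at 0. For \<open>x\<close> at least 0 the other zero of the
  sine stays away.\<close>

lemma markov_inequality_upper_half:
  fixes p :: "complex poly"
  assumes deg: "degree p \<le> n"
    and B: "\<And>x. x \<in> {-1..1} \<Longrightarrow> norm (poly p (of_real x)) \<le> B"
    and x: "0 \<le> x" "x < 1"
  shows "norm (poly (pderiv p) (of_real x)) \<le> 6 * real n ^ 3 * B"
proof -
  have "0 \<le> B" using B[of 0] by (simp add: order_trans[OF norm_ge_zero])
  \<comment> \<open>The Joukowski substitution w^n p((w + 1/w) / 2), cleared of denominators. On the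
    unit circle the argument of \<open>p\<close> is Re w, which lies in [-1, 1].\<close>
  define q where "q = (\<Sum>k\<le>n. smult (coeff p k / 2 ^ k) (monom 1 (n - k) * [:1, 0, 1:] ^ k))"
  have deg_q: "degree q \<le> 2 * n"
    unfolding q_def
  proof (rule degree_sum_le)
    fix k assume k: "k \<in> {..n}"
    have "degree (monom (1 :: complex) (n - k) * [:1, 0, 1:] ^ k) \<le> (n - k) + 2 * k"
      by (rule order_trans[OF degree_mult_le] add_mono degree_monom_le
          order_trans[OF degree_power_le])+ simp
    then show "degree (smult (coeff p k / 2 ^ k) (monom 1 (n - k) * [:1, 0, 1:] ^ k)) \<le> 2 * n"
      using k by (intro order_trans[OF degree_smult_le]) auto
  qed simp
  have q: "poly q w = w ^ n * poly p ((w + 1 / w) / 2)" if "w \<noteq> 0" for w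
  proof -
    have "poly q w = (\<Sum>k\<le>n. coeff p k / 2 ^ k * (w ^ (n - k) * (1 + w * w) ^ k))"
      by (simp add: q_def poly_sum poly_monom algebra_simps)
    also have "\<dots> = (\<Sum>k\<le>n. w ^ n * (coeff p k * ((w + 1 / w) / 2) ^ k))"
    proof (rule sum.cong)
      fix k assume "k \<in> {..n}"
      then have "w ^ n = w ^ (n - k) * w ^ k" by (simp flip: power_add)
      moreover have "w ^ k * (w + 1 / w) ^ k = (1 + w * w) ^ k"
        using that by (simp add: field_simps flip: power_mult_distrib)
      ultimately show "coeff p k / 2 ^ k * (w ^ (n - k) * (1 + w * w) ^ k) =
          w ^ n * (coeff p k * ((w + 1 / w) / 2) ^ k)"
        by (simp add: power_divide mult_ac)
    qed simp
    also have "\<dots> = w ^ n * poly p ((w + 1 / w) / 2)"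
    proof -
      have "poly p y = (\<Sum>k\<le>n. coeff p k * y ^ k)" for y
        unfolding poly_altdef using deg
        by (intro sum.mono_neutral_left) (auto simp: coeff_eq_0)
      then show ?thesis by (simp add: sum_distrib_left)
    qed
    finally show ?thesis .
  qed
  have coeff_q: "norm (coeff q k) \<le> B" for k
  proof (rule coeff_bound_on_circle)
    fix w :: complex assume w: "norm w = 1"
    then have "w \<noteq> 0" "1 / w = cnj w" by (auto simp: divide_conv_cnj)
    then have "poly q w = w ^ n * poly p (of_real (Re w))"
      using q[of w] by (simp add: complex_add_cnj)
    moreover have "Re w \<in> {-1..1}" using abs_Re_le_cmod[of w] w by auto
    ultimately show "norm (poly q w) \<le> B" using B w by (simp add: norm_mult norm_power)
  qed
  define E where "E = (\<lambda>k z. exp (\<i> * (of_nat k - of_nat n) * z) :: complex)"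
  have trig: "poly p (cos z) = (\<Sum>k\<le>2 * n. coeff q k * E k z)" for z
  proof -
    define w where "w = exp (\<i> * z)"
    have "w \<noteq> 0" by (simp add: w_def)
    have "cos z = (w + 1 / w) / 2" by (simp add: cos_exp_eq w_def exp_minus field_simps)
    then have "poly p (cos z) = poly q w / w ^ n" using q[OF \<open>w \<noteq> 0\<close>] \<open>w \<noteq> 0\<close> by (simp del: eq_divide_eq_numeral1)
    also have "poly q w = (\<Sum>k\<le>2 * n. coeff q k * w ^ k)"
      unfolding poly_altdef using deg_q
      by (intro sum.mono_neutral_left) (auto simp: coeff_eq_0)
    also have "\<dots> / w ^ n = (\<Sum>k\<le>2 * n. coeff q k * E k z)"
      unfolding sum_divide_distrib
      by (intro sum.cong) (auto simp: E_def w_def exp_diff ring_distribs ac_simps simp flip: exp_of_nat_mult)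
    finally show ?thesis .
  qed
  have deriv: "- sin z * poly (pderiv p) (cos z) =
      (\<Sum>k\<le>2 * n. coeff q k * (\<i> * (of_nat k - of_nat n) * E k z))" for z
  proof -
    have "((\<lambda>z. poly p (cos z)) has_field_derivative poly (pderiv p) (cos z) * - sin z) (at z)"
      by (rule DERIV_chain2[OF poly_DERIV DERIV_cos])
    moreover have "((\<lambda>z. \<Sum>k\<le>2 * n. coeff q k * E k z) has_field_derivative
        (\<Sum>k\<le>2 * n. coeff q k * (\<i> * (of_nat k - of_nat n) * E k z))) (at z)"
      unfolding E_def by (auto intro!: derivative_eq_intros sum.cong)
    ultimately show ?thesis unfolding trig[symmetric]
      by (metis DERIV_unique mult.commute)
  qed
  define \<theta> where "\<theta> = arccos x"
  have \<theta>: "cos \<theta> = x" "0 < \<theta>" "\<theta> \<le> pi / 2"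
    using x arccos_le_pi2[of x] arccos_lt_bounded[of x] by (auto simp: \<theta>_def)
  \<comment> \<open>For y = \<theta> / 2 at most pi / 4: y cos y <= sin y by the mean value theorem,
    the square of cos y is at least 1 / 2, and the double angle formula combines the two.\<close>
  have sin_ge: "\<theta> \<le> 2 * sin \<theta>"
  proof -
    let ?y = "\<theta> / 2"
    have y: "0 < ?y" "?y \<le> pi / 4" using \<theta> by auto
    obtain \<xi> where \<xi>: "0 < \<xi>" "\<xi> < ?y" "sin ?y - sin 0 = (?y - 0) * cos \<xi>"
      using MVT2[OF y(1), of sin cos] by (auto intro: DERIV_sin)
    have "cos ?y \<le> cos \<xi>" using \<xi> y pi_gt_zero by (intro cos_monotone_0_pi_le) auto
    then have "?y * cos ?y \<le> sin ?y" using \<xi> y by (auto intro: mult_left_mono)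
    have c: "sqrt 2 / 2 \<le> cos ?y"
      using cos_monotone_0_pi_le[of ?y "pi / 4"] y pi_gt_zero by (simp add: cos_45)
    then have "0 < cos ?y" using real_sqrt_gt_zero[of 2] by linarith
    have "(sqrt 2 / 2) ^ 2 \<le> cos ?y ^ 2" using c by (intro power_mono) auto
    then have "1 / 2 \<le> cos ?y * cos ?y" by (simp add: power2_eq_square)
    then have "?y * (1 / 2) \<le> ?y * (cos ?y * cos ?y)" using y by (intro mult_left_mono) auto
    also have "\<dots> \<le> sin ?y * cos ?y"
      using \<open>?y * cos ?y \<le> sin ?y\<close> \<open>0 < cos ?y\<close> by (simp add: mult.assoc[symmetric] mult_right_mono)
    also have "\<dots> = sin \<theta> / 2" using sin_double[of ?y] by simp
    finally show ?thesis by simp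
  qed
  \<comment> \<open>Subtracting the sum at \<theta> = 0, which is 0 because of the sine, replaces
    each exponential \<open>E k\<close> by \<open>E k\<close> - 1, of modulus at most n
    \<theta>.\<close>
  have "norm (sin \<theta>) * norm (poly (pderiv p) (of_real x)) =
      norm (\<Sum>k\<le>2 * n. coeff q k * (\<i> * (of_nat k - of_nat n) * (E k (of_real \<theta>) - 1)))"
  proof -
    have "E k 0 = 1" for k by (simp add: E_def)
    then have "(\<Sum>k\<le>2 * n. coeff q k * (\<i> * (of_nat k - of_nat n))) = 0"
      using deriv[of 0] by simp
    then have "(\<Sum>k\<le>2 * n. coeff q k * (\<i> * (of_nat k - of_nat n) * (E k (of_real \<theta>) - 1))) =
        - sin (of_real \<theta>) * poly (pderiv p) (cos (of_real \<theta>))"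
      unfolding deriv by (simp add: algebra_simps sum_subtractf sum.distrib)
    then show ?thesis
      using \<theta>(1) by (simp add: norm_mult sin_of_real cos_of_real)
  qed
  also have "\<dots> \<le> (\<Sum>k\<le>2 * n. B * (real n * (real n * \<theta>)))"
  proof (intro order_trans[OF norm_sum] sum_mono)
    fix k assume k: "k \<in> {..2 * n}"
    have kn: "norm (of_nat k - of_nat n :: complex) \<le> real n"
    proof -
      have "of_nat k - of_nat n = (of_real (real k - real n) :: complex)" by simp
      then have "norm (of_nat k - of_nat n :: complex) = \<bar>real k - real n\<bar>"
        by (metis norm_of_real)
      also have "\<dots> \<le> real n" using k by auto
      finally show ?thesis .
    qed
    have "norm (E k (of_real \<theta>) - 1) \<le> \<bar>(real k - real n) * \<theta>\<bar>"
    proof -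
      have "E k (of_real \<theta>) = exp (\<i> * of_real ((real k - real n) * \<theta>))"
        by (simp add: E_def mult_ac)
      then have "norm (E k (of_real \<theta>) - 1) = 2 * \<bar>sin ((real k - real n) * \<theta> / 2)\<bar>"
        using dist_exp_i_1[of "(real k - real n) * \<theta>"] by (simp add: dist_norm)
      also have "\<dots> \<le> 2 * \<bar>(real k - real n) * \<theta> / 2\<bar>"
        by (intro mult_left_mono abs_sin_x_le_abs_x) simp
      finally show ?thesis by simp
    qed
    also have "\<dots> \<le> real n * \<theta>"
      unfolding abs_mult using k \<theta> by (intro mult_mono) auto
    finally show "norm (coeff q k * (\<i> * (of_nat k - of_nat n) * (E k (of_real \<theta>) - 1))) \<le>
        B * (real n * (real n * \<theta>))"
      unfolding norm_mult using coeff_q[of k] kn \<open>0 \<le> B\<close> by (intro mult_mono) auto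
  qed
  also have "\<dots> = (2 * real n + 1) * real n ^ 2 * B * \<theta>"
    by (simp add: power2_eq_square algebra_simps)
  also have "\<dots> \<le> (2 * real n + 1) * real n ^ 2 * B * (2 * sin \<theta>)"
    using sin_ge \<open>0 \<le> B\<close> by (intro mult_left_mono) auto
  also have "\<dots> \<le> (6 * real n ^ 3 * B) * sin \<theta>"
  proof -
    have "0 < sin \<theta>" using sin_ge \<theta> by linarith
    moreover have "(2 * real n + 1) * real n ^ 2 * 2 \<le> 6 * real n ^ 3"
      by (cases n) (auto simp: power2_eq_square power3_eq_cube algebra_simps)
    ultimately have "((2 * real n + 1) * real n ^ 2 * 2) * (B * sin \<theta>) \<le> (6 * real n ^ 3) * (B * sin \<theta>)"
      using \<open>0 \<le> B\<close> by (intro mult_right_mono) auto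
    then show ?thesis by (simp add: mult_ac)
  qed
  finally show ?thesis
    using sin_ge \<theta> by (simp add: mult.commute)
qed

text \<open>The end point 1 is reached by continuity from the left, negative points by the
  reflection x -> -x.\<close>

lemma markov_inequality_unit:
  fixes p :: "complex poly"
  assumes deg: "degree p \<le> n"
    and B: "\<And>x. x \<in> {-1..1} \<Longrightarrow> norm (poly p (of_real x)) \<le> B"
    and x: "x \<in> {-1..1}"
  shows "norm (poly (pderiv p) (of_real x)) \<le> 6 * real n ^ 3 * B"
proof -
  have upper: "norm (poly (pderiv p) (of_real x)) \<le> 6 * real n ^ 3 * B"
    if deg: "degree p \<le> n" and B: "\<And>x. x \<in> {-1..1} \<Longrightarrow> norm (poly p (of_real x)) \<le> B"
      and "0 \<le> x" "x \<le> 1" for p :: "complex poly" and x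
  proof (cases "x = 1")
    case True
    have "((\<lambda>x. norm (poly (pderiv p) (of_real x))) \<longlongrightarrow> norm (poly (pderiv p) (of_real 1))) (at_left 1)"
      by (intro tendsto_intros)
    moreover have "\<forall>\<^sub>F x in at_left 1. norm (poly (pderiv p) (of_real x)) \<le> 6 * real n ^ 3 * B"
      by (rule eventually_mono[OF eventually_at_left_real[OF zero_less_one]])
        (use markov_inequality_upper_half[OF deg B] in auto)
    ultimately show ?thesis unfolding True
      by (rule tendsto_upperbound) simp
  next
    case False
    then show ?thesis using that by (intro markov_inequality_upper_half[OF deg B]) auto
  qed
  show ?thesis
  proof (cases "0 \<le> x")
    case True
    then show ?thesis using upper[OF deg B] x by auto
  next
    case False
    let ?p = "p \<circ>\<^sub>p [:0, -1:]"
    have "norm (poly (pderiv ?p) (of_real (- x))) \<le> 6 * real n ^ 3 * B"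
    proof (rule upper)
      show "degree ?p \<le> n" using deg degree_pcompose_le[of p "[:0, -1:]"] by simp
      show "norm (poly ?p (of_real y)) \<le> B" if "y \<in> {-1..1}" for y
        using B[of "- y"] that by (simp add: poly_pcompose)
    qed (use False x in auto)
    then show ?thesis by (simp add: pderiv_pcompose poly_pcompose pderiv_pCons)
  qed
qed

lemma markov_inequality:
  fixes p :: "complex poly"
  assumes "degree p \<le> n" "a < b"
    and B: "\<And>x. x \<in> {a..b} \<Longrightarrow> norm (poly p (of_real x)) \<le> B"
    and x: "x \<in> {a..b}"
  shows "norm (poly (pderiv p) (of_real x)) \<le> 12 * real n ^ 3 / (b - a) * B"
proof -
  define l where "l = (b - a) / 2"
  define m where "m = (a + b) / 2"
  have "0 < l" using assms by (simp add: l_def)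
  let ?p = "p \<circ>\<^sub>p [:of_real m, of_real l:]"
  have "norm (poly (pderiv ?p) (of_real ((x - m) / l))) \<le> 6 * real n ^ 3 * B"
  proof (rule markov_inequality_unit)
    show "degree ?p \<le> n"
      using assms(1) degree_pcompose_le[of p "[:of_real m, of_real l:]"]
      by (auto split: if_splits intro: order_trans)
    show "norm (poly ?p (of_real y)) \<le> B" if "y \<in> {-1..1}" for y
    proof -
      have "l * y \<le> l * 1" "l * (-1) \<le> l * y"
        using that \<open>0 < l\<close> by (intro mult_left_mono; simp)+
      then have "m + l * y \<in> {a..b}" by (auto simp: l_def m_def field_simps)
      from B[OF this] show ?thesis by (simp add: poly_pcompose mult.commute)
    qed
    show "(x - m) / l \<in> {-1..1}" using x \<open>0 < l\<close> by (auto simp: field_simps l_def m_def)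
  qed
  moreover have "poly (pderiv ?p) (of_real ((x - m) / l)) = of_real l * poly (pderiv p) (of_real x)"
    using \<open>0 < l\<close> by (simp add: pderiv_pcompose poly_pcompose pderiv_pCons mult.commute)
  ultimately have "l * norm (poly (pderiv p) (of_real x)) \<le> 6 * real n ^ 3 * B"
    using \<open>0 < l\<close> by (simp add: norm_mult)
  then show ?thesis using assms(2) by (simp add: l_def field_simps)
qed

section \<open>Markov factors and a set without the extension property\<close>

lemma poly_sup_norm_upper:
  assumes "compact K" "z \<in> K"
  shows "norm (poly P z) \<le> poly_sup_norm K P"
  unfolding poly_sup_norm_def
proof (rule cSUP_upper[OF assms(2)])
  have "compact ((\<lambda>z. norm (poly P z)) ` K)"
    by (intro compact_continuous_image assms continuous_intros)
  then show "bdd_above ((\<lambda>z. norm (poly P z)) ` K)"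
    by (intro bounded_imp_bdd_above compact_imp_bounded)
qed

lemma poly_sup_norm_least:
  "K \<noteq> {} \<Longrightarrow> (\<And>z. z \<in> K \<Longrightarrow> norm (poly P z) \<le> B) \<Longrightarrow> poly_sup_norm K P \<le> B"
  unfolding poly_sup_norm_def by (rule cSUP_least)

lemma poly_sup_norm_nonneg: "compact K \<Longrightarrow> K \<noteq> {} \<Longrightarrow> 0 \<le> poly_sup_norm K P"
  using poly_sup_norm_upper norm_ge_zero order_trans by blast

definition markov_constants :: "nat \<Rightarrow> complex set \<Rightarrow> real set" where
  "markov_constants n K =
     {M. \<forall>P. degree P \<le> n \<longrightarrow> poly_sup_norm K (pderiv P) \<le> M * poly_sup_norm K P}"

text \<open>Testing with the polynomial 1 shows that the set is bounded below, as the infimum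
  requires.\<close>

lemma markov_constants_nonneg:
  assumes "M \<in> markov_constants n K" "K \<noteq> {}"
  shows "0 \<le> M"
proof -
  have "poly_sup_norm K (pderiv 1) \<le> M * poly_sup_norm K 1"
    using assms(1) unfolding markov_constants_def by (metis (mono_tags) degree_1 le0 mem_Collect_eq)
  then show ?thesis using assms(2) by (simp add: poly_sup_norm_def)
qed

lemma markov_factor_le:
  assumes "M \<in> markov_constants n K" "K \<noteq> {}"
  shows "0 \<le> markov_factor n K" "markov_factor n K \<le> M"
proof -
  have "bdd_below (markov_constants n K)"
    using markov_constants_nonneg[OF _ assms(2)] by (auto simp: bdd_below_def)
  then show "markov_factor n K \<le> M"
    using assms(1) unfolding markov_factor_def markov_constants_def by (rule cInf_lower[rotated])
  show "0 \<le> markov_factor n K"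
    using assms markov_constants_nonneg
    unfolding markov_factor_def markov_constants_def[symmetric] by (intro cInf_greatest) auto
qed

text \<open>Differentiating the Lagrange formula at n + 1 points of \<open>K\<close> bounds P' by
  the values of P. Without this the infimum could be that of an empty set and admit no lower
  bound.\<close>

lemma markov_constants_nonempty:
  assumes "compact K" "infinite K"
  shows "markov_constants n K \<noteq> {}"
proof -
  have "K \<noteq> {}" using assms(2) by auto
  obtain x :: "nat \<Rightarrow> complex" where x: "inj x" "range x \<subseteq> K"
    using infinite_countable_subset[OF assms(2)] by blast
  let ?L = "lagrange_basis x (Suc n)"
  have "poly_sup_norm K (pderiv P) \<le> (\<Sum>i<Suc n. poly_sup_norm K (pderiv (?L i))) * poly_sup_norm K P"
    if "degree P \<le> n" for P
  proof (rule poly_sup_norm_least[OF \<open>K \<noteq> {}\<close>])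
    fix z assume z: "z \<in> K"
    have "inj_on x {..<Suc n}" using x(1) by (rule inj_on_subset) simp
    then have "P = (\<Sum>i<Suc n. smult (poly P (x i)) (?L i))"
      using that by (intro lagrange_interpolation) auto
    then have "pderiv P = pderiv (\<Sum>i<Suc n. smult (poly P (x i)) (?L i))"
      by (rule arg_cong)
    also have "\<dots> = (\<Sum>i<Suc n. smult (poly P (x i)) (pderiv (?L i)))"
      by (simp add: higher_pderiv_sum[where n = 1, simplified] pderiv_smult del: sum.lessThan_Suc)
    finally have "pderiv P = (\<Sum>i<Suc n. smult (poly P (x i)) (pderiv (?L i)))" .
    then have "norm (poly (pderiv P) z) \<le> (\<Sum>i<Suc n. norm (poly P (x i) * poly (pderiv (?L i)) z))"
      by (simp add: poly_sum sum_norm_le del: sum.lessThan_Suc)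
    also have "\<dots> \<le> (\<Sum>i<Suc n. poly_sup_norm K (pderiv (?L i)) * poly_sup_norm K P)"
    proof (intro sum_mono)
      fix i
      have "x i \<in> K" using x(2) by auto
      then show "norm (poly P (x i) * poly (pderiv (?L i)) z) \<le>
          poly_sup_norm K (pderiv (?L i)) * poly_sup_norm K P"
        unfolding norm_mult mult.commute[of "poly_sup_norm K (pderiv (?L i))"]
        using assms(1) z by (intro mult_mono poly_sup_norm_upper poly_sup_norm_nonneg) auto
    qed
    finally show "norm (poly (pderiv P) z) \<le>
        (\<Sum>i<Suc n. poly_sup_norm K (pderiv (?L i))) * poly_sup_norm K P"
      by (simp add: sum_distrib_right del: sum.lessThan_Suc)
  qed
  then show ?thesis unfolding markov_constants_def by blast
qed

lemma markov_factor_ge: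
  assumes "compact K" "infinite K" "degree P \<le> n" "0 < poly_sup_norm K P"
    and "B * poly_sup_norm K P \<le> poly_sup_norm K (pderiv P)"
  shows "B \<le> markov_factor n K"
  unfolding markov_factor_def markov_constants_def[symmetric]
proof (rule cInf_greatest[OF markov_constants_nonempty[OF assms(1,2)]])
  fix M assume "M \<in> markov_constants n K"
  then have "poly_sup_norm K (pderiv P) \<le> M * poly_sup_norm K P"
    using assms(3) unfolding markov_constants_def by blast
  with assms(5) have "B * poly_sup_norm K P \<le> M * poly_sup_norm K P" by (rule order_trans)
  with assms(4) show "B \<le> M" by simp
qed

definition spike_pos :: "nat \<Rightarrow> real" where "spike_pos k = (1 / 8) ^ Suc k"

text \<open>The growing exponent gives decay faster than every power; the offset 2 keeps the length
  below an eighth of \<open>spike_pos k\<close> from k = 0 on.\<close>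

definition spike_len :: "nat \<Rightarrow> real" where "spike_len k = spike_pos k ^ (k + 2)"

definition spike :: "nat \<Rightarrow> real set" where "spike k = {spike_pos k..spike_pos k + spike_len k}"

definition spike_set :: "real set" where "spike_set = {-1..0} \<union> (\<Union>k. spike k)"

lemma spike_pos_pos: "0 < spike_pos k"
  by (simp add: spike_pos_def)

lemma spike_pos_Suc: "spike_pos (Suc k) = spike_pos k / 8"
  by (simp add: spike_pos_def)

lemma spike_pos_antimono: "j \<le> k \<Longrightarrow> spike_pos k \<le> spike_pos j"
  unfolding spike_pos_def by (intro power_decreasing) auto

lemma spike_pos_le: "spike_pos k \<le> 1 / 8"
  using spike_pos_antimono[of 0 k] by (simp add: spike_pos_def)

lemma spike_pos_less: "j < k \<Longrightarrow> spike_pos k \<le> spike_pos j / 8"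
  using spike_pos_antimono[of "Suc j" k] by (simp add: spike_pos_Suc)

lemma spike_pos_tendsto: "spike_pos \<longlonglongrightarrow> 0"
  unfolding spike_pos_def[abs_def] by (intro LIMSEQ_Suc LIMSEQ_power_zero) simp

lemma spike_len_pos: "0 < spike_len k"
  by (simp add: spike_len_def spike_pos_pos)

lemma spike_len_le: "spike_len k \<le> spike_pos k / 8"
proof -
  have "spike_len k \<le> spike_pos k ^ 2"
    unfolding spike_len_def using spike_pos_le[of k] spike_pos_pos[of k]
    by (intro power_decreasing) auto
  also have "\<dots> \<le> spike_pos k * (1 / 8)"
    unfolding power2_eq_square using spike_pos_le[of k] spike_pos_pos[of k] by (intro mult_left_mono) auto
  finally show ?thesis by simp
qed

lemma spike_len_antimono:
  assumes "j \<le> k" shows "spike_len k \<le> spike_len j"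
proof -
  have "spike_pos k ^ (k + 2) \<le> spike_pos j ^ (k + 2)"
    using spike_pos_antimono[OF assms] spike_pos_pos[of k] by (intro power_mono) auto
  also have "\<dots> \<le> spike_pos j ^ (j + 2)"
    using assms spike_pos_le[of j] spike_pos_pos[of j] by (intro power_decreasing) auto
  finally show ?thesis by (simp add: spike_len_def)
qed

lemma spike_set_bounds: "spike_set \<subseteq> {-1..1}"
proof
  fix x assume "x \<in> spike_set"
  then consider "x \<in> {-1..0}" | k where "x \<in> spike k" by (auto simp: spike_set_def)
  then show "x \<in> {-1..1}"
  proof cases
    case 2
    then show ?thesis
      using spike_pos_le[of k] spike_len_le[of k] spike_pos_pos[of k] by (auto simp: spike_def)
  qed auto
qed

text \<open>The free room around a spike is proportional to its position, not to its length. It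
  contains the support of every cut-off of scale at most \<open>spike_pos k / 4\<close>.\<close>

lemma spike_set_isolated:
  assumes "x \<in> spike_set" "x \<notin> spike k"
  shows "x \<le> 3 / 4 * spike_pos k \<or> 3 / 2 * spike_pos k \<le> x"
proof -
  consider "x \<in> {-1..0}" | j where "x \<in> spike j" using assms by (auto simp: spike_set_def)
  then show ?thesis
  proof cases
    case 1
    then show ?thesis using spike_pos_pos[of k] by auto
  next
    case 2
    with assms consider "j < k" | "k < j" by (metis nat_neq_iff)
    then show ?thesis
    proof cases
      case 1
      then show ?thesis using 2 spike_pos_less[OF 1] spike_pos_pos[of k] by (auto simp: spike_def)
    next
      case c: 2
      show ?thesis
        using 2 spike_pos_less[OF c] spike_len_le[of j] spike_pos_pos[of k] by (auto simp: spike_def)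
    qed
  qed
qed

lemma compact_spike_set: "compact spike_set"
proof -
  \<comment> \<open>Finite stages in which all spikes from index \<open>n\<close> on are swallowed
    by an interval that shrinks to [-1, 0].\<close>
  define J where "J n = {-1..2 * spike_pos n} \<union> (\<Union>k<n. spike k)" for n
  have "spike_set = (\<Inter>n. J n)"
  proof (intro equalityI subsetI INT_I)
    fix x n assume "x \<in> spike_set"
    then consider "x \<in> {-1..0}" | k where "x \<in> spike k" by (auto simp: spike_set_def)
    then show "x \<in> J n"
    proof cases
      case 1
      then show ?thesis using spike_pos_pos[of n] by (auto simp: J_def)
    next
      case 2
      show ?thesis
      proof (cases "k < n")
        case False
        then show ?thesis
          using 2 spike_pos_antimono[of n k] spike_len_le[of k] spike_pos_pos[of k]
          by (auto simp: J_def spike_def)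
      qed (use 2 in \<open>auto simp: J_def\<close>)
    qed
  next
    fix x assume x: "x \<in> (\<Inter>n. J n)"
    show "x \<in> spike_set"
    proof (cases "x \<le> 0")
      case True
      have "x \<in> J 0" using x by blast
      with True show ?thesis by (auto simp: J_def spike_set_def)
    next
      case False
      then have "\<forall>\<^sub>F n in sequentially. spike_pos n < x / 2"
        using spike_pos_tendsto by (intro order_tendstoD) auto
      then obtain n where "spike_pos n < x / 2" by (auto simp: eventually_sequentially)
      moreover have "x \<in> J n" using x by blast
      ultimately show ?thesis by (auto simp: J_def spike_set_def)
    qed
  qed
  moreover have "closed (J n)" for n
    unfolding J_def spike_def by (intro closed_Un closed_UN closed_atLeastAtMost) auto
  ultimately have "closed spike_set" using closed_INT[of UNIV J] by simp
  then show ?thesis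
    using spike_set_bounds bounded_subset[OF bounded_closed_interval] by (auto simp: compact_eq_bounded_closed)
qed

lemma islimpt_Icc_self: "a < b \<Longrightarrow> x \<in> {a..b} \<Longrightarrow> x islimpt {a..b :: real}"
proof (rule connected_imp_perfect)
  fix y assume "a < b"
  then have "a \<in> {a..b}" "b \<in> {a..b}" "a \<noteq> b" by auto
  then show "{a..b} \<noteq> {y}" by (metis singletonD)
qed simp_all

lemma perfect_set_Icc: "a < b \<Longrightarrow> perfect_set {a..b}"
  by (auto simp: perfect_set_def intro: islimpt_Icc_self)

lemma perfect_spike_set: "perfect_set spike_set"
  unfolding perfect_set_def
proof (intro conjI ballI)
  show "closed spike_set" using compact_spike_set by (rule compact_imp_closed)
  fix x assume "x \<in> spike_set"
  then consider "x \<in> {-1..0}" | k where "x \<in> spike k" by (auto simp: spike_set_def)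
  then show "x islimpt spike_set"
  proof cases
    case 1
    then have "x islimpt {-1..0}" by (intro islimpt_Icc_self) auto
    then show ?thesis by (rule islimpt_subset) (auto simp: spike_set_def)
  next
    case 2
    then have "x islimpt spike k"
      unfolding spike_def using spike_len_pos[of k] by (intro islimpt_Icc_self) auto
    then show ?thesis by (rule islimpt_subset) (auto simp: spike_set_def)
  qed
qed

text \<open>The Taylor expansion at 0 is dominated by the exponential series; this carries bounds
  from [-1, 0] to nearby points on the right.\<close>

lemma poly_le_exp_of_higher_pderiv:
  fixes P :: "complex poly"
  assumes "\<And>j. norm (poly ((pderiv ^^ j) P) 0) \<le> M ^ j * B" "0 \<le> x" "0 \<le> M" "0 \<le> B"
  shows "norm (poly P (of_real x)) \<le> B * exp (M * x)"
proof -
  have coeff: "norm (coeff P j) \<le> M ^ j * B / fact j" for j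
    using assms(1)[of j]
    by (simp add: poly_0_coeff_0 coeff_higher_pderiv norm_mult field_simps flip: pochhammer_fact)
  have "norm (poly P (of_real x)) \<le> (\<Sum>j\<le>degree P. norm (coeff P j) * x ^ j)"
    unfolding poly_altdef using assms(2)
    by (intro order_trans[OF norm_sum] sum_mono) (simp add: norm_mult norm_power)
  also have "\<dots> \<le> (\<Sum>j\<le>degree P. B * ((M * x) ^ j /\<^sub>R fact j))"
  proof (rule sum_mono)
    fix j
    have "norm (coeff P j) * x ^ j \<le> (M ^ j * B / fact j) * x ^ j"
      using coeff assms(2) by (intro mult_right_mono) auto
    then show "norm (coeff P j) * x ^ j \<le> B * ((M * x) ^ j /\<^sub>R fact j)"
      by (simp add: power_mult_distrib field_simps)
  qed
  also have "\<dots> = B * (\<Sum>j\<le>degree P. (M * x) ^ j /\<^sub>R fact j)"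
    by (simp add: sum_distrib_left)
  also have "\<dots> \<le> B * exp (M * x)"
    unfolding exp_def using assms
    by (intro mult_left_mono sum_le_suminf summable_exp_generic) auto
  finally show ?thesis .
qed

text \<open>Three regimes. On [-1, 0] the Markov inequality applies, and iterated it bounds all
  derivatives. Spikes from index \<open>L\<close> on lie in [0, 2 \<open>spike_pos L\<close>], where
  the Taylor series at 0 costs at most a factor 3. The finitely many longer spikes satisfy the
  Markov inequality on their own interval, the worst length being bounded by
  \<open>spike_len L\<close>.\<close>

lemma markov_spike_set:
  assumes L: "24 * real n ^ 3 \<le> 8 ^ Suc L"
  shows "36 * real n ^ 3 / spike_len L \<in> markov_constants n (of_real ` spike_set)"
  unfolding markov_constants_def
proof (intro CollectI allI impI)
  fix P :: "complex poly" assume deg: "degree P \<le> n"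
  let ?K = "complex_of_real ` spike_set"
  define M where "M = 12 * real n ^ 3"
  define N where "N = poly_sup_norm ?K P"
  have K: "compact ?K" "?K \<noteq> {}"
    using compact_spike_set by (auto intro!: compact_continuous_image continuous_intros simp: spike_set_def)
  have "0 \<le> M" by (simp add: M_def)
  have "0 \<le> N" unfolding N_def by (rule poly_sup_norm_nonneg[OF K])
  have P: "norm (poly P (of_real x)) \<le> N" if "x \<in> spike_set" for x
    unfolding N_def using that by (intro poly_sup_norm_upper K) auto
  have len: "0 < spike_len L" "spike_len L \<le> 1"
    using spike_len_pos spike_len_le[of L] spike_pos_le[of L] by auto
  have high: "norm (poly ((pderiv ^^ j) P) (of_real x)) \<le> M ^ j * N" if "x \<in> {-1..0}" for j x
    using that
  proof (induction j arbitrary: x)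
    case 0
    then show ?case using P by (simp add: spike_set_def)
  next
    case (Suc j)
    have "degree ((pderiv ^^ j) P) \<le> n" using deg by (simp add: degree_higher_pderiv)
    then have "norm (poly (pderiv ((pderiv ^^ j) P)) (of_real x)) \<le> 12 * real n ^ 3 / (0 - (-1)) * (M ^ j * N)"
      by (rule markov_inequality) (use Suc in auto)
    then show ?case by (simp add: M_def)
  qed
  have "norm (poly (pderiv P) (of_real x)) \<le> 36 * real n ^ 3 / spike_len L * N" if "x \<in> spike_set" for x
  proof -
    have M3: "3 * M * N \<le> 36 * real n ^ 3 / spike_len L * N"
      using len \<open>0 \<le> N\<close> mult_left_le[of "spike_len L" "36 * real n ^ 3"]
      by (intro mult_right_mono) (auto simp: M_def le_divide_eq)
    have "x \<in> {-1..0} \<or> (\<exists>k. x \<in> spike k)" using that by (simp add: spike_set_def)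
    then consider "x \<in> {-1..0}" | k where "x \<in> spike k" "L \<le> k" | k where "x \<in> spike k" "k < L"
      by (elim disjE exE) (use linorder_not_less in blast)+
    then show ?thesis
    proof cases
      case 1
      then have "norm (poly (pderiv P) (of_real x)) \<le> M * N" using high[of x 1] by simp
      also have "\<dots> \<le> 3 * M * N" using \<open>0 \<le> M\<close> \<open>0 \<le> N\<close> by simp
      finally show ?thesis using M3 by simp
    next
      case 2
      have x: "0 \<le> x" "x \<le> 2 * spike_pos L"
        using 2 spike_len_le[of k] spike_pos_pos[of k] spike_pos_antimono[OF 2(2)] by (auto simp: spike_def)
      have "M * x \<le> M * (2 * spike_pos L)" using x \<open>0 \<le> M\<close> by (intro mult_left_mono)
      \<comment> \<open>Exactly the hypothesis on \<open>L\<close>, since 2 * 12 = 24.\<close>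
      also have "\<dots> \<le> 1" using L by (simp add: M_def spike_pos_def field_simps)
      finally have "exp (M * x) \<le> 3" using exp_le by (metis exp_le_cancel_iff order_trans)
      have "norm (poly (pderiv P) (of_real x)) \<le> (M * N) * exp (M * x)"
      proof (rule poly_le_exp_of_higher_pderiv)
        show "norm (poly ((pderiv ^^ j) (pderiv P)) 0) \<le> M ^ j * (M * N)" for j
          using high[of 0 "Suc j"] by (simp add: funpow_swap1 mult_ac)
      qed (use x \<open>0 \<le> M\<close> \<open>0 \<le> N\<close> in auto)
      also have "\<dots> \<le> (M * N) * 3"
        using \<open>exp (M * x) \<le> 3\<close> \<open>0 \<le> M\<close> \<open>0 \<le> N\<close> by (intro mult_left_mono) auto
      finally show ?thesis using M3 by simp
    next
      case 3
      have "norm (poly (pderiv P) (of_real x)) \<le>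
          12 * real n ^ 3 / (spike_pos k + spike_len k - spike_pos k) * N"
      proof (rule markov_inequality[OF deg])
        show "x \<in> {spike_pos k..spike_pos k + spike_len k}" using 3 by (simp add: spike_def)
        show "norm (poly P (of_real y)) \<le> N" if "y \<in> {spike_pos k..spike_pos k + spike_len k}" for y
          using that by (intro P) (auto simp: spike_set_def spike_def)
      qed (use spike_len_pos in auto)
      also have "\<dots> \<le> 36 * real n ^ 3 / spike_len L * N"
        using spike_len_antimono[of k L] 3 spike_len_pos[of k] len \<open>0 \<le> N\<close>
        by (intro mult_right_mono frac_le) auto
      finally show ?thesis .
    qed
  qed
  then show "poly_sup_norm ?K (pderiv P) \<le> 36 * real n ^ 3 / spike_len L * poly_sup_norm ?K P"
    unfolding N_def by (intro poly_sup_norm_least K) auto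
qed

section \<open>Failure of the extension property\<close>

lemma deriv_funpow_monomial: "(deriv ^^ j) (\<lambda>x :: real. x ^ j) 0 = fact j"
proof -
  have "(\<lambda>x :: real. x ^ j) = poly (monom 1 j)" by (simp add: poly_monom fun_eq_iff)
  then show ?thesis
    by (simp add: deriv_funpow_poly poly_0_coeff_0 coeff_higher_pderiv coeff_monom flip: pochhammer_fact)
qed

definition bump_monomial :: "nat \<Rightarrow> real \<Rightarrow> real" where
  "bump_monomial j t = bump t * t ^ j"

lemma bump_monomial_C_inf: "bump_monomial j \<in> C_inf"
  unfolding bump_monomial_def[abs_def] by (intro C_inf_mult C_inf_power bump_C_inf) simp

lemma deriv_funpow_bump_monomial: "(deriv ^^ j) (bump_monomial j) 0 = fact j"
proof -
  have "(deriv ^^ j) (bump_monomial j) 0 = (deriv ^^ j) (\<lambda>x. x ^ j) 0"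
    by (rule C_inf_derivs_eq_on[of "{0..1}"])
      (auto simp: bump_monomial_def bump_eq_1 intro: perfect_set_Icc bump_monomial_C_inf C_inf_power)
  then show ?thesis by (simp add: deriv_funpow_monomial)
qed

text \<open>The factor \<open>l ^ j\<close> undoes the rescaling of the monomial: for positive
  \<open>l\<close> this is a cut-off at scale \<open>l\<close> times (x -
  \<open>spike_pos k\<close>)^j, and a derivative of order i has size l^(j - i).\<close>

definition spike_fun :: "nat \<Rightarrow> nat \<Rightarrow> real \<Rightarrow> real \<Rightarrow> real" where
  "spike_fun j k l x = l ^ j * bump_monomial j ((x - spike_pos k) / l)"

lemma spike_fun_C_inf: "spike_fun j k l \<in> C_inf"
  unfolding spike_fun_def[abs_def]
  by (rule C_inf_mult[OF C_inf_const C_inf_affine[OF bump_monomial_C_inf]])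

lemma deriv_funpow_spike_fun:
  "(deriv ^^ i) (spike_fun j k l) x = l ^ j * ((deriv ^^ i) (bump_monomial j) ((x - spike_pos k) / l) / l ^ i)"
  unfolding spike_fun_def[abs_def]
  unfolding deriv_funpow_cmult[OF C_inf_affine[OF bump_monomial_C_inf]]
    deriv_funpow_affine[OF bump_monomial_C_inf] ..

text \<open>On the set the function does not depend on the cut-off scale: the scale \<open>spike_len k\<close> shows
  that its norms up to order \<open>j - 1\<close> are small, the scale \<open>spike_pos k / 4\<close> that its norms of
  higher order do not exceed a power of \<open>1 / spike_pos k\<close>.\<close>

lemma spike_fun_eq:
  assumes "spike_len k \<le> l" "l \<le> spike_pos k / 4" "x \<in> spike_set"
  shows "spike_fun j k l x = (if x \<in> spike k then (x - spike_pos k) ^ j else 0)"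
proof -
  have "0 < l" using assms(1) spike_len_pos[of k] by simp
  show ?thesis
  proof (cases "x \<in> spike k")
    case True
    then have "bump ((x - spike_pos k) / l) = 1"
      using assms(1) \<open>0 < l\<close> by (intro bump_eq_1) (auto simp: spike_def field_simps)
    then show ?thesis
      using True \<open>0 < l\<close> by (simp add: spike_fun_def bump_monomial_def power_divide)
  next
    case False
    then have "bump ((x - spike_pos k) / l) = 0"
      using spike_set_isolated[OF assms(3) False] assms(2) \<open>0 < l\<close>
      by (intro bump_eq_0) (auto simp: field_simps)
    then show ?thesis
      using False by (simp add: spike_fun_def bump_monomial_def)
  qed
qed

text \<open>An extension of the monomial on spike \<open>k\<close> would have derivative
  \<open>fact j\<close> of order \<open>j\<close> at the spike, values of the size of
  \<open>spike_len k\<close>, and derivatives of order \<open>j + 1\<close> at most a fixed power of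
  1 / \<open>spike_pos k\<close>. For large \<open>k\<close> the derivative interpolation inequality
  forbids this, because the length decays faster than every power.\<close>

lemma not_extension_property_spike_set: "\<not> extension_property spike_set"
proof
  interpret perfect_compact spike_set
    by standard (auto simp: perfect_spike_set compact_spike_set, auto simp: spike_set_def)
  assume "extension_property spike_set"
  then obtain W where W: "whitney_linear spike_set W"
    and cont: "continuous_map (whitney_topology spike_set) C_inf_topology W"
    and ext: "\<And>f. f \<in> whitney_space spike_set \<Longrightarrow> restrict (W f) spike_set = f"
    unfolding extension_property_def by blast
  have W_C_inf: "W f \<in> C_inf" if "f \<in> whitney_space spike_set" for f
    using cont that unfolding continuous_map_def topspace_whitney topspace_C_inf by auto
  obtain C1 p where C1: "0 < C1" "\<And>f k x. f \<in> whitney_space spike_set \<Longrightarrow> k \<le> 0 \<Longrightarrow> \<bar>x\<bar> \<le> real 2 \<Longrightarrow>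
      \<bar>(deriv ^^ k) (W f) x\<bar> \<le> C1 * graded_norm p f"
    by (rule continuous_whitney_operatorD[OF W cont, of 0 2]) blast
  \<comment> \<open>One above the order \<open>p\<close> that controls the values of
    \<open>W f\<close>, so that every derivative of order at most \<open>p\<close> retains a factor
    \<open>spike_len k\<close>.\<close>
  define j where "j = Suc p"
  obtain C2 R where C2: "0 < C2" "\<And>f k x. f \<in> whitney_space spike_set \<Longrightarrow> k \<le> Suc j \<Longrightarrow> \<bar>x\<bar> \<le> real 2 \<Longrightarrow>
      \<bar>(deriv ^^ k) (W f) x\<bar> \<le> C2 * graded_norm R f"
    by (rule continuous_whitney_operatorD[OF W cont, of "Suc j" 2]) blast
  obtain C3 where C3: "0 < C3" "\<And>F c t A B. F \<in> C_inf \<Longrightarrow> 0 < t \<Longrightarrow>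
      (\<And>x. x \<in> {c..c + real j * t} \<Longrightarrow> \<bar>F x\<bar> \<le> A) \<Longrightarrow>
      (\<And>x. x \<in> {c..c + real j * t} \<Longrightarrow> \<bar>(deriv ^^ Suc j) F x\<bar> \<le> B) \<Longrightarrow>
      t ^ j * \<bar>(deriv ^^ j) F c\<bar> \<le> C3 * (A + B * t ^ Suc j)"
    by (rule derivative_interpolation_inequality[of j]) blast
  obtain B where B: "1 \<le> B" "\<And>i t. i \<le> max p R \<Longrightarrow> \<bar>(deriv ^^ i) (bump_monomial j) t\<bar> \<le> B"
    using deriv_funpow_bounded_of_support[OF bump_monomial_C_inf, of "-1" 2 j "max p R"]
    by (auto simp: bump_monomial_def bump_eq_0)
  have jet: "\<bar>(deriv ^^ i) (spike_fun j k l) x\<bar> \<le> B * (l ^ j / l ^ i)"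
    if "i \<le> max p R" "0 < l" for i k l x
  proof -
    have "\<bar>(deriv ^^ i) (spike_fun j k l) x\<bar> =
        (l ^ j / l ^ i) * \<bar>(deriv ^^ i) (bump_monomial j) ((x - spike_pos k) / l)\<bar>"
      using that by (simp add: deriv_funpow_spike_fun abs_mult)
    also have "\<dots> \<le> (l ^ j / l ^ i) * B"
      using that B by (intro mult_left_mono) auto
    finally show ?thesis by (simp add: mult.commute)
  qed
  define \<alpha> where "\<alpha> = C1 * ((real p + 1) * (3 * B))"
  define \<beta> where "\<beta> = C2 * ((real R + 1) * (3 * B * 4 ^ R))"
  have pos: "0 < \<alpha>" "0 < \<beta>" using B C1(1) C2(1) by (auto simp: \<alpha>_def \<beta>_def)
  have key: "t ^ j \<le> C3 * (\<alpha> * spike_len k + \<beta> / spike_pos k ^ R * t ^ Suc j)"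
    if "0 < t" "real j * t \<le> 1" for t k
  proof -
    let ?h = "spike_pos k / 4"
    define f where "f = restrict (spike_fun j k (spike_len k)) spike_set"
    have f: "f \<in> whitney_space spike_set"
      unfolding f_def by (intro restrict_C_inf_whitney spike_fun_C_inf)
    have h: "0 < ?h" "?h \<le> 1" using spike_pos_pos[of k] spike_pos_le[of k] by auto
    have len: "0 < spike_len k" "spike_len k \<le> ?h" "spike_len k \<le> 1"
      using spike_len_pos spike_len_le[of k] spike_pos_pos[of k] spike_pos_le[of k] by auto
    \<comment> \<open>The same element of the Whitney space, now represented by the wide cut-off for
      the norms up to order \<open>R\<close>.\<close>
    have f_eq: "f = restrict (spike_fun j k ?h) spike_set"
      unfolding f_def using len by (intro restrict_ext) (simp add: spike_fun_eq)
    have "whitney_norm spike_set r f \<le> 3 * (B * spike_len k)" if "r \<le> p" for r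
      unfolding f_def
    proof (rule whitney_norm_le[OF spike_fun_C_inf])
      fix i z assume "i \<le> r"
      then have i: "i \<le> p" using that by simp
      have "spike_len k ^ j / spike_len k ^ i = spike_len k ^ (j - i)"
        using i len by (simp add: power_diff j_def)
      also have "\<dots> \<le> spike_len k ^ 1"
        using i len by (intro power_decreasing) (auto simp: j_def)
      finally show "\<bar>(deriv ^^ i) (spike_fun j k (spike_len k)) z\<bar> \<le> B * spike_len k"
        using jet[of i "spike_len k" k z] i len B
        by (intro order_trans[OF jet] mult_left_mono) auto
    qed
    then have "graded_norm p f \<le> (\<Sum>r\<le>p. 3 * (B * spike_len k))"
      unfolding graded_norm_def by (intro sum_mono) auto
    then have gp: "graded_norm p f \<le> (real p + 1) * (3 * (B * spike_len k))"
      by (simp add: algebra_simps)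
    have "whitney_norm spike_set r f \<le> 3 * (B * (4 ^ R / spike_pos k ^ R))" if "r \<le> R" for r
      unfolding f_eq
    proof (rule whitney_norm_le[OF spike_fun_C_inf])
      fix i z assume "i \<le> r"
      then have i: "i \<le> R" using that by simp
      have "?h ^ j / ?h ^ i \<le> 1 / ?h ^ R"
        using h i by (intro frac_le power_decreasing power_le_one) auto
      also have "\<dots> = 4 ^ R / spike_pos k ^ R" by (simp add: power_divide)
      finally show "\<bar>(deriv ^^ i) (spike_fun j k ?h) z\<bar> \<le> B * (4 ^ R / spike_pos k ^ R)"
        using i h B by (intro order_trans[OF jet] mult_left_mono) auto
    qed
    then have "graded_norm R f \<le> (\<Sum>r\<le>R. 3 * (B * (4 ^ R / spike_pos k ^ R)))"
      unfolding graded_norm_def by (intro sum_mono) auto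
    then have gR: "graded_norm R f \<le> (real R + 1) * (3 * (B * (4 ^ R / spike_pos k ^ R)))"
      by (simp add: algebra_simps)
    have sub: "\<bar>x\<bar> \<le> real 2" if "x \<in> {spike_pos k..spike_pos k + real j * t}" for x
      using that \<open>real j * t \<le> 1\<close> spike_pos_pos[of k] spike_pos_le[of k] by auto
    have "t ^ j * \<bar>(deriv ^^ j) (W f) (spike_pos k)\<bar> \<le>
        C3 * (\<alpha> * spike_len k + \<beta> / spike_pos k ^ R * t ^ Suc j)"
    proof (rule C3(2)[OF W_C_inf[OF f] \<open>0 < t\<close>])
      fix x assume "x \<in> {spike_pos k..spike_pos k + real j * t}"
      note x = sub[OF this]
      have "\<bar>W f x\<bar> \<le> C1 * graded_norm p f" using C1(2)[OF f le_refl x] by simp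
      also have "\<dots> \<le> C1 * ((real p + 1) * (3 * (B * spike_len k)))"
        using gp C1(1) by (intro mult_left_mono) auto
      finally show "\<bar>W f x\<bar> \<le> \<alpha> * spike_len k" by (simp add: \<alpha>_def mult_ac)
      have "\<bar>(deriv ^^ Suc j) (W f) x\<bar> \<le> C2 * graded_norm R f" by (rule C2(2)[OF f le_refl x])
      also have "\<dots> \<le> C2 * ((real R + 1) * (3 * (B * (4 ^ R / spike_pos k ^ R))))"
        using gR C2(1) by (intro mult_left_mono) auto
      finally show "\<bar>(deriv ^^ Suc j) (W f) x\<bar> \<le> \<beta> / spike_pos k ^ R"
        by (simp add: \<beta>_def mult_ac)
    qed
    moreover have "(deriv ^^ j) (W f) (spike_pos k) = fact j"
    proof -
      have "(deriv ^^ j) (W f) (spike_pos k) = (deriv ^^ j) (spike_fun j k (spike_len k)) (spike_pos k)"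
      proof (rule C_inf_derivs_eq_on[OF perfect_spike_set W_C_inf[OF f] spike_fun_C_inf])
        show "W f x = spike_fun j k (spike_len k) x" if "x \<in> spike_set" for x
          using fun_cong[OF ext[OF f], of x] that by (simp add: f_def)
        show "spike_pos k \<in> spike_set"
          using len by (auto simp: spike_set_def spike_def intro!: exI[of _ k])
      qed
      then show ?thesis
        using len by (simp add: deriv_funpow_spike_fun deriv_funpow_bump_monomial)
    qed
    ultimately have "t ^ j * fact j \<le> C3 * (\<alpha> * spike_len k + \<beta> / spike_pos k ^ R * t ^ Suc j)"
      by simp
    moreover have "t ^ j * 1 \<le> t ^ j * fact j"
      using \<open>0 < t\<close> by (intro mult_left_mono) (auto simp: fact_ge_1)
    ultimately show ?thesis by simp
  qed
  \<comment> \<open>The summand \<open>2 * C3 * \<beta>\<close> lets the term with the higher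
    derivative be absorbed into half of the left side for t = \<tau> b^R; the summand
    \<open>real j\<close> keeps the points within [-2, 2].\<close>
  define \<tau> where "\<tau> = 1 / (2 * C3 * \<beta> + real j)"
  have "0 < \<tau>" using pos C3(1) by (auto simp: \<tau>_def intro!: divide_pos_pos add_pos_nonneg)
  have *: "\<tau> ^ j \<le> 2 * C3 * \<alpha> * spike_pos k" if k: "R * j \<le> k" for k
  proof -
    define b where "b = spike_pos k"
    have b: "0 < b" "b \<le> 1" using spike_pos_pos[of k] spike_pos_le[of k] by (auto simp: b_def)
    define t where "t = \<tau> * b ^ R"
    have "0 < t" using \<open>0 < \<tau>\<close> b by (simp add: t_def)
    have den: "0 < 2 * C3 * \<beta> + real j" using \<open>0 < \<tau>\<close> by (simp add: \<tau>_def)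
    have "real j * t \<le> real j * \<tau>"
      using b \<open>0 < \<tau>\<close> by (intro mult_left_mono) (auto simp: t_def intro!: mult_left_le power_le_one)
    also have "\<dots> \<le> 1" using den pos C3(1) by (simp add: \<tau>_def field_simps)
    finally have "t ^ j \<le> C3 * (\<alpha> * spike_len k + \<beta> / b ^ R * t ^ Suc j)"
      using key[OF \<open>0 < t\<close>, of k] by (simp add: b_def)
    moreover have "C3 * (\<beta> / b ^ R * t ^ Suc j) = (C3 * \<beta> * \<tau>) * t ^ j"
      using b by (simp add: t_def)
    moreover have "(C3 * \<beta> * \<tau>) * t ^ j \<le> (1 / 2) * t ^ j"
      using den \<open>0 < t\<close> by (intro mult_right_mono) (auto simp: \<tau>_def field_simps)
    ultimately have "t ^ j \<le> 2 * C3 * \<alpha> * spike_len k"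
      by (simp add: distrib_left)
    \<comment> \<open>One power of \<open>b\<close> more than on the left side, and this is what
      tends to 0.\<close>
    also have "spike_len k \<le> b ^ (R * j + 1)"
      unfolding spike_len_def b_def[symmetric] using b k by (intro power_decreasing) auto
    finally have "\<tau> ^ j * b ^ (R * j) \<le> (2 * C3 * \<alpha> * b) * b ^ (R * j)"
      using pos C3(1) by (simp add: t_def power_mult_distrib power_mult mult_ac)
    then show ?thesis using b by (simp add: b_def)
  qed
  have "(\<lambda>k. 2 * C3 * \<alpha> * spike_pos k) \<longlonglongrightarrow> 2 * C3 * \<alpha> * 0"
    by (intro tendsto_intros spike_pos_tendsto)
  then have "\<tau> ^ j \<le> 2 * C3 * \<alpha> * 0"
    by (rule LIMSEQ_le_const) (use * in blast)
  with zero_less_power[OF \<open>0 < \<tau>\<close>, of j] show False by simp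
qed

section \<open>A Cantor set with growing branching numbers\<close>

text \<open>Closed form of the squaring recursion; the offset 3 makes \<open>mesh_small\<close>
  valid from level 0 on.\<close>

definition mesh :: "nat \<Rightarrow> real" where "mesh s = (1 / 2) ^ 2 ^ (s + 3)"

text \<open>The \<open>s + 2\<close> nodes span only \<open>s + 1\<close> steps; the additional step
  leaves room for the last subinterval.\<close>

definition width :: "nat \<Rightarrow> real" where "width s = real (s + 2) * mesh s"

fun grid :: "nat \<Rightarrow> real set" where
  "grid 0 = {0}"
| "grid (Suc s) = (\<lambda>(a, i). a + real i * mesh s) ` (grid s \<times> {..<s + 2})"

definition cantor_level :: "nat \<Rightarrow> real set" where
  "cantor_level s = (\<Union>a\<in>grid s. {a..a + width s})"

definition cantor_set :: "real set" where "cantor_set = (\<Inter>s. cantor_level s)"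

lemma mesh_pos: "0 < mesh s" by (simp add: mesh_def)

lemma mesh_Suc: "mesh (Suc s) = mesh s ^ 2"
proof -
  have "(2 :: nat) ^ (Suc s + 3) = 2 ^ (s + 3) * 2" by (simp add: power_add)
  then show ?thesis by (simp only: mesh_def power_mult)
qed

lemma mesh_small: "2 * real (s + 3) * mesh s \<le> 1"
proof -
  have "s < 2 ^ s" by (rule less_exp)
  then have "s + 4 \<le> 8 * 2 ^ s" by linarith
  then have "s + 4 \<le> 2 ^ (s + 3)" by (simp add: power_add)
  then have "mesh s \<le> (1 / 2) ^ (s + 4)"
    unfolding mesh_def by (intro power_decreasing) auto
  then have "2 * real (s + 3) * mesh s \<le> 2 * real (s + 3) * (1 / 2) ^ (s + 4)"
    by (intro mult_left_mono) auto
  also have "\<dots> = real (s + 3) / 2 ^ (s + 3)" by (simp add: power_divide power_add field_simps)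
  also have "\<dots> \<le> 1"
    using of_nat_less_two_power[of "s + 3", where 'a = real] by (simp add: divide_le_eq)
  finally show ?thesis .
qed

lemma mesh_le_1: "mesh s \<le> 1"
  unfolding mesh_def by (rule power_le_one) auto

lemma width_pos: "0 < width s"
  unfolding width_def using mesh_pos[of s] by (intro mult_pos_pos) auto

lemma mesh_le_width: "mesh s \<le> width s"
  unfolding width_def using mesh_pos[of s] by (simp add: mult_le_cancel_right1)

lemma width_Suc_le: "2 * width (Suc s) \<le> mesh s"
proof -
  have "2 * width (Suc s) = (2 * real (s + 3) * mesh s) * mesh s"
    by (simp add: width_def mesh_Suc power2_eq_square algebra_simps)
  also have "\<dots> \<le> 1 * mesh s"
    using mesh_small mesh_pos[of s] by (intro mult_right_mono) auto
  finally show ?thesis by simp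
qed

lemma finite_grid: "finite (grid s)"
  by (induction s) auto

lemma card_grid: "card (grid s) \<le> fact (Suc s)"
proof (induction s)
  case (Suc s)
  have "card (grid (Suc s)) \<le> card (grid s \<times> {..<s + 2})"
    unfolding grid.simps by (intro card_image_le) (auto simp: finite_grid)
  also have "\<dots> = (s + 2) * card (grid s)" by (simp add: card_cartesian_product)
  also have "\<dots> \<le> (s + 2) * fact (Suc s)" using Suc.IH by (intro mult_left_mono) auto
  finally show ?case by simp
qed simp

lemma grid_SucI: "a \<in> grid s \<Longrightarrow> i < s + 2 \<Longrightarrow> a + real i * mesh s \<in> grid (Suc s)"
  by force

lemma grid_SucE:
  assumes "c \<in> grid (Suc s)"
  obtains a i where "a \<in> grid s" "i < s + 2" "c = a + real i * mesh s"
  using assms by auto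

lemma grid_separated:
  "a \<in> grid (Suc s) \<Longrightarrow> b \<in> grid (Suc s) \<Longrightarrow> a \<noteq> b \<Longrightarrow> mesh s \<le> \<bar>a - b\<bar>"
proof (induction s arbitrary: a b)
  case 0
  then obtain i j where ij: "a = real i * mesh 0" "b = real j * mesh 0" by auto
  with 0 have "i \<noteq> j" by auto
  then have "1 \<le> \<bar>real i - real j\<bar>" by linarith
  then have "1 * mesh 0 \<le> \<bar>real i - real j\<bar> * mesh 0"
    using mesh_pos[of 0] by (intro mult_right_mono) auto
  also have "\<dots> = \<bar>a - b\<bar>" using mesh_pos[of 0] by (simp add: ij abs_mult flip: left_diff_distrib)
  finally show ?case by simp
next
  case (Suc s)
  let ?h = "mesh (Suc s)"
  obtain c i where a: "c \<in> grid (Suc s)" "i < Suc s + 2" "a = c + real i * ?h"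
    by (rule grid_SucE[OF Suc.prems(1)])
  obtain d j where b: "d \<in> grid (Suc s)" "j < Suc s + 2" "b = d + real j * ?h"
    by (rule grid_SucE[OF Suc.prems(2)])
  have h: "0 < ?h" by (rule mesh_pos)
  show ?case
  proof (cases "c = d")
    case True
    with Suc.prems a b have "i \<noteq> j" by auto
    then have "1 \<le> \<bar>real i - real j\<bar>" by linarith
    then have "1 * ?h \<le> \<bar>real i - real j\<bar> * ?h" using h by (intro mult_right_mono) auto
    also have "\<dots> = \<bar>a - b\<bar>" using h True a b by (simp add: abs_mult flip: left_diff_distrib)
    finally show ?thesis by simp
  next
    case False
    \<comment> \<open>Distinct parents are \<open>mesh s\<close> apart. The offsets can reduce this
      by at most \<open>width (Suc s) - ?h\<close>, and the width is at most \<open>mesh s\<close>,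
      so \<open>?h\<close> remains.\<close>
    have "\<bar>real i - real j\<bar> \<le> real (s + 2)" using a(2) b(2) by linarith
    then have "\<bar>(real i - real j) * ?h\<bar> \<le> real (s + 2) * ?h"
      using h unfolding abs_mult by (intro mult_mono) auto
    moreover have "a - b = (c - d) + (real i - real j) * ?h" using a b by (simp add: algebra_simps)
    moreover have "mesh s \<le> \<bar>c - d\<bar>" using Suc.IH a b False by blast
    moreover have "width (Suc s) \<le> mesh s"
      using width_Suc_le[of s] width_pos[of "Suc s"] by linarith
    moreover have "width (Suc s) = real (s + 2) * ?h + ?h" by (simp add: width_def algebra_simps)
    ultimately show ?thesis by linarith
  qed
qed

lemma grid_close_eq:
  assumes "a \<in> grid s" "b \<in> grid s" "\<bar>a - b\<bar> < 2 * width s"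
  shows "a = b"
proof (cases s)
  case (Suc t)
  then show ?thesis
    using grid_separated[of a t b] width_Suc_le[of t] assms by force
qed (use assms in auto)

lemma grid_inj: "inj_on (\<lambda>(a, i). a + real i * mesh s) (grid s \<times> {..<s + 2})"
proof (rule inj_onI, clarify)
  fix a i b j
  assume *: "a \<in> grid s" "i < s + 2" "b \<in> grid s" "j < s + 2" "a + real i * mesh s = b + real j * mesh s"
  have "\<bar>real i - real j\<bar> \<le> real (s + 2)" using * by linarith
  then have "\<bar>(real i - real j) * mesh s\<bar> \<le> width s"
    unfolding abs_mult width_def using mesh_pos[of s] by (intro mult_mono) auto
  moreover have "b - a = (real i - real j) * mesh s" using * by (simp add: algebra_simps)
  ultimately have "\<bar>b - a\<bar> < 2 * width s" using width_pos[of s] by linarith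
  then have "a = b" using grid_close_eq[of b s a] * by simp
  with * mesh_pos[of s] show "a = b \<and> i = j" by simp
qed

lemma node_bound:
  assumes "i < s + 2"
  shows "0 \<le> real i * mesh s" "real i * mesh s + mesh s \<le> width s"
proof -
  have "(real i + 1) * mesh s \<le> real (s + 2) * mesh s"
    using assms mesh_pos[of s] by (intro mult_right_mono) auto
  then show "real i * mesh s + mesh s \<le> width s" by (simp add: width_def algebra_simps)
qed (use mesh_pos[of s] in auto)

lemma child_interval:
  assumes "i < s + 2"
  shows "{a + real i * mesh s..a + real i * mesh s + width (Suc s)} \<subseteq> {a..a + width s}"
  using node_bound[OF assms] width_Suc_le[of s] width_pos[of "Suc s"] by auto

lemma cantor_level_Suc: "cantor_level (Suc s) \<subseteq> cantor_level s"
proof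
  fix x assume "x \<in> cantor_level (Suc s)"
  then obtain a i where "a \<in> grid s" "i < s + 2"
    "x \<in> {a + real i * mesh s..a + real i * mesh s + width (Suc s)}"
    unfolding cantor_level_def by auto
  with child_interval show "x \<in> cantor_level s" unfolding cantor_level_def by blast
qed

lemma cantor_level_antimono: "s \<le> t \<Longrightarrow> cantor_level t \<subseteq> cantor_level s"
  using cantor_level_Suc by (rule lift_Suc_antimono_le)

lemma grid_mono: "s \<le> t \<Longrightarrow> grid s \<subseteq> grid t"
proof (rule lift_Suc_mono_le)
  show "grid s \<subseteq> grid (Suc s)" for s
    using grid_SucI[of _ s 0] by auto
qed

lemma grid_subset: "grid s \<subseteq> cantor_set"
proof
  fix a assume "a \<in> grid s"
  have "a \<in> cantor_level t" for t
  proof -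
    have "a \<in> grid (max s t)" using grid_mono[of s "max s t"] \<open>a \<in> grid s\<close> by auto
    then have "a \<in> cantor_level (max s t)"
      using width_pos[of "max s t"] by (auto simp: cantor_level_def intro!: bexI[of _ a])
    then show ?thesis using cantor_level_antimono[of t "max s t"] by auto
  qed
  then show "a \<in> cantor_set" by (simp add: cantor_set_def)
qed

lemma node_in_cantor_set: "a \<in> grid s \<Longrightarrow> i < s + 2 \<Longrightarrow> a + real i * mesh s \<in> cantor_set"
  using grid_SucI grid_subset by blast

lemma cantor_setE:
  assumes "x \<in> cantor_set"
  obtains a where "a \<in> grid s" "x \<in> {a..a + width s}"
  using assms unfolding cantor_set_def cantor_level_def by blast

lemma compact_cantor_set: "compact cantor_set"
proof -
  have "compact (cantor_level s)" for s
    unfolding cantor_level_def by (intro compact_UN finite_grid compact_Icc)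
  then have "closed cantor_set" "bounded (cantor_level 0)"
    unfolding cantor_set_def using compact_imp_closed
    by (blast intro: closed_INT, blast intro: compact_imp_bounded)
  moreover have "cantor_set \<subseteq> cantor_level 0" by (auto simp: cantor_set_def)
  ultimately show ?thesis
    using bounded_subset by (auto simp: compact_eq_bounded_closed)
qed

text \<open>Every quantity that depends on the level, such as the Lebesgue constant of the nodes or the
  number of intervals, is of the form bounded here.\<close>

lemma mesh_superexponential: "\<forall>\<^sub>F s in sequentially. real (3 * s + 12) ^ (3 * s + c) * mesh s \<le> (1 / 2) ^ s"
proof -
  \<comment> \<open>Replacing the base 3s + 12 by the larger number 2^(3s + 12) turns the claim into
    this comparison of exponents of 2, quadratic against exponential.\<close>
  have "\<forall>\<^sub>F s in sequentially. (3 * real s + 12) * (3 * real s + real c) + real s \<le> 2 ^ (s + 3)"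
    by real_asymp
  then show ?thesis
  proof eventually_elim
    case (elim s)
    have "real ((3 * s + 12) * (3 * s + c) + s) \<le> real (2 ^ (s + 3))" using elim by simp
    then have le: "(3 * s + 12) * (3 * s + c) + s \<le> 2 ^ (s + 3)" by (simp only: of_nat_le_iff)
    have "real (3 * s + 12) ^ (3 * s + c) \<le> (2 ^ (3 * s + 12)) ^ (3 * s + c)"
      using of_nat_less_two_power[of "3 * s + 12", where 'a = real] by (intro power_mono) auto
    then have "real (3 * s + 12) ^ (3 * s + c) * mesh s \<le> 2 ^ ((3 * s + 12) * (3 * s + c)) * mesh s"
      using mesh_pos[of s] by (intro mult_right_mono) (auto simp: power_mult)
    also have "mesh s \<le> (1 / 2) ^ ((3 * s + 12) * (3 * s + c) + s)"
      unfolding mesh_def by (intro power_decreasing le) auto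
    finally show ?case by (simp add: power_add power_divide)
  qed
qed

lemma width_tendsto: "width \<longlonglongrightarrow> 0"
proof (rule real_tendsto_sandwich[of "\<lambda>_. 0" _ _ "\<lambda>s. (1 / 2) ^ s"])
  show "\<forall>\<^sub>F s in sequentially. width s \<le> (1 / 2) ^ s"
    using mesh_superexponential[of 1]
  proof eventually_elim
    case (elim s)
    have "real (s + 2) \<le> real (3 * s + 12) ^ 1" by simp
    also have "\<dots> \<le> real (3 * s + 12) ^ (3 * s + 1)" by (intro power_increasing) auto
    finally have "width s \<le> real (3 * s + 12) ^ (3 * s + 1) * mesh s"
      unfolding width_def using mesh_pos[of s] by (intro mult_right_mono) auto
    with elim show ?case by linarith
  qed
qed (auto intro!: always_eventually less_imp_le[OF width_pos] LIMSEQ_power_zero)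

lemma perfect_cantor_set: "perfect_set cantor_set"
  unfolding perfect_set_def
proof (intro conjI ballI)
  show "closed cantor_set" using compact_cantor_set by (rule compact_imp_closed)
  fix x assume x: "x \<in> cantor_set"
  show "x islimpt cantor_set"
    unfolding islimpt_approachable
  proof (intro allI impI)
    fix e :: real assume "0 < e"
    then obtain s where s: "width s < e"
      using order_tendstoD(2)[OF width_tendsto] by (auto simp: eventually_sequentially)
    obtain a where a: "a \<in> grid s" "x \<in> {a..a + width s}" using cantor_setE[OF x] .
    \<comment> \<open>Two distinct points of the set close to \<open>x\<close>; at least one of them
      differs from \<open>x\<close>.\<close>
    have "a \<in> cantor_set" "a + mesh s \<in> cantor_set"
      using node_in_cantor_set[OF a(1), of 0] node_in_cantor_set[OF a(1), of 1] by auto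
    moreover have "dist a x < e" "dist (a + mesh s) x < e"
      using a s mesh_pos[of s] mesh_le_width[of s] by (auto simp: dist_real_def)
    moreover have "a \<noteq> x \<or> a + mesh s \<noteq> x" using mesh_pos[of s] by auto
    ultimately show "\<exists>x'\<in>cantor_set. x' \<noteq> x \<and> dist x' x < e" by blast
  qed
qed

lemma zero_in_cantor_set: "0 \<in> cantor_set"
  using grid_subset[of 0] by simp

interpretation cantor: perfect_compact cantor_set
  by standard (use perfect_cantor_set compact_cantor_set zero_in_cantor_set in auto)

lemma infinite_cantor_set: "infinite cantor_set"
  using perfect_cantor_set zero_in_cantor_set islimpt_finite unfolding perfect_set_def by blast

section \<open>Extension from the Cantor set\<close>

lemma deriv_funpow_prod_bound:
  fixes f :: "'i \<Rightarrow> real \<Rightarrow> real"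
  assumes "finite J" "\<And>j. j \<in> J \<Longrightarrow> f j \<in> C_inf" "\<And>j. j \<in> J \<Longrightarrow> 0 \<le> r j"
    and "\<And>j k. j \<in> J \<Longrightarrow> \<bar>(deriv ^^ k) (f j) x\<bar> \<le> A j * r j ^ k"
  shows "\<bar>(deriv ^^ k) (\<lambda>x. \<Prod>j\<in>J. f j x) x\<bar> \<le> (\<Prod>j\<in>J. A j) * (\<Sum>j\<in>J. r j) ^ k"
  using assms
proof (induction J arbitrary: k rule: finite_induct)
  case empty
  have "(deriv ^^ Suc k) (\<lambda>x. 1 :: real) = (\<lambda>x. 0)" for k
    unfolding deriv_funpow_Suc by (simp add: deriv_funpow_zero)
  then show ?case by (cases k) (auto simp del: funpow.simps(2))
next
  case (insert i J)
  have "\<bar>(deriv ^^ k) (\<lambda>x. f i x * (\<Prod>j\<in>J. f j x)) x\<bar> \<le>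
      A i * (\<Prod>j\<in>J. A j) * (r i + (\<Sum>j\<in>J. r j)) ^ k"
    using insert by (intro deriv_funpow_mult_bound C_inf_prod sum_nonneg) auto
  then show ?case using insert.hyps by simp
qed

text \<open>The nodes are integers, so all denominators are at least 1 in modulus. Each linear
  factor is at most 3n with derivative at most 1, and the product rule adds up the rates 1.\<close>

lemma deriv_funpow_lagrange_basis_bound:
  assumes "i < n" "\<bar>t\<bar> \<le> 2 * real n"
  shows "\<bar>(deriv ^^ k) (poly (lagrange_basis real n i)) t\<bar> \<le> (3 * real n) ^ n * real n ^ k"
proof -
  let ?J = "{..<n} - {i}"
  let ?f = "\<lambda>j. smult (1 / (real i - real j)) [:- real j, 1:]"
  have card: "card ?J = n - 1" using assms by simp
  have n: "1 \<le> real n" using assms by simp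
  have bound: "\<bar>(deriv ^^ k) (poly (?f j)) t\<bar> \<le> (3 * real n) * 1 ^ k" if j: "j \<in> ?J" for j k
  proof -
    have "1 \<le> \<bar>real i - real j\<bar>" using j by auto
    then have inv: "\<bar>1 / (real i - real j)\<bar> \<le> 1" by (simp add: divide_le_eq)
    consider "k = 0" | "k = 1" | m where "k = Suc (Suc m)" by (cases k rule: nat.exhaust; metis One_nat_def nat.exhaust)
    then show ?thesis
    proof cases
      case 1
      have "\<bar>1 / (real i - real j)\<bar> * \<bar>t - real j\<bar> \<le> 1 * (3 * real n)"
        using inv assms j by (intro mult_mono) auto
      moreover have "poly (?f j) t = (1 / (real i - real j)) * (t - real j)"
        by (simp add: diff_divide_distrib)
      ultimately show ?thesis unfolding 1 funpow.simps(1) id_apply power_0 mult_1_right abs_mult[symmetric]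
        by (simp only: mult_1_left)
    next
      case 2
      have "(deriv ^^ 1) (poly (?f j)) t = poly (pderiv (?f j)) t"
        by (simp only: deriv_funpow_poly) simp
      also have "\<dots> = 1 / (real i - real j)" by (simp add: pderiv_smult pderiv_pCons)
      finally show ?thesis unfolding 2 using inv n by simp
    next
      case 3
      have "pderiv (pderiv (?f j)) = 0" by (simp add: pderiv_smult pderiv_pCons)
      then have "(pderiv ^^ k) (?f j) = 0"
        unfolding 3 funpow_Suc_right o_apply by (simp only: higher_pderiv_0)
      then show ?thesis using n by (simp only: deriv_funpow_poly) simp
    qed
  qed
  have "poly (lagrange_basis real n i) = (\<lambda>t. \<Prod>j\<in>?J. poly (?f j) t)"
    unfolding lagrange_basis_def poly_prod ..
  moreover have "\<bar>(deriv ^^ k) (\<lambda>t. \<Prod>j\<in>?J. poly (?f j) t) t\<bar> \<le> (\<Prod>j\<in>?J. 3 * real n) * (\<Sum>j\<in>?J. 1) ^ k"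
    by (rule deriv_funpow_prod_bound) (rule finite_Diff finite_lessThan C_inf_poly zero_le_one bound | assumption)+
  moreover have "\<dots> \<le> (3 * real n) ^ n * real n ^ k"
  proof (intro mult_mono power_mono)
    show "(\<Prod>j\<in>?J. 3 * real n) \<le> (3 * real n) ^ n"
      unfolding prod_constant card using n by (intro power_increasing) auto
    show "(\<Sum>j\<in>?J. 1) \<le> real n" using card n by (simp add: of_nat_diff)
  qed (auto intro: sum_nonneg)
  ultimately show ?thesis by simp
qed

text \<open>Lagrange interpolation at the nodes of the interval starting at \<open>a\<close>,
  rescaled to integer nodes so that the level enters only through their number and the factor
  \<open>mesh s\<close>.\<close>

definition interp :: "nat \<Rightarrow> real \<Rightarrow> (real \<Rightarrow> real) \<Rightarrow> real \<Rightarrow> real" where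
  "interp s a v x = (\<Sum>i<s + 2. v (a + real i * mesh s) * poly (lagrange_basis real (s + 2) i) ((x - a) / mesh s))"

lemma interp_poly:
  assumes "degree p < s + 2"
  shows "interp s a (poly p) x = poly p x"
proof -
  let ?q = "p \<circ>\<^sub>p [:a, mesh s:]"
  have "degree ?q < s + 2"
    using assms degree_pcompose_le[of p "[:a, mesh s:]"] mesh_pos[of s] by simp
  moreover have "inj_on real {..<s + 2}" by (auto intro: inj_onI)
  ultimately have "?q = (\<Sum>i<s + 2. smult (poly ?q (real i)) (lagrange_basis real (s + 2) i))"
    by (rule lagrange_interpolation[rotated])
  then have "poly ?q ((x - a) / mesh s) =
      poly (\<Sum>i<s + 2. smult (poly ?q (real i)) (lagrange_basis real (s + 2) i)) ((x - a) / mesh s)"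
    by (rule arg_cong)
  also have "\<dots> = interp s a (poly p) x"
    unfolding interp_def poly_sum by (simp add: poly_pcompose)
  finally show ?thesis using mesh_pos[of s] by (simp add: poly_pcompose)
qed

lemma interp_diff: "interp s a (\<lambda>x. v x - u x) x = interp s a v x - interp s a u x"
  unfolding interp_def by (simp add: left_diff_distrib sum_subtractf)

lemma interp_C_inf: "interp s a v \<in> C_inf"
  unfolding interp_def[abs_def]
  by (rule C_inf_sum, rule C_inf_mult[OF C_inf_const C_inf_affine[OF C_inf_poly]])

text \<open>A crude upper bound for the Lebesgue constant on the doubled interval: the number of
  nodes times the bound for one basis polynomial.\<close>

definition lebesgue_const :: "nat \<Rightarrow> real" where
  "lebesgue_const s = real (s + 2) * (3 * real (s + 2)) ^ (s + 2)"

lemma lebesgue_const_nonneg: "0 \<le> lebesgue_const s"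
  unfolding lebesgue_const_def by simp

lemma lebesgue_const_mono: "lebesgue_const s \<le> lebesgue_const (Suc s)"
proof -
  have "(3 * real (s + 2)) ^ (s + 2) \<le> (3 * real (Suc s + 2)) ^ (s + 2)"
    by (intro power_mono) auto
  also have "\<dots> \<le> (3 * real (Suc s + 2)) ^ (Suc s + 2)"
    by (intro power_increasing) auto
  finally show ?thesis unfolding lebesgue_const_def by (intro mult_mono) auto
qed

lemma deriv_funpow_interp_bound:
  assumes v: "\<And>i. i < s + 2 \<Longrightarrow> \<bar>v (a + real i * mesh s)\<bar> \<le> V" and x: "\<bar>x - a\<bar> \<le> 2 * width s"
  shows "\<bar>(deriv ^^ k) (interp s a v) x\<bar> \<le> lebesgue_const s * V * (real (s + 2) / mesh s) ^ k"
proof -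
  let ?L = "\<lambda>i. poly (lagrange_basis real (s + 2) i)"
  let ?t = "(x - a) / mesh s"
  have "0 \<le> V" using v[of 0] by force
  have t: "\<bar>?t\<bar> \<le> 2 * real (s + 2)"
    using x mesh_pos[of s] by (simp add: width_def divide_le_eq algebra_simps)
  have "(deriv ^^ k) (interp s a v) x =
      (\<Sum>i<s + 2. v (a + real i * mesh s) * ((deriv ^^ k) (?L i) ?t / mesh s ^ k))"
    unfolding interp_def[abs_def]
    by (subst deriv_funpow_sum)
      (auto intro: C_inf_mult[OF C_inf_const C_inf_affine[OF C_inf_poly]]
        simp only: deriv_funpow_cmult[OF C_inf_affine[OF C_inf_poly]] deriv_funpow_affine[OF C_inf_poly])
  also have "\<bar>\<dots>\<bar> \<le> (\<Sum>i<s + 2. V * ((3 * real (s + 2)) ^ (s + 2) * real (s + 2) ^ k / mesh s ^ k))"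
  proof (intro order_trans[OF sum_abs] sum_mono)
    fix i assume i: "i \<in> {..<s + 2}"
    then have "\<bar>(deriv ^^ k) (?L i) ?t\<bar> \<le> (3 * real (s + 2)) ^ (s + 2) * real (s + 2) ^ k"
      using deriv_funpow_lagrange_basis_bound[OF _ t, of i k] by blast
    then have "\<bar>(deriv ^^ k) (?L i) ?t / mesh s ^ k\<bar> \<le>
        (3 * real (s + 2)) ^ (s + 2) * real (s + 2) ^ k / mesh s ^ k"
      using mesh_pos[of s] by (simp add: divide_right_mono)
    then show "\<bar>v (a + real i * mesh s) * ((deriv ^^ k) (?L i) ?t / mesh s ^ k)\<bar> \<le>
        V * ((3 * real (s + 2)) ^ (s + 2) * real (s + 2) ^ k / mesh s ^ k)"
      unfolding abs_mult using v i \<open>0 \<le> V\<close> by (intro mult_mono) auto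
  qed
  also have "\<dots> = lebesgue_const s * V * (real (s + 2) / mesh s) ^ k"
    by (simp add: lebesgue_const_def power_divide)
  finally show ?thesis .
qed

text \<open>The passage from the interpolant of a parent interval to that of its \<open>i\<close>-th
  child, cut off around the child.\<close>

definition piece :: "nat \<Rightarrow> real \<Rightarrow> nat \<Rightarrow> (real \<Rightarrow> real) \<Rightarrow> real \<Rightarrow> real" where
  "piece s a i f x = bump ((x - (a + real i * mesh s)) / width (Suc s)) *
     (interp (Suc s) (a + real i * mesh s) f x - interp s a f x)"

lemma piece_C_inf: "piece s a i f \<in> C_inf"
  unfolding piece_def[abs_def]
  by (rule C_inf_mult[OF C_inf_affine[OF bump_C_inf] C_inf_diff[OF interp_C_inf interp_C_inf]])

lemma piece_eq_0:
  assumes "x \<le> a + real i * mesh s - width (Suc s) \<or> a + real i * mesh s + 2 * width (Suc s) \<le> x"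
  shows "piece s a i f x = 0"
proof -
  have "bump ((x - (a + real i * mesh s)) / width (Suc s)) = 0"
    using assms width_pos[of "Suc s"] by (intro bump_eq_0) (auto simp: field_simps)
  then show ?thesis by (simp add: piece_def)
qed

lemma deriv_funpow_bump_scaled_bound:
  assumes "\<And>k t. k \<le> q \<Longrightarrow> \<bar>(deriv ^^ k) bump t\<bar> \<le> B" "k \<le> q"
  shows "\<bar>(deriv ^^ k) (\<lambda>x. bump ((x - c) / width s)) x\<bar> \<le> B * (1 / mesh s) ^ k"
proof -
  have "0 \<le> B" using assms(1)[of 0 0] by force
  have "\<bar>(deriv ^^ k) (\<lambda>x. bump ((x - c) / width s)) x\<bar> =
      \<bar>(deriv ^^ k) bump ((x - c) / width s)\<bar> * (1 / width s) ^ k"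
    using width_pos[of s] by (simp add: deriv_funpow_affine[OF bump_C_inf] power_divide)
  also have "\<dots> \<le> B * (1 / mesh s) ^ k"
    using assms \<open>0 \<le> B\<close> mesh_le_width[of s] mesh_pos[of s]
    by (intro mult_mono power_mono frac_le) auto
  finally show ?thesis .
qed

text \<open>Both interpolants are compared with the same polynomial \<open>p\<close>, which they reproduce.\<close>

lemma deriv_funpow_piece_bound:
  assumes B: "\<And>k t. k \<le> q \<Longrightarrow> \<bar>(deriv ^^ k) bump t\<bar> \<le> B" and "k \<le> q" and i: "i < s + 2"
    and p: "degree p < s + 2"
    and V: "\<And>j. j < s + 2 \<Longrightarrow> \<bar>f (a + real j * mesh s) - poly p (a + real j * mesh s)\<bar> \<le> V"
      "\<And>j. j < s + 3 \<Longrightarrow> \<bar>f (a + real i * mesh s + real j * mesh (Suc s)) -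
        poly p (a + real i * mesh s + real j * mesh (Suc s))\<bar> \<le> V"
  shows "\<bar>(deriv ^^ k) (piece s a i f) x\<bar> \<le>
    B * (2 * lebesgue_const (Suc s) * V) * (real (s + 4) / mesh (Suc s)) ^ k"
proof -
  let ?c = "a + real i * mesh s"
  let ?h = "mesh (Suc s)"
  let ?g = "\<lambda>x. f x - poly p x"
  have "0 \<le> V" using V(1)[of 0] by force
  have "0 \<le> B" using B[of 0 0] by force
  have h: "0 < ?h" by (rule mesh_pos)
  show ?thesis
  proof (cases "x \<le> ?c - width (Suc s) \<or> ?c + 2 * width (Suc s) \<le> x")
    case True
    then have "(deriv ^^ k) (piece s a i f) x = 0"
      by (intro deriv_funpow_eq_0_outside[OF piece_C_inf piece_eq_0])
    then show ?thesis
      using \<open>0 \<le> V\<close> \<open>0 \<le> B\<close> h lebesgue_const_nonneg[of "Suc s"] by simp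
  next
    case False
    then have x: "?c - width (Suc s) < x" "x < ?c + 2 * width (Suc s)" by auto
    have xc: "\<bar>x - ?c\<bar> \<le> 2 * width (Suc s)"
      unfolding abs_le_iff using x width_pos[of "Suc s"] by linarith
    \<comment> \<open>Near the child \<open>x\<close> also stays in the doubled parent interval, so
      the bounds for both interpolants apply.\<close>
    have xa: "\<bar>x - a\<bar> \<le> 2 * width s"
      unfolding abs_le_iff
      using x node_bound[OF i] width_Suc_le[of s] width_pos[of "Suc s"] mesh_le_width[of s] by linarith
    have h_le: "?h \<le> mesh s"
      using width_Suc_le[of s] mesh_le_width[of "Suc s"] h by linarith
    have "interp (Suc s) ?c f y - interp s a f y = interp (Suc s) ?c ?g y - interp s a ?g y" for y
      using p by (simp add: interp_diff interp_poly)
    then have eq: "(\<lambda>y. interp (Suc s) ?c f y - interp s a f y) =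
        (\<lambda>y. interp (Suc s) ?c ?g y - interp s a ?g y)" by blast
    have diff: "\<bar>(deriv ^^ j) (\<lambda>y. interp (Suc s) ?c f y - interp s a f y) x\<bar> \<le>
        (2 * lebesgue_const (Suc s) * V) * (real (s + 3) / ?h) ^ j" for j
    proof -
      have "\<bar>(deriv ^^ j) (interp (Suc s) ?c ?g) x\<bar> \<le> lebesgue_const (Suc s) * V * (real (Suc s + 2) / ?h) ^ j"
        using V(2) xc by (intro deriv_funpow_interp_bound) (auto simp: add.commute)
      moreover have "\<bar>(deriv ^^ j) (interp s a ?g) x\<bar> \<le> lebesgue_const s * V * (real (s + 2) / mesh s) ^ j"
        using V(1) xa by (intro deriv_funpow_interp_bound) auto
      moreover have "\<dots> \<le> lebesgue_const (Suc s) * V * (real (Suc s + 2) / ?h) ^ j"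
        using h h_le \<open>0 \<le> V\<close> lebesgue_const_mono[of s] lebesgue_const_nonneg
        by (intro mult_mono power_mono frac_le mult_nonneg_nonneg) (auto intro: less_imp_le)
      ultimately have "\<bar>(deriv ^^ j) (interp (Suc s) ?c ?g) x - (deriv ^^ j) (interp s a ?g) x\<bar> \<le>
          2 * (lebesgue_const (Suc s) * V * (real (Suc s + 2) / ?h) ^ j)"
        by linarith
      then show ?thesis
        unfolding eq deriv_funpow_diff[OF interp_C_inf interp_C_inf]
        by (simp add: mult.assoc add.commute)
    qed
    \<comment> \<open>The growth rates 1 / \<open>?h\<close> of the cut-off and (s + 3) /
      \<open>?h\<close> of the interpolants add up.\<close>
    have "\<bar>(deriv ^^ k) (piece s a i f) x\<bar> \<le>
        B * (2 * lebesgue_const (Suc s) * V) * (1 / ?h + real (s + 3) / ?h) ^ k"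
      unfolding piece_def[abs_def]
    proof (rule deriv_funpow_mult_bound)
      show "\<bar>(deriv ^^ j) (\<lambda>x. bump ((x - ?c) / width (Suc s))) x\<bar> \<le> B * (1 / ?h) ^ j" if "j \<le> k" for j
        using that \<open>k \<le> q\<close> by (intro deriv_funpow_bump_scaled_bound[OF B]) auto
      show "(\<lambda>x. bump ((x - ?c) / width (Suc s))) \<in> C_inf" by (rule C_inf_affine[OF bump_C_inf])
      show "(\<lambda>y. interp (Suc s) ?c f y - interp s a f y) \<in> C_inf"
        by (rule C_inf_diff[OF interp_C_inf interp_C_inf])
    qed (use diff h in auto)
    moreover have "1 / ?h + real (s + 3) / ?h = real (s + 4) / ?h"
      by (simp flip: add_divide_distrib)
    ultimately show ?thesis by simp
  qed
qed

definition level_term :: "nat \<Rightarrow> (real \<Rightarrow> real) \<Rightarrow> real \<Rightarrow> real" where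
  "level_term s f x = (\<Sum>(a, i)\<in>grid s \<times> {..<s + 2}. piece s a i f x)"

lemma level_term_C_inf: "level_term s f \<in> C_inf"
  unfolding level_term_def[abs_def] case_prod_unfold by (rule C_inf_sum, rule piece_C_inf)

text \<open>Relative error of a polynomial approximation on an interval of level \<open>s\<close>:
  Taylor of degree \<open>m\<close> once there are enough nodes to reproduce it, otherwise the zero
  polynomial, which happens for finitely many levels only.\<close>

definition defect :: "nat \<Rightarrow> nat \<Rightarrow> real" where
  "defect m s = (if m < s + 2 then width s ^ m else 1)"

text \<open>In this order: a bound for the number of pieces, the two interpolants, the approximation
  error, and the cost of \<open>q\<close> derivatives. The degree \<open>2 * q + 1\<close> is one
  more than what \<open>mesh (Suc s)\<close>, a square, consumes.\<close>

definition rate :: "nat \<Rightarrow> nat \<Rightarrow> real" where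
  "rate q s = fact (s + 2) * (2 * lebesgue_const (Suc s)) * defect (2 * q + 1) s *
     (real (s + 4) / mesh (Suc s)) ^ q"

lemma rate_nonneg: "0 \<le> rate q s"
  unfolding rate_def defect_def
  using lebesgue_const_nonneg[of "Suc s"] mesh_pos[of "Suc s"] width_pos[of s] by simp

lemma local_poly_approx:
  assumes "f \<in> whitney_space cantor_set" "a \<in> grid s"
  obtains p where "degree p < s + 2"
    "\<And>y. y \<in> cantor_set \<Longrightarrow> y \<in> {a..a + width s} \<Longrightarrow> \<bar>f y - poly p y\<bar> \<le> cantor.graded_norm m f * defect m s"
proof (cases "m < s + 2")
  case True
  have a: "a \<in> cantor_set" using grid_subset assms(2) by blast
  obtain p :: "real poly" where p: "degree p \<le> m"
    "\<And>x. x \<in> cantor_set \<Longrightarrow> \<bar>f x - poly p x\<bar> \<le> whitney_norm cantor_set m f * \<bar>x - a\<bar> ^ m"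
    using cantor.whitney_taylor_approx[OF assms(1) a, of m] by blast
  have "\<bar>f y - poly p y\<bar> \<le> cantor.graded_norm m f * defect m s"
    if "y \<in> cantor_set" "y \<in> {a..a + width s}" for y
  proof -
    have "whitney_norm cantor_set m f * \<bar>y - a\<bar> ^ m \<le> cantor.graded_norm m f * width s ^ m"
      using that assms(1) by (intro mult_mono power_mono cantor.whitney_norm_le_graded_norm
          cantor.graded_norm_nonneg) auto
    with p(2)[OF that(1)] True show ?thesis by (simp add: defect_def)
  qed
  then show ?thesis using p(1) True by (intro that[of p]) auto
next
  case False
  have "\<bar>f y - poly 0 y\<bar> \<le> cantor.graded_norm m f * defect m s" if "y \<in> cantor_set" for y
    using cantor.abs_le_whitney_norm[OF assms(1) that, of m] False
      cantor.whitney_norm_le_graded_norm[OF assms(1), of m m]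
    by (simp add: defect_def)
  then show ?thesis by (intro that[of 0]) auto
qed

lemma deriv_funpow_level_term_bound:
  assumes f: "f \<in> whitney_space cantor_set"
    and B: "\<And>k t. k \<le> q \<Longrightarrow> \<bar>(deriv ^^ k) bump t\<bar> \<le> B" and "k \<le> q"
  shows "\<bar>(deriv ^^ k) (level_term s f) x\<bar> \<le> B * cantor.graded_norm (2 * q + 1) f * rate q s"
proof -
  let ?V = "cantor.graded_norm (2 * q + 1) f * defect (2 * q + 1) s"
  let ?r = "real (s + 4) / mesh (Suc s)"
  let ?C = "B * (2 * lebesgue_const (Suc s) * ?V) * ?r ^ q"
  have "0 \<le> B" using B[of 0 0] by force
  have V: "0 \<le> ?V"
    using cantor.graded_norm_nonneg[OF f] width_pos[of s] by (simp add: defect_def)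
  have r: "1 \<le> ?r"
    using mesh_pos[of "Suc s"] mesh_le_1[of "Suc s"] by (simp add: le_divide_eq)
  have "0 \<le> 2 * lebesgue_const (Suc s) * ?V"
    by (rule mult_nonneg_nonneg[OF _ V]) (simp add: lebesgue_const_nonneg)
  then have BV: "0 \<le> B * (2 * lebesgue_const (Suc s) * ?V)"
    by (rule mult_nonneg_nonneg[OF \<open>0 \<le> B\<close>])
  then have C: "0 \<le> ?C" by (rule mult_nonneg_nonneg) (use r in simp)
  have piece: "\<bar>(deriv ^^ k) (piece s a i f) x\<bar> \<le> ?C" if a: "a \<in> grid s" and i: "i < s + 2" for a i
  proof -
    obtain p where p: "degree p < s + 2"
      "\<And>y. y \<in> cantor_set \<Longrightarrow> y \<in> {a..a + width s} \<Longrightarrow> \<bar>f y - poly p y\<bar> \<le> ?V"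
      using local_poly_approx[OF f a, of "2 * q + 1"] by blast
    have "\<bar>(deriv ^^ k) (piece s a i f) x\<bar> \<le> B * (2 * lebesgue_const (Suc s) * ?V) * ?r ^ k"
    proof (rule deriv_funpow_piece_bound[OF B \<open>k \<le> q\<close> i p(1)])
      fix j assume j: "j < s + 2"
      have "a + real j * mesh s \<in> {a..a + width s}"
        using node_bound[OF j] mesh_pos[of s] by auto
      then show "\<bar>f (a + real j * mesh s) - poly p (a + real j * mesh s)\<bar> \<le> ?V"
        by (intro p(2) node_in_cantor_set a j)
    next
      fix j assume "j < s + 3"
      then have j: "j < Suc s + 2" by simp
      have "a + real i * mesh s + real j * mesh (Suc s) \<in>
          {a + real i * mesh s..a + real i * mesh s + width (Suc s)}"
        using node_bound[OF j] mesh_pos[of "Suc s"] by auto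
      with child_interval[OF i]
      have "a + real i * mesh s + real j * mesh (Suc s) \<in> {a..a + width s}" by blast
      then show "\<bar>f (a + real i * mesh s + real j * mesh (Suc s)) -
          poly p (a + real i * mesh s + real j * mesh (Suc s))\<bar> \<le> ?V"
        by (intro p(2) node_in_cantor_set grid_SucI a i j)
    qed
    \<comment> \<open>Since \<open>?r\<close> is at least 1, the cost at order \<open>q\<close>
      covers all lower orders.\<close>
    also have "\<dots> \<le> ?C"
      by (intro mult_left_mono power_increasing BV r \<open>k \<le> q\<close>)
    finally show ?thesis .
  qed
  define D where "D = ?C"
  have D: "0 \<le> D" using C by (simp only: D_def)
  have le_D: "\<bar>(deriv ^^ k) (piece s (fst ai) (snd ai) f) x\<bar> \<le> D"
    if "ai \<in> grid s \<times> {..<s + 2}" for ai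
    unfolding D_def by (rule piece) (use that in auto)
  have "(deriv ^^ k) (level_term s f) x =
      (\<Sum>ai\<in>grid s \<times> {..<s + 2}. (deriv ^^ k) (piece s (fst ai) (snd ai) f) x)"
    unfolding level_term_def[abs_def] case_prod_unfold
    by (subst deriv_funpow_sum[OF piece_C_inf]) (rule refl)
  also have "\<bar>\<dots>\<bar> \<le> (\<Sum>ai\<in>grid s \<times> {..<s + 2}. D)"
    by (rule order_trans[OF sum_abs sum_mono[OF le_D]])
  also have "\<dots> = real (card (grid s) * (s + 2)) * D"
    unfolding sum_constant card_cartesian_product card_lessThan ..
  also have "\<dots> \<le> real (fact (Suc s) * (s + 2)) * D"
    using card_grid[of s] D by (intro mult_right_mono of_nat_mono mult_le_mono1)
  also have "fact (Suc s) * (s + 2) = (fact (s + 2) :: nat)"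
    by (simp add: algebra_simps)
  finally have "\<bar>(deriv ^^ k) (level_term s f) x\<bar> \<le> fact (s + 2) * D" by (simp only: of_nat_fact)
  then show ?thesis by (simp only: D_def rate_def mult_ac)
qed

text \<open>For levels with enough nodes the powers of \<open>mesh s\<close> cancel except for one,
  which beats everything else by \<open>mesh_superexponential\<close>. This is where the slow growth
  of the branching numbers enters.\<close>

lemma summable_rate: "summable (rate q)"
proof (rule summable_comparison_test_ev)
  show "summable (\<lambda>s. (1 / 2 :: real) ^ s)" by (rule summable_geometric) simp
  have "\<forall>\<^sub>F s in sequentially. 2 * q + 1 < s + 2"
    using eventually_ge_at_top[of "2 * q"] by eventually_elim simp
  with mesh_superexponential[of "3 * q + 7"]
  show "\<forall>\<^sub>F s in sequentially. norm (rate q s) \<le> (1 / 2) ^ s"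
  proof eventually_elim
    case (elim s)
    \<comment> \<open>A common upper bound for all bases that occur: s + 2, s + 4, 2(s + 3) and 3(s
      + 3).\<close>
    define U where "U = real (3 * s + 12)"
    have U: "1 \<le> U" by (simp add: U_def)
    have h: "0 < mesh s" by (rule mesh_pos)
    have "rate q s = fact (s + 2) * (2 * lebesgue_const (Suc s)) * (real (s + 2) ^ (2 * q + 1) * real (s + 4) ^ q) *
        (mesh s ^ (2 * q + 1) / (mesh s ^ 2) ^ q)"
      using elim by (simp add: rate_def defect_def width_def mesh_Suc power_divide power_mult_distrib)
    also have "mesh s ^ (2 * q + 1) / (mesh s ^ 2) ^ q = mesh s"
      using h by (simp add: power_mult)
    also have "fact (s + 2) * (2 * lebesgue_const (Suc s)) * (real (s + 2) ^ (2 * q + 1) * real (s + 4) ^ q) * mesh s \<le>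
        U ^ (s + 2) * (U * U ^ (s + 3)) * (U ^ (2 * q + 1) * U ^ q) * mesh s"
    proof -
      have "fact (s + 2) \<le> real (s + 2) ^ (s + 2)"
        using fact_le_power[of "s + 2", where 'a = real] by (simp only: of_nat_power)
      also have "\<dots> \<le> U ^ (s + 2)" by (intro power_mono) (auto simp: U_def)
      finally have 1: "fact (s + 2) \<le> U ^ (s + 2)" .
      have "2 * lebesgue_const (Suc s) = (2 * real (s + 3)) * (3 * real (s + 3)) ^ (s + 3)"
      proof -
        have "Suc s + 2 = s + 3" by simp
        then show ?thesis by (simp only: lebesgue_const_def mult.assoc)
      qed
      also have "\<dots> \<le> U * U ^ (s + 3)"
        by (intro mult_mono power_mono) (auto simp: U_def)
      finally have 2: "2 * lebesgue_const (Suc s) \<le> U * U ^ (s + 3)" .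
      have 3: "real (s + 2) ^ (2 * q + 1) \<le> U ^ (2 * q + 1)" "real (s + 4) ^ q \<le> U ^ q"
        by (intro power_mono; simp add: U_def)+
      show ?thesis
        by (intro 1 2 3 mult_right_mono mult_mono)
          (use h U in \<open>auto simp: lebesgue_const_nonneg\<close>)
    qed
    also have "\<dots> = U ^ (2 * s + 3 * q + 7) * mesh s"
    proof -
      have "2 * s + 3 * q + 7 = (s + 2) + (1 + (s + 3)) + ((2 * q + 1) + q)" by simp
      then show ?thesis by (simp only: power_add power_one_right)
    qed
    also have "\<dots> \<le> U ^ (3 * s + (3 * q + 7)) * mesh s"
      using U h by (intro mult_right_mono power_increasing) auto
    also have "\<dots> \<le> (1 / 2) ^ s" using elim by (simp add: U_def)
    finally show ?case using rate_nonneg[of q s] by simp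
  qed
qed

section \<open>The extension operator and its continuity\<close>

definition root_term :: "(real \<Rightarrow> real) \<Rightarrow> real \<Rightarrow> real" where
  "root_term f x = bump ((x - 0) / width 0) * interp 0 0 f x"

lemma root_term_C_inf: "root_term f \<in> C_inf"
  unfolding root_term_def[abs_def] by (rule C_inf_mult[OF C_inf_affine[OF bump_C_inf] interp_C_inf])

lemma deriv_funpow_root_term_bound:
  assumes f: "f \<in> whitney_space cantor_set"
    and B: "\<And>k t. k \<le> q \<Longrightarrow> \<bar>(deriv ^^ k) bump t\<bar> \<le> B" and "k \<le> q"
  shows "\<bar>(deriv ^^ k) (root_term f) x\<bar> \<le>
    B * cantor.graded_norm m f * (lebesgue_const 0 * (3 / mesh 0) ^ q)"
proof -
  let ?N = "cantor.graded_norm m f"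
  have "0 \<le> B" using B[of 0 0] by force
  have N: "0 \<le> ?N" by (rule cantor.graded_norm_nonneg[OF f])
  have h: "0 < mesh 0" "mesh 0 \<le> 1" using mesh_pos mesh_le_1 by auto
  show ?thesis
  proof (cases "x \<le> - width 0 \<or> 2 * width 0 \<le> x")
    case True
    have "root_term f y = 0" if "y \<le> - width 0 \<or> 2 * width 0 \<le> y" for y
    proof -
      have "bump ((y - 0) / width 0) = 0"
        using that width_pos[of 0] by (intro bump_eq_0) (auto simp: field_simps)
      then show ?thesis by (simp add: root_term_def)
    qed
    then have "(deriv ^^ k) (root_term f) x = 0"
      using True by (intro deriv_funpow_eq_0_outside[OF root_term_C_inf])
    then show ?thesis using \<open>0 \<le> B\<close> N h lebesgue_const_nonneg[of 0] by simp
  next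
    case False
    have "\<bar>f (0 + real i * mesh 0)\<bar> \<le> ?N" if "i < 0 + 2" for i
      using cantor.abs_le_whitney_norm[OF f node_in_cantor_set[OF _ that, of 0], of m]
        cantor.whitney_norm_le_graded_norm[OF f, of m m] by simp
    then have interp: "\<bar>(deriv ^^ j) (interp 0 0 f) x\<bar> \<le> (lebesgue_const 0 * ?N) * (real (0 + 2) / mesh 0) ^ j" for j
      using False width_pos[of 0] by (intro deriv_funpow_interp_bound) auto
    have "\<bar>(deriv ^^ k) (root_term f) x\<bar> \<le> B * (lebesgue_const 0 * ?N) * (1 / mesh 0 + real (0 + 2) / mesh 0) ^ k"
      unfolding root_term_def[abs_def]
    proof (rule deriv_funpow_mult_bound)
      show "\<bar>(deriv ^^ j) (\<lambda>x. bump ((x - 0) / width 0)) x\<bar> \<le> B * (1 / mesh 0) ^ j" if "j \<le> k" for j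
        using that \<open>k \<le> q\<close> by (intro deriv_funpow_bump_scaled_bound[OF B]) auto
      show "(\<lambda>x. bump ((x - 0) / width 0)) \<in> C_inf" by (rule C_inf_affine[OF bump_C_inf])
    qed (use h interp in \<open>auto intro: interp_C_inf\<close>)
    also have "1 / mesh 0 + real (0 + 2) / mesh 0 = 3 / mesh 0"
      by (simp flip: add_divide_distrib)
    also have "B * (lebesgue_const 0 * ?N) * (3 / mesh 0) ^ k \<le> B * (lebesgue_const 0 * ?N) * (3 / mesh 0) ^ q"
      using \<open>0 \<le> B\<close> N lebesgue_const_nonneg[of 0] \<open>k \<le> q\<close> h
      by (intro mult_left_mono power_increasing mult_nonneg_nonneg) (auto simp: le_divide_eq)
    finally show ?thesis by (simp add: mult_ac)
  qed
qed

definition cantor_ext :: "(real \<Rightarrow> real) \<Rightarrow> real \<Rightarrow> real" where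
  "cantor_ext f x = root_term f x + (\<Sum>s. level_term s f x)"

lemma bump_bound:
  obtains B where "1 \<le> B" "\<And>k t. k \<le> q \<Longrightarrow> \<bar>(deriv ^^ k) bump t\<bar> \<le> B"
  using deriv_funpow_bounded_of_support[of bump "-1" 2 q] bump_C_inf bump_eq_0 that by blast

lemma level_term_series:
  assumes f: "f \<in> whitney_space cantor_set"
  shows "(\<lambda>x. \<Sum>s. level_term s f x) \<in> C_inf"
    and "(deriv ^^ q) (\<lambda>x. \<Sum>s. level_term s f x) = (\<lambda>x. \<Sum>s. (deriv ^^ q) (level_term s f) x)"
    and "summable (\<lambda>s. level_term s f x)"
proof -
  have "\<exists>B. \<forall>k t. k \<le> q \<longrightarrow> \<bar>(deriv ^^ k) bump t\<bar> \<le> B" for q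
    using bump_bound[of q] by metis
  then obtain B where B: "\<And>q k t. k \<le> q \<Longrightarrow> \<bar>(deriv ^^ k) bump t\<bar> \<le> B q" by metis
  let ?b = "\<lambda>q s. B q * cantor.graded_norm (2 * q + 1) f * rate q s"
  have bound: "\<bar>(deriv ^^ q) (level_term s f) x\<bar> \<le> ?b q s" for q s x
    using B by (intro deriv_funpow_level_term_bound[OF f]) auto
  have sum: "summable (?b q)" for q by (intro summable_mult summable_rate)
  show "(\<lambda>x. \<Sum>s. level_term s f x) \<in> C_inf"
    by (rule C_inf_series(1)[where G = "\<lambda>s. level_term s f" and B = ?b, OF level_term_C_inf bound sum])
  show "(deriv ^^ q) (\<lambda>x. \<Sum>s. level_term s f x) = (\<lambda>x. \<Sum>s. (deriv ^^ q) (level_term s f) x)"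
    by (rule C_inf_series(2)[where G = "\<lambda>s. level_term s f" and B = ?b, OF level_term_C_inf bound sum])
  show "summable (\<lambda>s. level_term s f x)"
    by (rule summable_comparison_test'[OF sum[of 0], of 0]) (use bound[of 0] in auto)
qed

lemma cantor_ext_C_inf: "f \<in> whitney_space cantor_set \<Longrightarrow> cantor_ext f \<in> C_inf"
  unfolding cantor_ext_def[abs_def] by (rule C_inf_add[OF root_term_C_inf level_term_series(1)])

text \<open>The operator loses derivatives: order \<open>q\<close> is controlled by order
  \<open>2 * q + 1\<close>, which continuity between Frechet spaces permits.\<close>

lemma cantor_ext_bound:
  "\<exists>C R. \<forall>f\<in>whitney_space cantor_set. \<forall>k\<le>q. \<forall>x. \<bar>(deriv ^^ k) (cantor_ext f) x\<bar> \<le> C * cantor.graded_norm R f"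
proof -
  obtain B where B: "1 \<le> B" "\<And>k t. k \<le> q \<Longrightarrow> \<bar>(deriv ^^ k) bump t\<bar> \<le> B"
    using bump_bound[of q] by metis
  let ?R = "2 * q + 1"
  define C where "C = B * (lebesgue_const 0 * (3 / mesh 0) ^ q + (\<Sum>s. rate q s))"
  have "\<bar>(deriv ^^ k) (cantor_ext f) x\<bar> \<le> C * cantor.graded_norm ?R f"
    if f: "f \<in> whitney_space cantor_set" and k: "k \<le> q" for f k x
  proof -
    let ?N = "cantor.graded_norm ?R f"
    have eq: "(deriv ^^ k) (cantor_ext f) x = (deriv ^^ k) (root_term f) x + (\<Sum>s. (deriv ^^ k) (level_term s f) x)"
      unfolding cantor_ext_def[abs_def]
      by (subst deriv_funpow_add[OF root_term_C_inf level_term_series(1)[OF f]])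
        (simp only: level_term_series(2)[OF f])
    have b: "\<bar>(deriv ^^ k) (level_term s f) x\<bar> \<le> B * ?N * rate q s" for s
      by (rule deriv_funpow_level_term_bound[OF f B(2) k])
    have sum: "summable (\<lambda>s. B * ?N * rate q s)" by (intro summable_mult summable_rate)
    have "\<bar>\<Sum>s. (deriv ^^ k) (level_term s f) x\<bar> \<le> (\<Sum>s. B * ?N * rate q s)"
      using norm_suminf_le[OF _ sum, of "\<lambda>s. (deriv ^^ k) (level_term s f) x"] b by simp
    also have "\<dots> = B * ?N * (\<Sum>s. rate q s)" by (rule suminf_mult[OF summable_rate])
    finally have "\<bar>\<Sum>s. (deriv ^^ k) (level_term s f) x\<bar> \<le> B * ?N * (\<Sum>s. rate q s)" .
    moreover have "\<bar>(deriv ^^ k) (root_term f) x\<bar> \<le> B * ?N * (lebesgue_const 0 * (3 / mesh 0) ^ q)"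
      by (rule deriv_funpow_root_term_bound[OF f B(2) k])
    ultimately show ?thesis unfolding eq C_def by (simp add: algebra_simps)
  qed
  then show ?thesis by blast
qed

text \<open>All nodes lie in the set, so the interpolants do not see the \<open>undefined\<close>
  values of extensional functions outside; linearity depends on this.\<close>

lemma interp_cong:
  assumes "a \<in> grid s" "\<And>x. x \<in> cantor_set \<Longrightarrow> f x = g x"
  shows "interp s a f x = interp s a g x"
  unfolding interp_def using assms node_in_cantor_set by (intro sum.cong) auto

lemma interp_add: "interp s a (\<lambda>x. v x + u x) x = interp s a v x + interp s a u x"
  unfolding interp_def by (simp add: distrib_right sum.distrib)

lemma interp_cmult: "interp s a (\<lambda>x. c * v x) x = c * interp s a v x"
  unfolding interp_def by (simp only: sum_distrib_left mult.assoc)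

lemma level_term_add:
  "level_term s (\<lambda>x\<in>cantor_set. f x + g x) x = level_term s f x + level_term s g x"
  unfolding level_term_def sum.distrib[symmetric] case_prod_unfold
proof (intro sum.cong refl)
  fix ai assume "ai \<in> grid s \<times> {..<s + 2}"
  then obtain a i where ai: "ai = (a, i)" "a \<in> grid s" "i < s + 2" by auto
  have "interp s a (\<lambda>x\<in>cantor_set. f x + g x) x = interp s a (\<lambda>x. f x + g x) x"
    "interp (Suc s) (a + real i * mesh s) (\<lambda>x\<in>cantor_set. f x + g x) x =
      interp (Suc s) (a + real i * mesh s) (\<lambda>x. f x + g x) x"
    by (intro interp_cong grid_SucI ai; simp)+
  then show "piece s (fst ai) (snd ai) (\<lambda>x\<in>cantor_set. f x + g x) x =
      piece s (fst ai) (snd ai) f x + piece s (fst ai) (snd ai) g x"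
    by (simp add: ai(1) piece_def interp_add algebra_simps)
qed

lemma level_term_cmult:
  "level_term s (\<lambda>x\<in>cantor_set. c * f x) x = c * level_term s f x"
  unfolding level_term_def sum_distrib_left case_prod_unfold
proof (intro sum.cong refl)
  fix ai assume "ai \<in> grid s \<times> {..<s + 2}"
  then obtain a i where ai: "ai = (a, i)" "a \<in> grid s" "i < s + 2" by auto
  have "interp s a (\<lambda>x\<in>cantor_set. c * f x) x = interp s a (\<lambda>x. c * f x) x"
    "interp (Suc s) (a + real i * mesh s) (\<lambda>x\<in>cantor_set. c * f x) x =
      interp (Suc s) (a + real i * mesh s) (\<lambda>x. c * f x) x"
    by (intro interp_cong grid_SucI ai; simp)+
  then show "piece s (fst ai) (snd ai) (\<lambda>x\<in>cantor_set. c * f x) x = c * piece s (fst ai) (snd ai) f x"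
    by (simp add: ai(1) piece_def interp_cmult algebra_simps)
qed

lemma cantor_ext_linear: "whitney_linear cantor_set cantor_ext"
  unfolding whitney_linear_def
proof (intro conjI ballI allI ext)
  fix f g x assume fg: "f \<in> whitney_space cantor_set" "g \<in> whitney_space cantor_set"
  have "interp 0 0 (\<lambda>x\<in>cantor_set. f x + g x) x = interp 0 0 (\<lambda>x. f x + g x) x"
    by (rule interp_cong) auto
  then have "root_term (\<lambda>x\<in>cantor_set. f x + g x) x = root_term f x + root_term g x"
    by (simp add: root_term_def interp_add algebra_simps)
  moreover have "(\<Sum>s. level_term s (\<lambda>x\<in>cantor_set. f x + g x) x) =
      (\<Sum>s. level_term s f x) + (\<Sum>s. level_term s g x)"
    unfolding level_term_add by (rule suminf_add[symmetric]) (intro level_term_series fg)+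
  ultimately show "cantor_ext (\<lambda>x\<in>cantor_set. f x + g x) x = cantor_ext f x + cantor_ext g x"
    by (simp add: cantor_ext_def)
next
  fix f c x assume f: "f \<in> whitney_space cantor_set"
  have "interp 0 0 (\<lambda>x\<in>cantor_set. c * f x) x = interp 0 0 (\<lambda>x. c * f x) x"
    by (rule interp_cong) auto
  then have "root_term (\<lambda>x\<in>cantor_set. c * f x) x = c * root_term f x"
    by (simp add: root_term_def interp_cmult algebra_simps)
  moreover have "(\<Sum>s. level_term s (\<lambda>x\<in>cantor_set. c * f x) x) = c * (\<Sum>s. level_term s f x)"
    unfolding level_term_cmult by (rule suminf_mult) (rule level_term_series(3)[OF f])
  ultimately show "cantor_ext (\<lambda>x\<in>cantor_set. c * f x) x = c * cantor_ext f x"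
    by (simp add: cantor_ext_def algebra_simps)
qed

lemma bump_on_interval: "x \<in> {c..c + width s} \<Longrightarrow> bump ((x - c) / width s) = 1"
  using width_pos[of s] by (intro bump_eq_1) (auto simp: field_simps)

text \<open>On the set the series telescopes along the intervals that contain the given point.\<close>

lemma partial_sum_eq_interp:
  assumes x: "x \<in> cantor_set"
  shows "c \<in> grid n \<Longrightarrow> x \<in> {c..c + width n} \<Longrightarrow>
    root_term f x + (\<Sum>s<n. level_term s f x) = interp n c f x"
proof (induction n arbitrary: c)
  case 0
  then show ?case using bump_on_interval[of x 0 0] by (simp add: root_term_def)
next
  case (Suc n)
  obtain a i where ai: "a \<in> grid n" "i < n + 2" "c = a + real i * mesh n"
    by (rule grid_SucE[OF Suc.prems(1)])
  have "x \<in> {a..a + width n}" using Suc.prems(2) child_interval[OF ai(2), of a] ai(3) by blast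
  note IH = Suc.IH[OF ai(1) this]
  have "level_term n f x = (\<Sum>(b, j)\<in>{(a, i)}. piece n b j f x)"
    unfolding level_term_def
  proof (rule sum.mono_neutral_right)
    show "\<forall>bj\<in>grid n \<times> {..<n + 2} - {(a, i)}. (case bj of (b, j) \<Rightarrow> piece n b j f x) = 0"
    proof
      fix bj assume "bj \<in> grid n \<times> {..<n + 2} - {(a, i)}"
      then obtain b j where bj: "b \<in> grid n" "j < n + 2" "(b, j) \<noteq> (a, i)" "bj = (b, j)" by auto
      let ?d = "b + real j * mesh n"
      \<comment> \<open>Different index pairs give different left end points, hence end points at
        least \<open>2 * width (Suc n)\<close> apart, so the cut-off around \<open>?d\<close>
        vanishes at \<open>x\<close>.\<close>
      have "?d \<noteq> c"
        using inj_onD[OF grid_inj, of n "(b, j)" "(a, i)"] bj ai by auto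
      then have "2 * width (Suc n) \<le> \<bar>?d - c\<bar>"
        using grid_close_eq[OF grid_SucI[OF bj(1,2)] Suc.prems(1)] by force
      then have "piece n b j f x = 0"
        using Suc.prems(2) by (intro piece_eq_0) auto
      then show "(case bj of (b, j) \<Rightarrow> piece n b j f x) = 0" by (simp add: bj(4))
    qed
  qed (use ai finite_grid in auto)
  also have "\<dots> = interp (Suc n) c f x - interp n a f x"
    using bump_on_interval[OF Suc.prems(2)] ai(3) by (simp add: piece_def)
  finally show ?case using IH by simp
qed

text \<open>Comparison with the Taylor polynomial of degree 1, reproduced at every level: the error
  \<open>width n\<close> tends to 0 even after multiplication by the Lebesgue constant.\<close>

lemma interp_tendsto:
  assumes f: "f \<in> whitney_space cantor_set" and x: "x \<in> cantor_set"
    and c: "\<And>n. c n \<in> grid n" "\<And>n. x \<in> {c n..c n + width n}"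
  shows "(\<lambda>n. interp n (c n) f x) \<longlonglongrightarrow> f x"
proof -
  let ?N = "cantor.graded_norm 1 f"
  have N: "0 \<le> ?N" by (rule cantor.graded_norm_nonneg[OF f])
  have bound: "\<bar>interp n (c n) f x - f x\<bar> \<le> (lebesgue_const n + 1) * ?N * width n" for n
  proof -
    obtain p where p: "degree p < n + 2"
      "\<And>y. y \<in> cantor_set \<Longrightarrow> y \<in> {c n..c n + width n} \<Longrightarrow> \<bar>f y - poly p y\<bar> \<le> ?N * defect 1 n"
      using local_poly_approx[OF f c(1), of n 1] by blast
    have d: "defect 1 n = width n" by (simp add: defect_def)
    have "\<bar>(deriv ^^ 0) (interp n (c n) (\<lambda>y. f y - poly p y)) x\<bar> \<le>
        lebesgue_const n * (?N * width n) * (real (n + 2) / mesh n) ^ 0"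
    proof (rule deriv_funpow_interp_bound)
      fix i assume i: "i < n + 2"
      have "c n + real i * mesh n \<in> {c n..c n + width n}"
        using node_bound[OF i] mesh_pos[of n] by auto
      with p(2)[OF node_in_cantor_set[OF c(1) i]] d
      show "\<bar>f (c n + real i * mesh n) - poly p (c n + real i * mesh n)\<bar> \<le> ?N * width n" by simp
    qed (use c(2)[of n] width_pos[of n] in auto)
    moreover have "interp n (c n) (\<lambda>y. f y - poly p y) x = interp n (c n) f x - poly p x"
      by (simp only: interp_diff interp_poly[OF p(1)])
    moreover have "\<bar>f x - poly p x\<bar> \<le> ?N * width n" using p(2)[OF x c(2)] d by simp
    ultimately show ?thesis by (simp add: algebra_simps)
  qed
  have lim: "(\<lambda>n. (lebesgue_const n + 1) * ?N * width n) \<longlonglongrightarrow> 0"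
  proof -
    have "(\<lambda>n. lebesgue_const n * width n) \<longlonglongrightarrow> 0"
    proof (rule real_tendsto_sandwich[of "\<lambda>_. 0" _ _ "\<lambda>s. (1 / 2) ^ s"])
      show "\<forall>\<^sub>F s in sequentially. lebesgue_const s * width s \<le> (1 / 2) ^ s"
        using mesh_superexponential[of 4]
      proof eventually_elim
        case (elim s)
        define U where "U = real (3 * s + 12)"
        have "lebesgue_const s * width s \<le> (U * U ^ (s + 2)) * (U * mesh s)"
          unfolding lebesgue_const_def width_def using mesh_pos[of s]
          by (intro mult_mono power_mono) (auto simp: U_def)
        also have "\<dots> = U ^ (s + 4) * mesh s" by (simp add: power_add eval_nat_numeral)
        also have "\<dots> \<le> U ^ (3 * s + 4) * mesh s"
          using mesh_pos[of s] by (intro mult_right_mono power_increasing) (auto simp: U_def)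
        also have "\<dots> \<le> (1 / 2) ^ s" using elim by (simp add: U_def)
        finally show ?case .
      qed
    qed (auto intro!: always_eventually mult_nonneg_nonneg lebesgue_const_nonneg
        less_imp_le[OF width_pos] LIMSEQ_power_zero)
    then have "(\<lambda>n. ?N * (lebesgue_const n * width n) + ?N * width n) \<longlonglongrightarrow> ?N * 0 + ?N * 0"
      by (intro tendsto_intros width_tendsto)
    then show ?thesis by (simp add: algebra_simps)
  qed
  have "(\<lambda>n. interp n (c n) f x - f x) \<longlonglongrightarrow> 0"
    by (rule Lim_null_comparison[OF always_eventually lim]) (use bound in auto)
  then show ?thesis by (simp add: LIM_zero_iff)
qed

lemma cantor_ext_eq:
  assumes f: "f \<in> whitney_space cantor_set" and x: "x \<in> cantor_set"
  shows "cantor_ext f x = f x"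
proof -
  have "\<forall>n. \<exists>c. c \<in> grid n \<and> x \<in> {c..c + width n}"
    using cantor_setE[OF x] by metis
  then obtain c where c: "\<And>n. c n \<in> grid n" "\<And>n. x \<in> {c n..c n + width n}" by metis
  have "(\<lambda>n. root_term f x + (\<Sum>s<n. level_term s f x)) \<longlonglongrightarrow> cantor_ext f x"
    unfolding cantor_ext_def by (intro tendsto_intros summable_LIMSEQ level_term_series(3)[OF f])
  moreover have "(\<lambda>n. root_term f x + (\<Sum>s<n. level_term s f x)) \<longlonglongrightarrow> f x"
    unfolding partial_sum_eq_interp[OF x c] by (rule interp_tendsto[OF f x c])
  ultimately show ?thesis by (rule LIMSEQ_unique)
qed

lemma extension_property_cantor_set: "extension_property cantor_set"
  unfolding extension_property_def
proof (intro exI[of _ cantor_ext] conjI ballI)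
  show "continuous_map (whitney_topology cantor_set) C_inf_topology cantor_ext"
    by (rule cantor.continuous_whitney_operatorI[OF cantor_ext_linear cantor_ext_C_inf cantor_ext_bound])
  fix f assume f: "f \<in> whitney_space cantor_set"
  then have "f \<in> extensional cantor_set" by (auto simp: whitney_space_def)
  with cantor_ext_eq[OF f] show "restrict (cantor_ext f) cantor_set = f"
    by (auto simp: extensional_def restrict_def fun_eq_iff)
qed (rule cantor_ext_linear)

section \<open>Markov factors of the Cantor set\<close>

lemma fact_mesh_le:
  "\<forall>\<^sub>F t in sequentially. fact (t + 3) * mesh t \<le> 1"
  using mesh_superexponential[of 3]
proof eventually_elim
  case (elim t)
  have "fact (t + 3) \<le> real (t + 3) ^ (t + 3)"
    using fact_le_power[of "t + 3", where 'a = real] by (simp only: of_nat_power)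
  also have "\<dots> \<le> real (3 * t + 12) ^ (t + 3)" by (intro power_mono) auto
  also have "\<dots> \<le> real (3 * t + 12) ^ (3 * t + 3)" by (intro power_increasing) auto
  finally have "fact (t + 3) * mesh t \<le> real (3 * t + 12) ^ (3 * t + 3) * mesh t"
    using mesh_pos[of t] by (intro mult_right_mono) auto
  also have "\<dots> \<le> (1 / 2) ^ t" by (rule elim)
  also have "\<dots> \<le> 1" by (rule power_le_one) auto
  finally show ?case .
qed

definition grid_poly :: "nat \<Rightarrow> complex poly" where
  "grid_poly s = (\<Prod>a\<in>grid s. [:- of_real a, 1:])"

lemma degree_grid_poly: "degree (grid_poly s) = card (grid s)"
  unfolding grid_poly_def by (subst degree_prod_eq_sum_degree) auto

lemma norm_grid_poly: "norm (poly (grid_poly s) (of_real x)) = (\<Prod>a\<in>grid s. \<bar>x - a\<bar>)"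
proof -
  have "norm (poly (grid_poly s) (of_real x)) = (\<Prod>a\<in>grid s. norm (complex_of_real (x - a)))"
    by (simp add: grid_poly_def poly_prod prod_norm)
  then show ?thesis by (simp only: norm_of_real)
qed

lemma norm_pderiv_grid_poly:
  assumes c: "c \<in> grid s"
  shows "norm (poly (pderiv (grid_poly s)) (of_real c)) = (\<Prod>a\<in>grid s - {c}. \<bar>c - a\<bar>)"
proof -
  let ?f = "\<lambda>a. [:- complex_of_real a, 1:]"
  have split: "grid_poly s = ?f c * (\<Prod>a\<in>grid s - {c}. ?f a)"
    unfolding grid_poly_def by (rule prod.remove[OF finite_grid c])
  have "poly (pderiv (grid_poly s)) (of_real c) = poly (\<Prod>a\<in>grid s - {c}. ?f a) (of_real c)"
    unfolding split pderiv_mult by (simp add: pderiv_pCons)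
  then have "norm (poly (pderiv (grid_poly s)) (of_real c)) = (\<Prod>a\<in>grid s - {c}. norm (complex_of_real (c - a)))"
    by (simp add: poly_prod prod_norm)
  then show ?thesis by (simp only: norm_of_real)
qed

text \<open>Near a node \<open>c\<close> the product over the other nodes hardly differs from its value at \<open>c\<close>, since
  the intervals are short compared to their distances.\<close>

lemma grid_poly_small:
  assumes x: "x \<in> cantor_set" and t: "fact (t + 3) * mesh t \<le> 1"
  obtains c where "c \<in> grid (Suc t)"
    "norm (poly (grid_poly (Suc t)) (of_real x)) \<le>
      3 * width (Suc t) * norm (poly (pderiv (grid_poly (Suc t))) (of_real c))"
proof -
  let ?A = "grid (Suc t)"
  let ?w = "width (Suc t)"
  obtain c where c: "c \<in> ?A" "x \<in> {c..c + ?w}" using cantor_setE[OF x] .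
  have h: "0 < mesh t" by (rule mesh_pos)
  \<comment> \<open>Relative displacement: moving from \<open>c\<close> to \<open>x\<close> changes
    the distance to any other node by a factor at most 1 + \<open>r\<close>.\<close>
  define r where "r = ?w / mesh t"
  have r: "0 \<le> r" using h width_pos[of "Suc t"] by (simp add: r_def)
  have r_eq: "r = real (t + 3) * mesh t"
    using h by (simp add: r_def width_def mesh_Suc power2_eq_square)
  have card: "real (card (?A - {c})) * r \<le> 1"
  proof -
    have "card (?A - {c}) \<le> fact (t + 2)"
      using card_grid[of "Suc t"] card_Diff1_le[of ?A c] by simp
    then have "real (card (?A - {c})) * r \<le> real (fact (t + 2)) * r"
      using r by (intro mult_right_mono of_nat_mono)
    also have "real (fact (t + 2)) * r = fact (t + 3) * mesh t"
      unfolding r_eq by (simp add: eval_nat_numeral algebra_simps)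
    finally show ?thesis using t by linarith
  qed
  have "norm (poly (grid_poly (Suc t)) (of_real x)) = \<bar>x - c\<bar> * (\<Prod>a\<in>?A - {c}. \<bar>x - a\<bar>)"
    unfolding norm_grid_poly by (rule prod.remove[OF finite_grid c(1)])
  also have "\<dots> \<le> ?w * (\<Prod>a\<in>?A - {c}. \<bar>c - a\<bar> * (1 + r))"
  proof (intro mult_mono prod_mono conjI)
    fix a assume a: "a \<in> ?A - {c}"
    have "mesh t \<le> \<bar>c - a\<bar>" using a c by (intro grid_separated) auto
    then have "?w \<le> \<bar>c - a\<bar> * r"
      using h width_pos[of "Suc t"] by (simp add: r_def field_simps)
    moreover have "\<bar>x - a\<bar> \<le> \<bar>c - a\<bar> + ?w" using c by auto
    ultimately show "\<bar>x - a\<bar> \<le> \<bar>c - a\<bar> * (1 + r)" by (simp add: algebra_simps)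
  qed (use c width_pos[of "Suc t"] in \<open>auto intro: prod_nonneg\<close>)
  also have "\<dots> = ?w * ((\<Prod>a\<in>?A - {c}. \<bar>c - a\<bar>) * (1 + r) ^ card (?A - {c}))"
    by (simp add: prod.distrib)
  also have "(1 + r) ^ card (?A - {c}) \<le> 3"
  proof -
    \<comment> \<open>The number of nodes times \<open>r\<close> is at most 1, so the accumulated
      factor stays below e.\<close>
    have "(1 + r) ^ card (?A - {c}) \<le> exp r ^ card (?A - {c})"
      using r by (intro power_mono exp_ge_add_one_self) auto
    also have "\<dots> = exp (real (card (?A - {c})) * r)" by (rule exp_of_nat_mult[symmetric])
    also have "\<dots> \<le> exp 1" using card by simp
    also have "\<dots> \<le> 3" by (rule exp_le)
    finally show ?thesis .
  qed
  finally have "norm (poly (grid_poly (Suc t)) (of_real x)) \<le> ?w * ((\<Prod>a\<in>?A - {c}. \<bar>c - a\<bar>) * 3)"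
    using width_pos[of "Suc t"] by (simp add: mult_left_mono prod_nonneg)
  then show ?thesis
    using c(1) by (intro that[of c]) (simp_all add: norm_pderiv_grid_poly mult_ac)
qed

text \<open>Tested with \<open>grid_poly (Suc t)\<close>, which is small on the whole set compared
  with its derivative at some node; there are at most \<open>fact (t + 2)\<close> nodes, so the
  degree is admissible.\<close>

lemma markov_factor_cantor_set_ge:
  assumes t: "fact (t + 3) * mesh t \<le> 1" and n: "fact (t + 2) \<le> n"
  shows "1 / (3 * width (Suc t)) \<le> markov_factor n (of_real ` cantor_set)"
proof (rule markov_factor_ge)
  let ?K = "complex_of_real ` cantor_set"
  let ?P = "grid_poly (Suc t)"
  show K: "compact ?K"
    by (intro compact_continuous_image compact_cantor_set continuous_intros)
  show inf: "infinite ?K"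
    using infinite_cantor_set by (subst finite_image_iff) (auto intro: inj_onI)
  have ne: "?K \<noteq> {}" using zero_in_cantor_set by blast
  show "degree ?P \<le> n" using card_grid[of "Suc t"] n by (simp add: degree_grid_poly)
  have w: "0 < width (Suc t)" by (rule width_pos)
  have "?P \<noteq> 0" by (auto simp: grid_poly_def prod_zero_iff finite_grid)
  \<comment> \<open>A nonzero polynomial cannot vanish on an infinite set.\<close>
  show "0 < poly_sup_norm ?K ?P"
  proof (rule ccontr)
    assume "\<not> 0 < poly_sup_norm ?K ?P"
    then have "poly ?P z = 0" if "z \<in> ?K" for z
      using poly_sup_norm_upper[OF K that, of ?P] by (metis norm_le_zero_iff not_less order_trans)
    then have "?K \<subseteq> {z. poly ?P z = 0}" by blast
    then show False
      using poly_roots_finite[OF \<open>?P \<noteq> 0\<close>] inf finite_subset by blast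
  qed
  have "poly_sup_norm ?K ?P \<le> 3 * width (Suc t) * poly_sup_norm ?K (pderiv ?P)"
  proof (rule poly_sup_norm_least[OF ne])
    fix z assume "z \<in> ?K"
    then obtain x where x: "x \<in> cantor_set" "z = of_real x" by blast
    obtain c where c: "c \<in> grid (Suc t)"
      "norm (poly ?P (of_real x)) \<le> 3 * width (Suc t) * norm (poly (pderiv ?P) (of_real c))"
      using grid_poly_small[OF x(1) t] .
    have "norm (poly (pderiv ?P) (of_real c)) \<le> poly_sup_norm ?K (pderiv ?P)"
      by (intro poly_sup_norm_upper[OF K] imageI subsetD[OF grid_subset c(1)])
    then have "3 * width (Suc t) * norm (poly (pderiv ?P) (of_real c)) \<le>
        3 * width (Suc t) * poly_sup_norm ?K (pderiv ?P)"
      using w by (intro mult_left_mono) auto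
    with c(2) show "norm (poly ?P z) \<le> 3 * width (Suc t) * poly_sup_norm ?K (pderiv ?P)"
      unfolding x(2) by (rule order_trans)
  qed
  then show "1 / (3 * width (Suc t)) * poly_sup_norm ?K ?P \<le> poly_sup_norm ?K (pderiv ?P)"
    using w by (simp add: field_simps)
qed

text \<open>The hypothesis also bounds the factor 36 n^3 by 2 * 8^(L+1), and 1 /
  \<open>spike_len L\<close> contributes the exponent (L+1)(L+2).\<close>

lemma markov_factor_spike_set_bounds:
  assumes L: "24 * real n ^ 3 \<le> 8 ^ Suc L"
  shows "0 \<le> markov_factor n (of_real ` spike_set)"
    "markov_factor n (of_real ` spike_set) \<le> 2 * 8 ^ (Suc L * (L + 3))"
proof -
  have ne: "complex_of_real ` spike_set \<noteq> {}" by (auto simp: spike_set_def)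
  note bounds = markov_factor_le[OF markov_spike_set[OF L] ne]
  show "0 \<le> markov_factor n (of_real ` spike_set)" by (rule bounds)
  have "1 / spike_len L = 8 ^ (Suc L * (L + 2))"
    by (simp only: spike_len_def spike_pos_def power_mult power_one_over power_one divide_divide_eq_right mult_1_left div_by_1)
  then have eq: "36 * real n ^ 3 / spike_len L = 36 * real n ^ 3 * 8 ^ (Suc L * (L + 2))"
    by (metis times_divide_eq_right mult.right_neutral)
  have "0 \<le> (8 :: real) ^ Suc L" by simp
  with L have "36 * real n ^ 3 \<le> 2 * 8 ^ Suc L" by linarith
  then have "36 * real n ^ 3 * 8 ^ (Suc L * (L + 2)) \<le> 2 * 8 ^ Suc L * 8 ^ (Suc L * (L + 2))"
    by (intro mult_right_mono) auto
  also have "\<dots> = 2 * 8 ^ (Suc L * (L + 3))"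
  proof -
    have "Suc L * (L + 3) = Suc L + Suc L * (L + 2)" by (simp add: algebra_simps)
    then show ?thesis by (simp only: power_add mult.assoc)
  qed
  finally show "markov_factor n (of_real ` spike_set) \<le> 2 * 8 ^ (Suc L * (L + 3))"
    using bounds(2) eq by linarith
qed

text \<open>On this range of \<open>n\<close> one set gains two powers of 1 / \<open>mesh t\<close>
  up to the factor \<open>t + 3\<close>, while \<open>expo\<close> caps the other at 2 /
  \<open>mesh t\<close>.\<close>

lemma markov_ratio_bound:
  assumes t: "fact (t + 3) * mesh t \<le> 1" and n: "fact (t + 2) \<le> n" "n \<le> fact (t + 3)"
    and expo: "3 * (((t + 3) ^ 2 + 2) * ((t + 3) ^ 2 + 4)) \<le> 2 ^ (t + 3)"
  shows "\<bar>markov_factor n (of_real ` spike_set) / markov_factor n (of_real ` cantor_set)\<bar> \<le>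
    6 * real (t + 3) * mesh t"
proof -
  \<comment> \<open>From n <= (t + 3)! <= 2^((t + 3)^2) follows n^3 <= 8^((t + 3)^2), and 24 <= 8^2
    explains the offset in \<open>Suc ?L\<close>.\<close>
  let ?L = "(t + 3) ^ 2 + 1"
  have h: "0 < mesh t" by (rule mesh_pos)
  have "real n \<le> 2 ^ (t + 3) ^ 2"
  proof -
    have "real n \<le> real (fact (t + 3))" using n(2) by (simp only: of_nat_le_iff)
    also have "\<dots> \<le> real (t + 3) ^ (t + 3)"
      using fact_le_power[of "t + 3", where 'a = real] by (simp only: of_nat_power of_nat_fact)
    also have "\<dots> \<le> (2 ^ (t + 3)) ^ (t + 3)"
      using of_nat_less_two_power[of "t + 3", where 'a = real] by (intro power_mono) auto
    also have "\<dots> = 2 ^ (t + 3) ^ 2" by (simp only: power2_eq_square power_mult)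
    finally show ?thesis .
  qed
  then have "real n ^ 3 \<le> (2 ^ (t + 3) ^ 2) ^ 3" by (intro power_mono) auto
  also have "(2 ^ (t + 3) ^ 2) ^ 3 = (8 :: real) ^ (t + 3) ^ 2"
    by (simp add: power_mult[symmetric] mult.commute) (simp add: power_mult)
  finally have "real n ^ 3 \<le> 8 ^ (t + 3) ^ 2" .
  moreover have "0 \<le> (8 :: real) ^ (t + 3) ^ 2" by simp
  ultimately have "24 * real n ^ 3 \<le> 64 * 8 ^ (t + 3) ^ 2" by linarith
  also have "\<dots> = 8 ^ Suc ?L" by simp
  finally have L: "24 * real n ^ 3 \<le> 8 ^ Suc ?L" .
  note K2 = markov_factor_spike_set_bounds[OF L]
  note K1 = markov_factor_cantor_set_ge[OF t n(1)]
  have w: "0 < width (Suc t)" by (rule width_pos)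
  have K1_pos: "0 < markov_factor n (of_real ` cantor_set)"
    by (rule less_le_trans[OF _ K1]) (use w in simp)
  have "Suc ?L * (?L + 3) = ((t + 3) ^ 2 + 2) * ((t + 3) ^ 2 + 4)" by simp
  then have "(8 :: real) ^ (Suc ?L * (?L + 3)) = 2 ^ (3 * (((t + 3) ^ 2 + 2) * ((t + 3) ^ 2 + 4)))"
    by (simp only: power_mult) simp
  also have "\<dots> \<le> 2 ^ 2 ^ (t + 3)" using expo by (intro power_increasing) auto
  also have "\<dots> = 1 / mesh t" by (simp add: mesh_def power_one_over)
  finally have "markov_factor n (of_real ` spike_set) \<le> 2 / mesh t" using K2(2) by simp
  then have "markov_factor n (of_real ` spike_set) / markov_factor n (of_real ` cantor_set) \<le>
      (2 / mesh t) / (1 / (3 * width (Suc t)))"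
    using K1 K2(1) w h by (intro frac_le) auto
  also have "\<dots> = 6 * real (t + 3) * mesh t"
    using h by (simp add: width_def mesh_Suc power2_eq_square)
  finally show ?thesis using K2(1) K1_pos by simp
qed

text \<open>Consecutive factorial ranges cover all large \<open>n\<close>, so statements that hold
  eventually in \<open>t\<close> transfer to \<open>n\<close>; the witness is the greatest
  \<open>t\<close> whose lower bound holds.\<close>

lemma fact_interval:
  assumes "fact (N + 2) \<le> (n :: nat)"
  obtains t where "N \<le> t" "fact (t + 2) \<le> n" "n \<le> fact (t + 3)"
proof -
  define P where "P t \<longleftrightarrow> fact (t + 2) \<le> n" for t
  have bound: "t \<le> n" if "P t" for t
    using that fact_ge_self[of "t + 2"] by (simp add: P_def)
  define t where "t = Greatest P"
  have "P N" using assms by (simp add: P_def)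
  then have "P t" "N \<le> t"
    unfolding t_def using bound by (blast intro: GreatestI_nat Greatest_le_nat)+
  have "\<not> P (Suc t)"
    using Greatest_le_nat[of P "Suc t" n] bound by (auto simp: t_def)
  then have "n \<le> fact (t + 3)" by (simp add: P_def eval_nat_numeral)
  with \<open>P t\<close> \<open>N \<le> t\<close> show ?thesis by (intro that[of t]) (auto simp: P_def)
qed

lemma markov_ratio_tendsto:
  "(\<lambda>n. markov_factor n (of_real ` spike_set) / markov_factor n (of_real ` cantor_set)) \<longlonglongrightarrow> 0"
proof (rule LIMSEQ_I)
  fix e :: real assume "0 < e"
  have lim: "\<forall>\<^sub>F t in sequentially. 6 * real (t + 3) * mesh t < e"
  proof -
    have "\<forall>\<^sub>F t in sequentially. (1 / 2) ^ t < e"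
      using LIMSEQ_power_zero[of "1 / 2 :: real"] \<open>0 < e\<close> by (intro order_tendstoD) auto
    with mesh_superexponential[of 2] show ?thesis
    proof eventually_elim
      case (elim t)
      have "6 * real (t + 3) \<le> real (3 * t + 12) ^ 2" by (simp add: power2_eq_square algebra_simps)
      also have "\<dots> \<le> real (3 * t + 12) ^ (3 * t + 2)" by (intro power_increasing) auto
      finally have "6 * real (t + 3) * mesh t \<le> real (3 * t + 12) ^ (3 * t + 2) * mesh t"
        using mesh_pos[of t] by (intro mult_right_mono) auto
      with elim show ?case by linarith
    qed
  qed
  have expo: "\<forall>\<^sub>F t in sequentially. 3 * (((t + 3) ^ 2 + 2) * ((t + 3) ^ 2 + 4)) \<le> 2 ^ (t + 3)"
  proof -
    have "\<forall>\<^sub>F t in sequentially. 3 * (((real t + 3) ^ 2 + 2) * ((real t + 3) ^ 2 + 4)) \<le> 2 ^ (t + 3)"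
      by real_asymp
    then show ?thesis
    proof eventually_elim
      case (elim t)
      then have "real (3 * (((t + 3) ^ 2 + 2) * ((t + 3) ^ 2 + 4))) \<le> real (2 ^ (t + 3))"
        by (simp only: of_nat_mult of_nat_add of_nat_power of_nat_numeral)
      then show ?case by (simp only: of_nat_le_iff)
    qed
  qed
  have "\<forall>\<^sub>F t in sequentially. fact (t + 3) * mesh t \<le> 1 \<and> 6 * real (t + 3) * mesh t < e \<and>
      3 * (((t + 3) ^ 2 + 2) * ((t + 3) ^ 2 + 4)) \<le> 2 ^ (t + 3)"
    by (intro eventually_conj fact_mesh_le lim expo)
  then obtain N where N: "\<And>t. N \<le> t \<Longrightarrow> fact (t + 3) * mesh t \<le> 1"
    "\<And>t. N \<le> t \<Longrightarrow> 6 * real (t + 3) * mesh t < e"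
    "\<And>t. N \<le> t \<Longrightarrow> 3 * (((t + 3) ^ 2 + 2) * ((t + 3) ^ 2 + 4)) \<le> 2 ^ (t + 3)"
    by (auto simp only: eventually_sequentially)
  have "norm (markov_factor n (of_real ` spike_set) / markov_factor n (of_real ` cantor_set) - 0) < e"
    if n: "fact (N + 2) \<le> n" for n
  proof -
    obtain t where t: "N \<le> t" "fact (t + 2) \<le> n" "n \<le> fact (t + 3)" by (rule fact_interval[OF n])
    show ?thesis
      using markov_ratio_bound[OF N(1)[OF t(1)] t(2,3) N(3)[OF t(1)]] N(2)[OF t(1)] by simp
  qed
  then show "\<exists>no. \<forall>n\<ge>no. norm (markov_factor n (of_real ` spike_set) / markov_factor n (of_real ` cantor_set) - 0) < e"
    by blast
qed

theorem proposition10p1: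
  "\<exists>K1 K2 :: real set.
     infinite K1 \<and> compact K1 \<and> perfect_set K1 \<and>
     infinite K2 \<and> compact K2 \<and> perfect_set K2 \<and>
     extension_property K1 \<and> \<not> extension_property K2 \<and>
     (\<lambda>n. markov_factor n (of_real ` K2) / markov_factor n (of_real ` K1)) \<longlonglongrightarrow> 0"
proof (rule exI[of _ cantor_set], rule exI[of _ spike_set], intro conjI)
  have "infinite {-1..0 :: real}" by simp
  then show "infinite spike_set"
    by (rule contrapos_nn) (auto simp: spike_set_def)
qed (rule infinite_cantor_set compact_cantor_set perfect_cantor_set compact_spike_set perfect_spike_set
    extension_property_cantor_set not_extension_property_spike_set markov_ratio_tendsto)+

end
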